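(* Let $\Xi=\{\xi_k\}_{k\in\mathbb{Z}}$ be a stationary, centered, finitely dependent, complex Gaussian process with unit variance, and let $f(z)=\sum_{k=0}^\infty\xi_kz^k$. When the spectral density of $\Xi$ has zeros $\theta_j$ of multiplicity $2k_j$ for $j=1,2,\dots,p$, set $\alpha=(2k-1)/(2k)$ with $k=\max_{1\le j\le p}k_j$; set $\alpha=0$ otherwise. For $r\in(0,1)$ let $N_f(r)$ be the number of zeros of $f$ in $\{z\in\mathbb{C}:|z|<r\}$. Then there exists a positive constant $C_\Xi$ such that, as $r\to1_-$, $$\mathbb{E}N_f(r)=\frac{r^2}{1-r^2}-C_\Xi(1-r^2)^{-\alpha}+o\left((1-r^2)^{-\alpha}\right).$$
   Context: The covariance function of $\Xi$ is $\mathbb{E}[\xi_k\overline{\xi_l}]=\gamma(l-k)$ for $k,l\in\mathbb{Z}$, with $\gamma(0)=1$ and $\gamma(-k)=\overline{\gamma(k)}$. Complex Gaussian processes are circularly symmetric, so that their law is determined by this covariance. The process is finitely dependent if $\gamma(k)=0$ for all $|k|$ sufficiently large; its spectral density is then the non-negative trigonometric polynomial $\theta\mapsto 1+G(e^{\sqrt{-1}\theta})+\overline{G(e^{\sqrt{-1}\theta})}$, where $G(z)=\sum_{k\ge1}\overline{\gamma(k)}z^k$. The zeros of the spectral density are its zeros on the circle $\mathbb{R}/2\pi\mathbb{Z}$, whose multiplicities are even.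
   Formalization: The formal theorem additionally assumes γ(k) ≠ 0 for some k ≠ 0: for an i.i.d. sequence the expected number of zeros is exactly r²/(1−r²) with α = 0, so no positive constant C_Ξ exists. *)

theory Defs
  imports "HOL-Probability.Probability" "HOL-Complex_Analysis.Complex_Analysis"
begin

text \<open>Degenerate (almost surely constant) variables count as Gaussian.\<close>

definition real_gaussian :: "'a measure \<Rightarrow> ('a \<Rightarrow> real) \<Rightarrow> bool" where
  "real_gaussian M X \<longleftrightarrow> X \<in> borel_measurable M \<and>
     ((\<exists>\<mu>. AE \<omega> in M. X \<omega> = \<mu>) \<or>
      (\<exists>\<mu> \<sigma>. \<sigma> > 0 \<and> distributed M lborel X (\<lambda>x. ennreal (normal_density \<mu> \<sigma> x))))"

definition process_law :: "'a measure \<Rightarrow> (int \<Rightarrow> 'a \<Rightarrow> complex) \<Rightarrow> (int \<Rightarrow> complex) measure" where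
  "process_law M \<xi> = distr M (\<Pi>\<^sub>M k\<in>UNIV. borel) (\<lambda>\<omega> k. \<xi> k \<omega>)"

text \<open>
  Joint Gaussianity: since \<open>Re (a * x) = Re a * Re x - Im a * Im x\<close>, the variables below are
  exactly the finite real linear combinations of the real and imaginary parts of the process.
  The last conjunct is circular symmetry.
\<close>

definition complex_gaussian_process :: "'a measure \<Rightarrow> (int \<Rightarrow> 'a \<Rightarrow> complex) \<Rightarrow> bool" where
  "complex_gaussian_process M \<xi> \<longleftrightarrow>
     (\<forall>k. \<xi> k \<in> borel_measurable M) \<and>
     (\<forall>S a. finite S \<longrightarrow> real_gaussian M (\<lambda>\<omega>. Re (\<Sum>k\<in>S. a k * \<xi> k \<omega>))) \<and>
     (\<forall>\<phi>. process_law M (\<lambda>k \<omega>. cis \<phi> * \<xi> k \<omega>) = process_law M \<xi>)"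

definition stationary_process :: "'a measure \<Rightarrow> (int \<Rightarrow> 'a \<Rightarrow> complex) \<Rightarrow> bool" where
  "stationary_process M \<xi> \<longleftrightarrow> (\<forall>n. process_law M (\<lambda>k. \<xi> (k + n)) = process_law M \<xi>)"

definition centered_process :: "'a measure \<Rightarrow> (int \<Rightarrow> 'a \<Rightarrow> complex) \<Rightarrow> bool" where
  "centered_process M \<xi> \<longleftrightarrow> (\<forall>k. (\<integral>\<omega>. \<xi> k \<omega> \<partial>M) = 0)"

definition unit_variance :: "'a measure \<Rightarrow> (int \<Rightarrow> 'a \<Rightarrow> complex) \<Rightarrow> bool" where
  "unit_variance M \<xi> \<longleftrightarrow> (\<forall>k. (\<integral>\<omega>. (cmod (\<xi> k \<omega>))\<^sup>2 \<partial>M) = 1)"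

text \<open>For a stationary process \<open>E[\<xi>\<^sub>k * cnj \<xi>\<^sub>l]\<close> depends only on \<open>n = l - k\<close>; here \<open>k = 0\<close>.\<close>

definition autocov :: "'a measure \<Rightarrow> (int \<Rightarrow> 'a \<Rightarrow> complex) \<Rightarrow> int \<Rightarrow> complex" where
  "autocov M \<xi> n = (\<integral>\<omega>. \<xi> 0 \<omega> * cnj (\<xi> n \<omega>) \<partial>M)"

definition finitely_dependent :: "'a measure \<Rightarrow> (int \<Rightarrow> 'a \<Rightarrow> complex) \<Rightarrow> bool" where
  "finitely_dependent M \<xi> \<longleftrightarrow> (\<exists>m. \<forall>k. \<bar>k\<bar> > m \<longrightarrow> autocov M \<xi> k = 0)"

text \<open>Only finitely many terms are non-zero when the process is finitely dependent.\<close>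

definition G_fun :: "(int \<Rightarrow> complex) \<Rightarrow> complex \<Rightarrow> complex" where
  "G_fun \<gamma> z = (\<Sum>k. cnj (\<gamma> (int (Suc k))) * z ^ Suc k)"

text \<open>The complex number under \<open>Re\<close> is already real.\<close>

definition spectral_density :: "(int \<Rightarrow> complex) \<Rightarrow> real \<Rightarrow> real" where
  "spectral_density \<gamma> \<theta> = Re (1 + G_fun \<gamma> (cis \<theta>) + cnj (G_fun \<gamma> (cis \<theta>)))"

definition zero_multiplicity :: "(real \<Rightarrow> real) \<Rightarrow> real \<Rightarrow> nat" where
  "zero_multiplicity g t = (LEAST n. (deriv ^^ n) g t \<noteq> 0)"

text \<open>The circle \<open>\<real> / 2\<pi>\<int>\<close> is represented by \<open>[0, 2\<pi>)\<close>.\<close>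

definition spectral_zeros :: "(int \<Rightarrow> complex) \<Rightarrow> real set" where
  "spectral_zeros \<gamma> = {\<theta> \<in> {0..<2 * pi}. spectral_density \<gamma> \<theta> = 0}"

text \<open>
  The multiplicities are even, because the spectral density is non-negative, so the half
  multiplicities \<open>k\<^sub>j\<close> are given by an exact division.
\<close>

definition max_half_multiplicity :: "(int \<Rightarrow> complex) \<Rightarrow> nat" where
  "max_half_multiplicity \<gamma> =
     Max ((\<lambda>\<theta>. zero_multiplicity (spectral_density \<gamma>) \<theta> div 2) ` spectral_zeros \<gamma>)"

definition zero_exponent :: "(int \<Rightarrow> complex) \<Rightarrow> real" where
  "zero_exponent \<gamma> =
     (if spectral_zeros \<gamma> = {} then 0
      else (2 * real (max_half_multiplicity \<gamma>) - 1) / (2 * real (max_half_multiplicity \<gamma>)))"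

definition power_series :: "(int \<Rightarrow> 'a \<Rightarrow> complex) \<Rightarrow> 'a \<Rightarrow> complex \<Rightarrow> complex" where
  "power_series \<xi> \<omega> z = (\<Sum>k. \<xi> (int k) \<omega> * z ^ k)"

text \<open>Zeros are counted with multiplicity.\<close>

definition zero_count :: "(complex \<Rightarrow> complex) \<Rightarrow> real \<Rightarrow> ennreal" where
  "zero_count f r = (\<Sum>\<^sub>\<infinity>z\<in>{z. cmod z < r \<and> f z = 0}. ennreal (real_of_int (zorder f z)))"

text \<open>
  The power series has radius of convergence at least 1 and is not identically zero only almost
  surely. The nonnegative integral ignores null sets, so the values of \<open>zero_count\<close> on the
  exceptional set (where it need not even be measurable, as \<open>M\<close> is not assumed complete) do
  not matter.
\<close>

definition expected_zeros :: "'a measure \<Rightarrow> (int \<Rightarrow> 'a \<Rightarrow> complex) \<Rightarrow> real \<Rightarrow> ennreal" where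
  "expected_zeros M \<xi> r = (\<integral>\<^sup>+ \<omega>. zero_count (power_series \<xi> \<omega>) r \<partial>M)"

end

theory Submission
  imports Defs
begin

text \<open>
  Let \<open>u(z) = 1 + 2 Re G(z)\<close>, a harmonic polynomial whose restriction to the unit circle is the
  spectral density. The covariance kernel of \<open>f\<close> satisfies \<open>E |f(z)|\<^sup>2 = u(z) / (1 - |z|\<^sup>2)\<close>, and
  \<open>E log |f(z)|\<close> is half the logarithm of this kernel up to an additive constant. By Jensen's formula,
  \<open>(J(r) - J(s)) / log (r / s)\<close> lies between the numbers of zeros in \<open>|z| < s\<close> and in \<open>|z| < r\<close>,
  where \<open>J(r)\<close> is the circular mean of \<open>log |f|\<close>. Taking expectations and letting \<open>s\<close> and \<open>r\<close>
  come together gives \<open>E N(r) = r\<^sup>2 / (1 - r\<^sup>2) - A(r)\<close>, where \<open>A(r)\<close> is the mean of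
  \<open>- Re (z G'(z)) / u(z)\<close> over \<open>|z| = r\<close>.

  If \<open>u\<close> has no zero on the unit circle, \<open>A\<close> is continuous up to \<open>r = 1\<close>, vanishes at \<open>0\<close> and is
  strictly increasing because \<open>log u\<close> is superharmonic. Otherwise, near a zero \<open>t\<close> of order \<open>2 k\<close> of
  the spectral density, \<open>u\<close> at radius \<open>1 - \<epsilon>\<close> and angle \<open>t + x\<close> behaves like \<open>c x^(2k) + b \<epsilon>\<close>, where
  \<open>b > 0\<close> by Harnack's inequality. The substitution \<open>x = \<epsilon>^(1/(2k)) s\<close> and dominated convergence show
  that this zero contributes \<open>\<epsilon>^(1/(2k) - 1)\<close> times a positive constant.
\<close>

section \<open>Jensen's formula\<close>

text \<open>The joint law of the real and imaginary parts of f(z) is never formed. For fixed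
  \<open>z\<close>, characteristic functions of partial sums identify each projection
  \<open>Re (cis t * f z)\<close> as a centered normal variable whose variance does not depend on
  \<open>t\<close>. The mean of \<open>ln \<bar>Re (cis t * w)\<bar>\<close> over \<open>t\<close>
  is \<open>ln (cmod w) - ln 2\<close>, so the projections already determine E log |f(z)|. That mean
  is itself Jensen's formula for two zeros lying on the circle, one reason why the boundary case is
  treated in full.

  Multiplicity is measured along the circle only, so the order of vanishing of u in the radial
  direction has to be controlled separately. Nonnegativity of u would allow radial decay of any
  order. Harnack's inequality makes the decay at a zero exactly linear, and this is why the angular
  multiplicity 2k alone fixes the scale \<open>(1 - r) powr (1 / (2 * k))\<close>. The same
  inequality gives the uniform lower bound c (x^(2k) + epsilon) that dominates the rescaled
  integrals.\<close>

lemma cis_borel_measurable [measurable]: "cis \<in> borel_measurable borel"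
  by (intro borel_measurable_continuous_onI continuous_intros)

lemma cnj_borel_measurable [measurable]: "cnj \<in> borel_measurable borel"
  by (intro borel_measurable_continuous_onI continuous_intros)

section \<open>The uniform distribution of the angle\<close>

definition angle_measure :: "real measure" where
  "angle_measure = uniform_measure lborel {0..2 * pi}"

lemma emeasure_angle_interval: "emeasure lborel {0..2 * pi} = ennreal (2 * pi)"
  by simp

lemma prob_space_angle: "prob_space angle_measure"
  unfolding angle_measure_def by (rule prob_space_uniform_measure) auto

lemma sets_angle [simp, measurable_cong]: "sets angle_measure = sets borel"
  by (simp add: angle_measure_def)

lemma space_angle [simp]: "space angle_measure = UNIV"
  by (simp add: angle_measure_def)

interpretation angle: prob_space angle_measure by (rule prob_space_angle)

lemma measure_angle_UNIV [simp]: "measure angle_measure UNIV = 1"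
  using angle.prob_space by simp

lemma angle_measure_density:
  "angle_measure = density lborel (\<lambda>x. ennreal (indicator {0..2*pi} x / (2 * pi)))"
  unfolding angle_measure_def uniform_measure_def emeasure_angle_interval
  by (intro arg_cong[where f = "density lborel"] ext) (auto simp: divide_ennreal indicator_def ennreal_1[symmetric] simp del: ennreal_1)

lemma integrable_angle_iff:
  fixes f :: "real \<Rightarrow> 'b :: {banach, second_countable_topology}"
  assumes [measurable]: "f \<in> borel_measurable borel"
  shows "integrable angle_measure f \<longleftrightarrow> set_integrable lborel {0..2*pi} f"
proof -
  have "integrable angle_measure f \<longleftrightarrow> integrable lborel (\<lambda>x. (indicator {0..2*pi} x / (2 * pi)) *\<^sub>R f x)"
    unfolding angle_measure_density by (subst integrable_density) auto
  also have "\<dots> \<longleftrightarrow> integrable lborel (\<lambda>x. (1 / (2 * pi)) *\<^sub>R (indicator {0..2*pi} x *\<^sub>R f x))"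
    by simp
  also have "\<dots> \<longleftrightarrow> set_integrable lborel {0..2*pi} f"
    unfolding set_integrable_def
  proof
    let ?g = "\<lambda>x. indicator {0..2*pi} x *\<^sub>R f x"
    assume "integrable lborel (\<lambda>x. (1 / (2 * pi)) *\<^sub>R ?g x)"
    then have "integrable lborel (\<lambda>x. (2 * pi) *\<^sub>R ((1 / (2 * pi)) *\<^sub>R ?g x))"
      by (rule integrable_scaleR_right)
    then show "integrable lborel ?g" unfolding scaleR_scaleR by simp
  qed (intro integrable_scaleR_right)
  finally show ?thesis .
qed

lemma integral_angle:
  fixes f :: "real \<Rightarrow> 'b :: {banach, second_countable_topology}"
  assumes [measurable]: "f \<in> borel_measurable borel"
  shows "(\<integral>t. f t \<partial>angle_measure) = (1 / (2 * pi)) *\<^sub>R (LINT t:{0..2*pi}|lborel. f t)"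
proof -
  have "(\<integral>t. f t \<partial>angle_measure) = (\<integral>x. (indicator {0..2*pi} x / (2 * pi)) *\<^sub>R f x \<partial>lborel)"
    unfolding angle_measure_density by (subst integral_density) auto
  also have "\<dots> = (\<integral>x. (1 / (2 * pi)) *\<^sub>R (indicator {0..2*pi} x *\<^sub>R f x) \<partial>lborel)"
    by simp
  also have "\<dots> = (1 / (2 * pi)) *\<^sub>R (LINT t:{0..2*pi}|lborel. f t)"
    unfolding set_lebesgue_integral_def by (rule integral_scaleR_right)
  finally show ?thesis .
qed

lemma
  fixes f :: "real \<Rightarrow> 'b :: euclidean_space"
  assumes "continuous_on UNIV f"
  shows integrable_angle_continuous: "integrable angle_measure f"
    and integral_angle_continuous: "(\<integral>t. f t \<partial>angle_measure) = (1 / (2 * pi)) *\<^sub>R integral {0..2*pi} f"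
proof -
  have [measurable]: "f \<in> borel_measurable borel"
    using assms by (rule borel_measurable_continuous_onI)
  have *: "set_integrable lborel {0..2*pi} f"
    by (rule borel_integrable_atLeastAtMost') (rule continuous_on_subset[OF assms], simp)
  then show "integrable angle_measure f" by (simp add: integrable_angle_iff)
  show "(\<integral>t. f t \<partial>angle_measure) = (1 / (2 * pi)) *\<^sub>R integral {0..2*pi} f"
    using set_borel_integral_eq_integral(2)[OF *] by (simp add: integral_angle)
qed

text \<open>A fibre of \<open>cis\<close> is empty or lies in a coset of the multiples of 2 pi,
  hence is countable. This discards the angles at which a logarithm has its pole.\<close>

lemma AE_angle_cis_neq: "AE t in angle_measure. cis t \<noteq> b"
proof -
  have "countable {t. cis t = b}"
  proof (cases "\<exists>t0. cis t0 = b")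
    case True
    then obtain t0 where t0: "cis t0 = b" by auto
    have "{t. cis t = b} \<subseteq> range (\<lambda>n::int. t0 + 2 * pi * n)"
    proof
      fix t assume "t \<in> {t. cis t = b}"
      then have "cis (t - t0) = 1" using t0 by (auto simp: cis_divide[symmetric])
      then have "cos (t - t0) = 1" by (metis cis.simps(1) one_complex.simps(1))
      then obtain n :: int where "t - t0 = n * 2 * pi" by (auto simp: cos_one_2pi_int)
      then show "t \<in> range (\<lambda>n::int. t0 + 2 * pi * n)" by (intro image_eqI[of _ _ n]) (auto simp: algebra_simps)
    qed
    then show ?thesis by (rule countable_subset) auto
  qed auto
  then have "{t. cis t = b} \<in> null_sets lborel"
    by (rule countable_imp_null_set_lborel)
  then have "AE t in lborel. cis t \<noteq> b" by (rule AE_I') auto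
  then show ?thesis unfolding angle_measure_density
    by (subst AE_density) auto
qed

section \<open>Mean values over circles\<close>

lemma mean_value_holomorphic:
  assumes "f holomorphic_on ball 0 R" "0 < r" "r < R"
  shows "(\<integral>t. f (of_real r * cis t) \<partial>angle_measure) = f 0"
proof -
  have hol: "f holomorphic_on cball 0 r" using assms(1,3) by (auto intro: holomorphic_on_subset)
  have "((\<lambda>u. f u / (u - 0)) has_contour_integral (2 * of_real pi * \<i> * f 0)) (circlepath 0 r)"
    by (rule Cauchy_integral_circlepath_simple[OF hol]) (use assms in auto)
  then have "((\<lambda>t. f (r * cis t) / (r * cis t) * r * \<i> * cis t) has_integral (2 * of_real pi * \<i> * f 0)) {0..2*pi}"
    unfolding circlepath_def by (subst (asm) has_contour_integral_part_circlepath_iff) auto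
  then have "((\<lambda>t. f (r * cis t) * \<i>) has_integral (2 * of_real pi * \<i> * f 0)) {0..2*pi}"
    by (rule has_integral_eq[rotated]) (use assms in auto)
  \<comment> \<open>On the circle dz = i z dt, so the contour integral carries a factor i, which
    \<open>- \<i>\<close> cancels.\<close>
  from has_integral_mult_left[OF this, of "- \<i>"]
  have "((\<lambda>t. f (r * cis t) * \<i> * - \<i>) has_integral (2 * of_real pi * \<i> * f 0 * - \<i>)) {0..2*pi}" .
  moreover have "2 * of_real pi * \<i> * f 0 * - \<i> = 2 * of_real pi * f 0" "\<And>t. f (r * cis t) * \<i> * - \<i> = f (r * cis t)"
    by (simp_all add: complex_eq_iff)
  ultimately have *: "((\<lambda>t. f (r * cis t)) has_integral (2 * of_real pi * f 0)) {0..2*pi}"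
    by (simp only:)
  have "continuous_on UNIV (\<lambda>t. f (r * cis t))"
    by (rule continuous_on_compose2[OF holomorphic_on_imp_continuous_on[OF hol]])
       (use assms in \<open>auto intro!: continuous_intros simp: norm_mult\<close>)
  then show ?thesis using integral_unique[OF *]
    by (subst integral_angle_continuous) (auto simp: scaleR_conv_of_real)
qed

text \<open>A zero-free function on a disc is \<open>exp h\<close>, and \<open>ln (cmod g)\<close>
  is then the real part of the holomorphic \<open>h\<close>.\<close>

lemma mean_value_ln_norm:
  assumes "g holomorphic_on ball 0 R" "\<And>z. z \<in> ball 0 R \<Longrightarrow> g z \<noteq> 0" "0 < r" "r < R"
  shows "(\<integral>t. ln (cmod (g (of_real r * cis t))) \<partial>angle_measure) = ln (cmod (g 0))"
    and "integrable angle_measure (\<lambda>t. ln (cmod (g (of_real r * cis t))))"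
proof -
  obtain h where h: "h holomorphic_on ball 0 R" "\<And>z. z \<in> ball 0 R \<Longrightarrow> exp (h z) = g z"
    using holomorphic_logarithm_exists[of "ball 0 R" g 0] assms by auto
  have ln: "ln (cmod (g z)) = Re (h z)" if "z \<in> ball 0 R" for z
    using h(2)[OF that, symmetric] by simp
  have mem: "of_real r * cis t \<in> ball 0 R" for t using assms by (simp add: norm_mult)
  have cont: "continuous_on UNIV (\<lambda>t. h (r * cis t))"
    by (rule continuous_on_compose2[OF holomorphic_on_imp_continuous_on[OF h(1)]])
       (use assms in \<open>auto intro!: continuous_intros simp: norm_mult\<close>)
  have int: "integrable angle_measure (\<lambda>t. h (r * cis t))"
    by (rule integrable_angle_continuous[OF cont])
  then show "integrable angle_measure (\<lambda>t. ln (cmod (g (of_real r * cis t))))"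
    by (simp only: ln mem) simp
  show "(\<integral>t. ln (cmod (g (of_real r * cis t))) \<partial>angle_measure) = ln (cmod (g 0))"
    unfolding ln[OF mem] integral_Re[OF int] mean_value_holomorphic[OF h(1) assms(3,4)]
    using ln[of 0] assms by simp
qed

section \<open>Logarithmic means of linear factors\<close>

lemma ln_norm_diff_cis_borel [measurable]:
  "(\<lambda>t. ln (cmod (of_real r * cis t - a))) \<in> borel_measurable borel"
proof -
  show ?thesis by measurable
qed

lemma jensen_linear_outside:
  assumes "0 < r" "r < cmod a"
  shows "(\<integral>t. ln (cmod (of_real r * cis t - a)) \<partial>angle_measure) = ln (cmod a)"
    and "integrable angle_measure (\<lambda>t. ln (cmod (of_real r * cis t - a)))"
proof -
  have *: "(\<lambda>z. z - a) holomorphic_on ball 0 (cmod a)" "\<And>z. z \<in> ball 0 (cmod a) \<Longrightarrow> z - a \<noteq> 0"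
    by (auto intro!: holomorphic_intros)
  show "(\<integral>t. ln (cmod (of_real r * cis t - a)) \<partial>angle_measure) = ln (cmod a)"
    and "integrable angle_measure (\<lambda>t. ln (cmod (of_real r * cis t - a)))"
    using mean_value_ln_norm[OF * assms] by simp_all
qed

lemma jensen_linear_inside:
  assumes "cmod a < r"
  shows "(\<integral>t. ln (cmod (of_real r * cis t - a)) \<partial>angle_measure) = ln r"
    and "integrable angle_measure (\<lambda>t. ln (cmod (of_real r * cis t - a)))"
proof -
  have r: "r > 0" using assms norm_ge_zero[of a] by linarith
  \<comment> \<open>Reflection in the circle: as a function of \<open>cis t\<close>, the right-hand
    side has no zero in the closed unit disc, so the mean value property applies at radius 1 and
    returns the value at 0.\<close>
  have eq: "cmod (of_real r * cis t - a) = cmod (of_real r - cnj a * cis t)" for t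
  proof -
    have "of_real r * cis t - a = cis t * cnj (of_real r - cnj a * cis t)"
      by (simp add: algebra_simps cis_cnj cis_mult)
    then show ?thesis by (simp add: norm_mult del: complex_cnj_diff complex_cnj_mult)
  qed
  obtain R where R: "1 < R" "cmod a * R < r"
  proof (cases "a = 0")
    case True then show ?thesis using that[of 2] r by auto
  next
    case False
    then have "1 < r / cmod a" using assms by simp
    then obtain R where "1 < R" "R < r / cmod a" using dense by blast
    then show ?thesis using that[of R] False by (simp add: field_simps)
  qed
  have nz: "of_real r - cnj a * z \<noteq> 0" if "z \<in> ball 0 R" for z
  proof
    assume "of_real r - cnj a * z = 0"
    then have "cmod (of_real r) = cmod (cnj a * z)" by simp
    then have "r = cmod a * cmod z" using r by (simp add: norm_mult)
    also have "\<dots> \<le> cmod a * R" using that by (intro mult_left_mono) auto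
    finally show False using R by simp
  qed
  have "(\<lambda>z. of_real r - cnj a * z) holomorphic_on ball 0 R" by (intro holomorphic_intros)
  from mean_value_ln_norm[OF this nz, of 1]
  show "(\<integral>t. ln (cmod (of_real r * cis t - a)) \<partial>angle_measure) = ln r"
    and "integrable angle_measure (\<lambda>t. ln (cmod (of_real r * cis t - a)))"
    using R r by (simp_all add: eq)
qed

text \<open>The pole lies on the circle, so the integral is obtained as a limit over smaller radii
  \<open>s n\<close>, for which \<open>a\<close> is outside. Fatou's lemma first makes the limit
  integrable; up to a constant it then serves as the dominating function.\<close>

lemma jensen_linear_boundary:
  assumes "0 < r" "cmod a = r"
  shows "(\<integral>t. ln (cmod (of_real r * cis t - a)) \<partial>angle_measure) = ln r"
    and "integrable angle_measure (\<lambda>t. ln (cmod (of_real r * cis t - a)))"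
proof -
  \<comment> \<open>The double successor starts the radii at r / 2, which keeps them
    positive.\<close>
  define s where "s n = r * (1 - inverse (real (Suc (Suc n))))" for n
  have s: "0 < s n" "s n < r" for n
    using assms by (auto simp: s_def field_simps intro!: mult_pos_pos add_pos_nonneg)
  have s_lim: "s \<longlonglongrightarrow> r"
  proof -
    have "(\<lambda>n. inverse (real (Suc n))) \<longlonglongrightarrow> 0" by (rule LIMSEQ_inverse_real_of_nat)
    then have "(\<lambda>n. inverse (real (Suc (Suc n)))) \<longlonglongrightarrow> 0" by (rule LIMSEQ_Suc)
    then have "(\<lambda>n. r * (1 - inverse (real (Suc (Suc n))))) \<longlonglongrightarrow> r * (1 - 0)"
      by (intro tendsto_intros)
    then show ?thesis by (simp add: s_def[abs_def])
  qed
  have nz: "AE t in angle_measure. of_real r * cis t - a \<noteq> 0"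
    using AE_angle_cis_neq[of "a / r"] by eventually_elim (use assms in \<open>auto simp: field_simps\<close>)
  \<comment> \<open>Points of the closed disc of radius \<open>r\<close> are at most
    \<open>2 * r\<close> apart, so \<open>h\<close> is nonnegative, as Fatou's lemma
    requires.\<close>
  define h where "h n t = ln (2 * r) - ln (cmod (of_real (s n) * cis t - a))" for n t
  define h0 where "h0 t = ln (2 * r) - ln (cmod (of_real r * cis t - a))" for t
  have [measurable]: "h n \<in> borel_measurable borel" "h0 \<in> borel_measurable borel" for n
    unfolding h_def h0_def by measurable
  have int_n: "integrable angle_measure (\<lambda>t. ln (cmod (of_real (s n) * cis t - a)))"
    "(\<integral>t. ln (cmod (of_real (s n) * cis t - a)) \<partial>angle_measure) = ln r" for n
    using jensen_linear_outside[of "s n" a] s[of n] assms by auto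
  have h_int: "integrable angle_measure (h n)" "(\<integral>t. h n t \<partial>angle_measure) = ln 2" for n
    using int_n[of n] assms by (simp_all add: h_def[abs_def] ln_mult)
  have h0_upper: "cmod (of_real r * cis t - a) \<le> 2 * r" for t
    using norm_triangle_ineq4[of "of_real r * cis t" a] assms by (simp add: norm_mult)
  have pos_n: "0 < cmod (of_real (s n) * cis t - a)" for n t
    using s[of n] assms by (auto simp: norm_mult)
  have upper_n: "cmod (of_real (s n) * cis t - a) \<le> 2 * r" for n t
    using norm_triangle_ineq4[of "of_real (s n) * cis t" a] s[of n] assms by (simp add: norm_mult)
  \<comment> \<open>The gap \<open>r - s n\<close> is at most the distance from \<open>a\<close> to
    the point on the inner circle, hence the factor 2. After taking logarithms,
    \<open>h0 + ln 2\<close> dominates every \<open>h n\<close>.\<close>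
  have lower_n: "cmod (of_real r * cis t - a) \<le> 2 * cmod (of_real (s n) * cis t - a)" for n t
  proof -
    have "cmod (of_real r * cis t - a) \<le> cmod (of_real (s n) * cis t - a) + cmod (of_real (r - s n) * cis t)"
      using norm_triangle_ineq[of "of_real (s n) * cis t - a" "of_real (r - s n) * cis t"] by (simp add: algebra_simps)
    also have "cmod (of_real (r - s n) * cis t) = cmod a - cmod (of_real (s n) * cis t)"
      using s[of n] assms by (simp add: norm_mult del: of_real_diff)
    also have "\<dots> \<le> cmod (a - of_real (s n) * cis t)" by (rule norm_triangle_ineq2)
    finally show ?thesis by (simp add: norm_minus_commute)
  qed
  have h_nonneg: "0 \<le> h n t" for n t
    using upper_n pos_n[of n t] unfolding h_def by (simp add: ln_le_cancel_iff[symmetric] del: ln_le_cancel_iff) (use assms in auto)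
  have lim: "AE t in angle_measure. (\<lambda>n. h n t) \<longlonglongrightarrow> h0 t"
    using nz
  proof eventually_elim
    case (elim t)
    then show ?case unfolding h_def h0_def
      by (intro tendsto_intros s_lim) auto
  qed
  have "(\<integral>\<^sup>+t. ennreal (h0 t) \<partial>angle_measure) = (\<integral>\<^sup>+t. liminf (\<lambda>n. ennreal (h n t)) \<partial>angle_measure)"
  proof (rule nn_integral_cong_AE, use lim in eventually_elim)
    case (elim t)
    then have "(\<lambda>n. ennreal (h n t)) \<longlonglongrightarrow> ennreal (h0 t)" by (intro tendsto_ennrealI)
    then show ?case by (metis lim_imp_Liminf trivial_limit_sequentially)
  qed
  also have "\<dots> \<le> liminf (\<lambda>n. \<integral>\<^sup>+t. ennreal (h n t) \<partial>angle_measure)"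
    by (rule nn_integral_liminf) simp
  also have "(\<lambda>n. \<integral>\<^sup>+t. ennreal (h n t) \<partial>angle_measure) = (\<lambda>n. ennreal (ln 2))"
    by (rule ext, subst nn_integral_eq_integral) (auto simp: h_int h_nonneg)
  also have "liminf (\<lambda>n. ennreal (ln 2)) < \<infinity>" by (simp add: Liminf_const)
  finally have fin: "(\<integral>\<^sup>+t. ennreal (h0 t) \<partial>angle_measure) < \<infinity>" .
  have h0_nonneg: "AE t in angle_measure. 0 \<le> h0 t"
    using nz
  proof eventually_elim
    case (elim t)
    then have "ln (cmod (of_real r * cis t - a)) \<le> ln (2 * r)"
      using h0_upper[of t] assms by (subst ln_le_cancel_iff) auto
    then show ?case by (simp add: h0_def)
  qed
  have int0: "integrable angle_measure h0"
    by (rule integrableI_nonneg) (use fin h0_nonneg in auto)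
  have bound: "AE t in angle_measure. norm (h n t) \<le> h0 t + ln 2" for n
    using nz
  proof eventually_elim
    case (elim t)
    have "ln (cmod (of_real r * cis t - a)) \<le> ln (2 * cmod (of_real (s n) * cis t - a))"
      using lower_n[of t n] elim by (subst ln_le_cancel_iff) (use pos_n[of n t] in auto)
    also have "\<dots> = ln 2 + ln (cmod (of_real (s n) * cis t - a))"
      using pos_n[of n t] by (subst ln_mult) auto
    finally show ?case using h_nonneg[of n t] by (simp add: h_def h0_def)
  qed
  have "(\<lambda>n. \<integral>t. h n t \<partial>angle_measure) \<longlonglongrightarrow> (\<integral>t. h0 t \<partial>angle_measure)"
    by (rule integral_dominated_convergence[OF _ _ _ lim bound]) (use int0 in auto)
  then have "(\<integral>t. h0 t \<partial>angle_measure) = ln 2"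
    unfolding h_int by (simp add: LIMSEQ_const_iff)
  moreover have *: "(\<lambda>t. ln (cmod (of_real r * cis t - a))) = (\<lambda>t. ln (2 * r) - h0 t)"
    by (simp add: h0_def fun_eq_iff)
  ultimately show "(\<integral>t. ln (cmod (of_real r * cis t - a)) \<partial>angle_measure) = ln r"
    and "integrable angle_measure (\<lambda>t. ln (cmod (of_real r * cis t - a)))"
    unfolding * using int0 assms by (simp_all add: ln_mult)
qed

lemma jensen_linear:
  assumes "0 < r"
  shows "(\<integral>t. ln (cmod (of_real r * cis t - a)) \<partial>angle_measure) = ln (max r (cmod a))"
    and "integrable angle_measure (\<lambda>t. ln (cmod (of_real r * cis t - a)))"
  using jensen_linear_outside[of r a] jensen_linear_inside[of a r] jensen_linear_boundary[of r a] assms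
  by (cases "cmod a" r rule: linorder_cases; simp add: max_def)+

lemma zorder_prod_linear:
  assumes "finite Z" "a \<in> Z"
  shows "zorder (\<lambda>z. \<Prod>b\<in>Z. (z - b) ^ m b) a = int (m a)"
proof (rule zorder_eqI)
  show "(\<lambda>z. \<Prod>b\<in>Z - {a}. (z - b) ^ m b) holomorphic_on UNIV" by (intro holomorphic_intros)
  show "(\<Prod>b\<in>Z. (w - b) ^ m b) = (\<Prod>b\<in>Z - {a}. (w - b) ^ m b) * (w - a) powi int (m a)" for w
    using assms by (subst prod.remove[of _ a]) (auto simp: mult.commute)
qed (use assms in auto)

text \<open>Dividing by the polynomial with the same zeros and orders leaves a zero-free
  \<open>h\<close>, whose logarithmic mean is its value at 0; \<open>jensen_linear\<close> evaluates
  each linear factor.\<close>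

theorem jensen_formula:
  assumes hol: "f holomorphic_on ball 0 R" and f0: "f 0 \<noteq> 0" and r: "0 < r" "r < R"
    and fin: "finite {z \<in> ball 0 R. f z = 0}"
  shows "(\<integral>t. ln (cmod (f (of_real r * cis t))) \<partial>angle_measure) = ln (cmod (f 0)) +
      (\<Sum>a\<in>{z \<in> ball 0 R. f z = 0}. of_int (zorder f a) * (ln (max r (cmod a)) - ln (cmod a)))"
    and "integrable angle_measure (\<lambda>t. ln (cmod (f (of_real r * cis t))))"
proof -
  define Z where "Z = {z \<in> ball 0 R. f z = 0}"
  have finZ: "finite Z" using fin by (simp add: Z_def)
  have R: "0 < R" using r by simp
  have zo: "(if f z = 0 then zorder f z > 0 else zorder f z = 0)" if "z \<in> ball 0 R" for z
  proof -
    have "\<exists>w\<in>ball 0 R. f w \<noteq> 0" using f0 R by (intro bexI[of _ 0]) auto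
    from zorder_exist_zero[OF hol _ _ that this] show ?thesis by (auto split: if_splits)
  qed
  define m where "m a = nat (zorder f a)" for a
  define P where "P z = (\<Prod>b\<in>Z. (z - b) ^ m b)" for z
  have m: "m a > 0" "zorder f a = int (m a)" if "a \<in> Z" for a
    using zo[of a] that by (auto simp: m_def Z_def split: if_splits)
  have P_hol: "P holomorphic_on A" for A unfolding P_def by (intro holomorphic_intros)
  have P0: "P z = 0 \<longleftrightarrow> z \<in> Z" for z
    unfolding P_def using finZ m by (auto simp: prod_zero_iff)
  obtain h where h: "h holomorphic_on ball 0 R" "\<And>z. z \<in> ball 0 R \<Longrightarrow> h z \<noteq> 0"
      "\<And>z. z \<in> ball 0 R \<Longrightarrow> f z = h z * P z"
  proof (rule holomorphic_zorder_factorization[OF hol _ _ P_hol])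
    show "P z = 0 \<longleftrightarrow> f z = 0" if "z \<in> ball 0 R" for z using that by (auto simp: P0 Z_def)
    show "zorder P z = zorder f z" if z: "z \<in> ball 0 R" for z
    proof (cases "f z = 0")
      case True
      then have "z \<in> Z" using z by (simp add: Z_def)
      then show ?thesis unfolding P_def[abs_def] using zorder_prod_linear[OF finZ] m by simp
    next
      case False
      have "zorder P z = 0"
        by (rule zorder_eqI[OF open_UNIV _ P_hol]) (use False in \<open>auto simp: P0 Z_def\<close>)
      then show ?thesis using zo[OF z] False by simp
    qed
  qed auto
  have mem: "of_real r * cis t \<in> ball 0 R" for t using r by (simp add: norm_mult)
  have nz: "AE t in angle_measure. \<forall>a\<in>Z. of_real r * cis t - a \<noteq> 0"
    unfolding AE_finite_all[OF finZ]
  proof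
    fix a assume "a \<in> Z"
    show "AE t in angle_measure. of_real r * cis t - a \<noteq> 0"
      using AE_angle_cis_neq[of "a / r"] by eventually_elim (use r in \<open>auto simp: field_simps\<close>)
  qed
  define F where "F t = ln (cmod (h (of_real r * cis t))) + (\<Sum>a\<in>Z. of_int (zorder f a) * ln (cmod (of_real r * cis t - a)))" for t
  have eq: "AE t in angle_measure. ln (cmod (f (of_real r * cis t))) = F t"
    using nz
  proof eventually_elim
    case (elim t)
    have "ln (cmod (f (of_real r * cis t))) = ln (cmod (h (of_real r * cis t))) + ln (cmod (P (of_real r * cis t)))"
      unfolding h(3)[OF mem] norm_mult using h(2)[OF mem] elim P0 by (subst ln_mult) auto
    also have "ln (cmod (P (of_real r * cis t))) = (\<Sum>a\<in>Z. ln (cmod (of_real r * cis t - a) ^ m a))"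
      unfolding P_def prod_norm[symmetric] norm_power[symmetric] using elim by (subst ln_prod) (auto simp: finZ)
    also have "\<dots> = (\<Sum>a\<in>Z. of_int (zorder f a) * ln (cmod (of_real r * cis t - a)))"
      by (rule sum.cong[OF refl]) (use elim in \<open>simp add: ln_realpow m\<close>)
    finally show ?case by (simp add: F_def)
  qed
  have hint: "(\<integral>t. ln (cmod (h (of_real r * cis t))) \<partial>angle_measure) = ln (cmod (h 0))"
    "integrable angle_measure (\<lambda>t. ln (cmod (h (of_real r * cis t))))"
    using mean_value_ln_norm[of h R r] h r by auto
  have Fint: "integrable angle_measure F"
    unfolding F_def by (intro Bochner_Integration.integrable_add hint(2) Bochner_Integration.integrable_sum integrable_mult_right jensen_linear(2) r)
  have "(\<integral>t. F t \<partial>angle_measure) = ln (cmod (h 0)) + (\<Sum>a\<in>Z. of_int (zorder f a) * ln (max r (cmod a)))"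
    unfolding F_def
    by (subst Bochner_Integration.integral_add)
       (auto intro!: hint(2) Bochner_Integration.integrable_sum integrable_mult_right jensen_linear(2) r
          simp: Bochner_Integration.integral_sum hint(1) jensen_linear r)
  \<comment> \<open>Since 0 is not a zero, f(0) = h(0) P(0) may be split into logarithms.\<close>
  also have "ln (cmod (h 0)) = ln (cmod (f 0)) - (\<Sum>a\<in>Z. of_int (zorder f a) * ln (cmod a))"
  proof -
    have Z0: "a \<noteq> 0" if "a \<in> Z" for a using that f0 by (auto simp: Z_def)
    have "ln (cmod (f 0)) = ln (cmod (h 0)) + ln (cmod (P 0))"
      using h(2)[of 0] h(3)[of 0] R f0 by (simp add: norm_mult ln_mult)
    also have "ln (cmod (P 0)) = (\<Sum>a\<in>Z. ln (cmod a ^ m a))"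
      unfolding P_def prod_norm[symmetric] norm_power[symmetric] using Z0 by (subst ln_prod) (auto simp: finZ norm_power)
    also have "\<dots> = (\<Sum>a\<in>Z. of_int (zorder f a) * ln (cmod a))"
      by (rule sum.cong[OF refl]) (use Z0 in \<open>simp add: ln_realpow m\<close>)
    finally show ?thesis by simp
  qed
  finally have Fval: "(\<integral>t. F t \<partial>angle_measure) = ln (cmod (f 0)) + (\<Sum>a\<in>Z. of_int (zorder f a) * (ln (max r (cmod a)) - ln (cmod a)))"
    by (simp add: right_diff_distrib sum_subtractf)
  have "continuous_on UNIV (\<lambda>t. f (of_real r * cis t))"
    by (rule continuous_on_compose2[OF holomorphic_on_imp_continuous_on[OF hol]])
       (use mem in \<open>auto intro!: continuous_intros\<close>)
  then have [measurable]: "(\<lambda>t. f (of_real r * cis t)) \<in> borel_measurable borel"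
    by (rule borel_measurable_continuous_onI)
  have [measurable]: "F \<in> borel_measurable borel"
    using borel_measurable_integrable[OF Fint] by simp
  show "(\<integral>t. ln (cmod (f (of_real r * cis t))) \<partial>angle_measure) = ln (cmod (f 0)) +
      (\<Sum>a\<in>{z \<in> ball 0 R. f z = 0}. of_int (zorder f a) * (ln (max r (cmod a)) - ln (cmod a)))"
    using integral_cong_AE[OF _ _ eq] Fval by (simp add: Z_def)
  show "integrable angle_measure (\<lambda>t. ln (cmod (f (of_real r * cis t))))"
    using integrable_cong_AE[OF _ _ eq] Fint by simp
qed

section \<open>The logarithm of a circularly symmetric Gaussian variable\<close>

lemma zero_count_bounds:
  assumes hol: "f holomorphic_on ball 0 1" and f0: "f 0 \<noteq> 0" and sr: "0 < s" "s < r" "r < 1"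
  defines "J \<equiv> \<lambda>\<rho>. (\<integral>t. ln (cmod (f (of_real \<rho> * cis t))) \<partial>angle_measure)"
  shows "ennreal ((J r - J s) / ln (r / s)) \<le> zero_count f r"
    and "zero_count f s \<le> ennreal ((J r - J s) / ln (r / s))"
    and "0 \<le> J r - J s"
proof -
  \<comment> \<open>Shrinking to \<open>R < 1\<close> makes the zeros finite in number, by
    compactness, while the circle of radius \<open>r\<close> stays inside.\<close>
  obtain R where R: "r < R" "R < 1" using sr dense by blast
  define Z where "Z = {z \<in> ball 0 R. f z = 0}"
  have nconst: "\<not> f constant_on ball 0 1" if "a \<in> ball 0 1" "f a = 0" for a
    using that f0 unfolding constant_on_def by force
  have finZ: "finite Z"
  proof (cases "Z = {}")
    case False
    then obtain a where "a \<in> ball 0 1" "f a = 0" using R by (force simp: Z_def)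
    moreover have "cball (0::complex) R \<subseteq> ball 0 1" using R by auto
    ultimately have "finite {z \<in> cball 0 R. f z = 0}"
      using holomorphic_compact_finite_zeros[OF hol, of "cball 0 R"] nconst R by auto
    then show ?thesis by (rule rev_finite_subset) (auto simp: Z_def)
  qed auto
  have holR: "f holomorphic_on ball 0 R" by (rule holomorphic_on_subset[OF hol]) (use R in auto)
  have zpos: "of_int (zorder f a) > (0::real)" "a \<noteq> 0" if "a \<in> Z" for a
  proof -
    have "\<exists>w\<in>ball 0 R. f w \<noteq> 0" using f0 R sr by (intro bexI[of _ 0]) auto
    from zorder_exist_zero[OF holR _ _ _ this, of a] show "of_int (zorder f a) > (0::real)"
      using that by (auto simp: Z_def split: if_splits)
    show "a \<noteq> 0" using that f0 by (auto simp: Z_def)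
  qed
  define m where "m a = (of_int (zorder f a) :: real)" for a
  have zc: "zero_count f \<rho> = ennreal (\<Sum>a\<in>{a\<in>Z. cmod a < \<rho>}. m a)" if "\<rho> \<le> R" for \<rho>
  proof -
    have "{z. cmod z < \<rho> \<and> f z = 0} = {a\<in>Z. cmod a < \<rho>}" using that by (auto simp: Z_def)
    then show ?thesis unfolding zero_count_def m_def using finZ zpos
      by (subst sum_ennreal[symmetric]) (auto intro!: less_imp_le)
  qed
  \<comment> \<open>A zero contributes its order times a number between 0 and
    \<open>ln (r / s)\<close>: the full amount if it lies inside radius \<open>s\<close>, nothing if
    it lies at or beyond radius \<open>r\<close>. Both bounds are read off from this sum.\<close>
  have Jd: "J r - J s = (\<Sum>a\<in>Z. m a * (ln (max r (cmod a)) - ln (max s (cmod a))))"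
    unfolding J_def using R sr jensen_formula(1)[OF holR f0 _ _ finZ[unfolded Z_def], of r]
      jensen_formula(1)[OF holR f0 _ _ finZ[unfolded Z_def], of s]
    by (simp add: Z_def m_def sum_subtractf[symmetric] algebra_simps)
  have ln_rs: "ln (r / s) > 0" "ln (r/s) = ln r - ln s" using sr by (auto simp: ln_div)
  have term_nonneg: "0 \<le> ln (max r (cmod a)) - ln (max s (cmod a))" for a
    using sr ln_mono[of "max s (cmod a)" "max r (cmod a)"] by auto
  have sum_ind: "(\<Sum>a\<in>{a\<in>Z. cmod a < \<rho>}. m a) * ln (r/s) = (\<Sum>a\<in>Z. m a * (if cmod a < \<rho> then ln (r/s) else 0))" for \<rho>
  proof -
    have "(\<Sum>a\<in>{a\<in>Z. cmod a < \<rho>}. m a) * ln (r/s) = (\<Sum>a\<in>{a\<in>Z. cmod a < \<rho>}. m a * ln (r/s))"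
      by (rule sum_distrib_right)
    also have "\<dots> = (\<Sum>a\<in>Z. if cmod a < \<rho> then m a * ln (r/s) else 0)"
      using finZ by (rule sum.inter_filter)
    finally show ?thesis by (simp add: if_distrib cong: if_cong)
  qed
  have m0: "0 \<le> m a" if "a \<in> Z" for a using zpos[OF that] by (simp add: m_def)
  have ln_le: "ln (cmod a) \<le> ln r" if "s \<le> cmod a" "cmod a < r" for a
    using that sr by (subst ln_le_cancel_iff) auto
  have ln_le': "ln s \<le> ln (cmod a)" if "s \<le> cmod a" for a
    using that sr by (subst ln_le_cancel_iff) auto
  have up: "J r - J s \<le> (\<Sum>a\<in>{a\<in>Z. cmod a < r}. m a) * ln (r/s)"
    unfolding Jd sum_ind
    by (intro sum_mono mult_left_mono m0) (use sr in \<open>auto simp: max_def ln_rs not_le ln_le ln_le'\<close>)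
  have low: "(\<Sum>a\<in>{a\<in>Z. cmod a < s}. m a) * ln (r/s) \<le> J r - J s"
    unfolding Jd sum_ind
    by (intro sum_mono mult_left_mono m0) (use sr in \<open>auto simp: max_def ln_rs not_le ln_le ln_le'\<close>)
  show "0 \<le> J r - J s" unfolding Jd by (intro sum_nonneg mult_nonneg_nonneg m0 term_nonneg)
  show "ennreal ((J r - J s) / ln (r / s)) \<le> zero_count f r"
    using up ln_rs R by (subst zc) (auto intro!: ennreal_leI simp: divide_le_eq)
  show "zero_count f s \<le> ennreal ((J r - J s) / ln (r / s))"
    using low ln_rs R sr by (subst zc) (auto intro!: ennreal_leI simp: le_divide_eq)
qed

section \<open>Logarithmic mean of the projections of a complex number\<close>

lemma ln_norm_Re_cis:
  assumes "w \<noteq> 0"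
  shows "integrable angle_measure (\<lambda>t. ln \<bar>Re (cis t * w)\<bar>)"
    and "(\<integral>t. ln \<bar>Re (cis t * w)\<bar> \<partial>angle_measure) = ln (cmod w) - ln 2"
proof -
  \<comment> \<open>Twice the real part is \<open>cis t * w + cnj (cis t * w)\<close>, which factors
    as \<open>cis (- t) * w * ((cis t - b) * (cis t + b))\<close>. Both roots are unimodular, so
    each linear factor has logarithmic mean 0.\<close>
  define b where "b = csqrt (- cnj w / w)"
  have b2: "b * b = - cnj w / w" by (simp add: b_def flip: power2_eq_square)
  have "(cmod b)\<^sup>2 = 1"
    by (metis assms b2 complex_mod_cnj divide_self_if norm_divide norm_eq_zero norm_minus_cancel norm_mult power2_eq_square)
  then have nb: "cmod b = 1" by (simp add: power2_eq_1_iff) (smt (verit) norm_ge_zero)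
  have eq: "2 * \<bar>Re (cis t * w)\<bar> = cmod w * (cmod (of_real 1 * cis t - b) * cmod (of_real 1 * cis t - - b))" for t
  proof -
    have "of_real (2 * Re (cis t * w)) = cis t * w + cnj (cis t * w)" by (simp only: complex_add_cnj)
    also have "\<dots> = cis (- t) * w * ((cis t - b) * (cis t + b))"
    proof -
      have "cis t * cis (-t) = 1" by (simp add: cis_mult)
      moreover have "w * (b * b) = - cnj w" using assms b2 by simp
      ultimately have "cis (- t) * w * ((cis t - b) * (cis t + b)) = cis t * w + cis (-t) * cnj w"
        by algebra
      then show ?thesis by (simp add: cis_cnj)
    qed
    finally have "cmod (of_real (2 * Re (cis t * w))) = cmod (cis (- t) * w * ((cis t - b) * (cis t + b)))" by simp
    then show ?thesis unfolding norm_of_real abs_mult by (simp add: norm_mult del: times_complex.sel)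
  qed
  define F where "F t = ln (cmod w) - ln 2 + (ln (cmod (of_real 1 * cis t - b)) + ln (cmod (of_real 1 * cis t - - b)))" for t
  have Fi: "integrable angle_measure F" "(\<integral>t. F t \<partial>angle_measure) = ln (cmod w) - ln 2"
    unfolding F_def using jensen_linear[of 1 b] jensen_linear[of 1 "- b"] nb by simp_all
  have ae: "AE t in angle_measure. ln \<bar>Re (cis t * w)\<bar> = F t"
    using AE_angle_cis_neq[of b] AE_angle_cis_neq[of "- b"]
  proof eventually_elim
    case (elim t)
    have nz: "cmod (of_real 1 * cis t - b) > 0" "cmod (of_real 1 * cis t - - b) > 0"
      using elim by (auto simp: add_eq_0_iff2)
    have "\<bar>Re (cis t * w)\<bar> = cmod w / 2 * (cmod (of_real 1 * cis t - b) * cmod (of_real 1 * cis t - - b))"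
      using eq[of t] by simp
    then have "ln \<bar>Re (cis t * w)\<bar> = ln (cmod w / 2 * (cmod (of_real 1 * cis t - b) * cmod (of_real 1 * cis t - - b)))"
      by (rule arg_cong)
    also have "\<dots> = ln (cmod w / 2) + ln (cmod (of_real 1 * cis t - b) * cmod (of_real 1 * cis t - - b))"
      using nz assms by (intro ln_mult_pos mult_pos_pos) auto
    also have "ln (cmod (of_real 1 * cis t - b) * cmod (of_real 1 * cis t - - b)) = ln (cmod (of_real 1 * cis t - b)) + ln (cmod (of_real 1 * cis t - - b))"
      using nz by (intro ln_mult_pos)
    finally show ?case using assms by (simp add: F_def ln_div)
  qed
  have [measurable]: "F \<in> borel_measurable borel" using borel_measurable_integrable[OF Fi(1)] by simp
  show "integrable angle_measure (\<lambda>t. ln \<bar>Re (cis t * w)\<bar>)"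
    using integrable_cong_AE[OF _ _ ae] Fi by simp
  show "(\<integral>t. ln \<bar>Re (cis t * w)\<bar> \<partial>angle_measure) = ln (cmod w) - ln 2"
    using integral_cong_AE[OF _ _ ae] Fi by simp
qed

text \<open>Majorant for integrating the logarithm against a normal density:
  \<open>y powr (-1/2)\<close> is integrable at 0, and linear growth is absorbed by the density. The
  factor 2 comes from \<open>ln x \<le> x\<close> at \<open>x = y powr (-1/2)\<close>.\<close>

lemma abs_ln_le:
  fixes y :: real
  assumes "y > 0"
  shows "\<bar>ln y\<bar> \<le> (if y \<le> 1 then 2 * y powr (-1/2) else y)"
proof (cases "y \<le> 1")
  case True
  have "ln (y powr (-1/2)) \<le> y powr (-1/2) - 1" using assms by (intro ln_le_minus_one) auto
  then have "- ln y / 2 \<le> y powr (-1/2)" using assms by (simp add: ln_powr)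
  then show ?thesis using True assms by simp
next
  case False
  then show ?thesis using ln_le_minus_one[of y] assms by simp
qed

lemma integrable_ln_std_normal: "integrable std_normal_distribution (\<lambda>x. ln \<bar>x\<bar>)"
proof -
  define h where "h x = indicator {0..1} x *\<^sub>R (2 * x powr (-1/2))" for x :: real
  have [measurable]: "h \<in> borel_measurable borel" unfolding h_def by measurable
  have "(\<lambda>x::real. x powr (-1/2)) integrable_on {0..1}" by (rule integrable_on_powr_from_0) auto
  then have "(\<lambda>x::real. 2 * x powr (-1/2)) integrable_on {0..1}" by (rule integrable_on_mult_right)
  then have "(\<lambda>x::real. 2 * x powr (-1/2)) absolutely_integrable_on {0..1}"
    by (rule nonnegative_absolutely_integrable_1) auto
  then have "integrable lebesgue h" unfolding set_integrable_def h_def .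
  then have h: "integrable lborel h" by (subst (asm) integrable_completion) auto
  then have h': "integrable lborel (\<lambda>x. h (- x))"
    using lborel_integrable_real_affine[of h "-1" 0] by simp
  have i3: "integrable lborel (\<lambda>x. std_normal_density x * \<bar>x\<bar>)"
    using integrable_std_normal_moment_abs[of 1] by simp
  have d1: "std_normal_density x \<le> 1" for x
  proof -
    have "1 \<le> sqrt (2 * pi)" using pi_gt3 by (simp add: real_le_rsqrt)
    then have "1 / sqrt (2 * pi) \<le> 1" by simp
    moreover have "exp (- x\<^sup>2 / 2) \<le> 1" by simp
    ultimately show ?thesis unfolding std_normal_density_def
      by (intro mult_le_one) auto
  qed
  have "integrable lborel (\<lambda>x. std_normal_density x * ln \<bar>x\<bar>)"
  proof (rule Bochner_Integration.integrable_bound)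
    show "integrable lborel (\<lambda>x. h x + h (- x) + std_normal_density x * \<bar>x\<bar>)"
      by (intro Bochner_Integration.integrable_add h h' i3)
    show "AE x in lborel. norm (std_normal_density x * ln \<bar>x\<bar>) \<le> norm (h x + h (- x) + std_normal_density x * \<bar>x\<bar>)"
    proof (rule AE_I2)
      fix x :: real
      have hn: "0 \<le> h y" for y by (simp add: h_def)
      show "norm (std_normal_density x * ln \<bar>x\<bar>) \<le> norm (h x + h (- x) + std_normal_density x * \<bar>x\<bar>)"
      \<comment> \<open>The default \<open>ln 0 = 0\<close> lets the origin join the outer
        case.\<close>
      proof (cases "x = 0 \<or> \<bar>x\<bar> > 1")
        case True
        then have "\<bar>ln \<bar>x\<bar>\<bar> \<le> \<bar>x\<bar>" using abs_ln_le[of "\<bar>x\<bar>"] by (auto split: if_splits)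
        then have "std_normal_density x * \<bar>ln \<bar>x\<bar>\<bar> \<le> std_normal_density x * \<bar>x\<bar>"
          by (intro mult_left_mono) auto
        then show ?thesis using hn[of x] hn[of "-x"] by (simp add: abs_mult)
      next
        case False
        then have "\<bar>ln \<bar>x\<bar>\<bar> \<le> 2 * \<bar>x\<bar> powr (-1/2)" using abs_ln_le[of "\<bar>x\<bar>"] by auto
        also have "\<dots> \<le> h x + h (- x)" using False by (auto simp: h_def indicator_def abs_if split: if_splits)
        finally have "std_normal_density x * \<bar>ln \<bar>x\<bar>\<bar> \<le> 1 * (h x + h (- x))"
          by (intro mult_mono d1) auto
        moreover have "norm (std_normal_density x * ln \<bar>x\<bar>) = std_normal_density x * \<bar>ln \<bar>x\<bar>\<bar>"
          by (simp add: abs_mult)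
        ultimately have "norm (std_normal_density x * ln \<bar>x\<bar>) \<le> h x + h (- x)" by (simp only: mult_1)
        also have "\<dots> \<le> h x + h (- x) + std_normal_density x * \<bar>x\<bar>" by simp
        also have "\<dots> \<le> norm (h x + h (- x) + std_normal_density x * \<bar>x\<bar>)"
          unfolding real_norm_def by (rule abs_ge_self)
        finally show ?thesis .
      qed
    qed
  qed measurable
  then show ?thesis by (subst integrable_density) auto
qed

lemma prob_space_std_normal: "prob_space std_normal_distribution"
  by (rule prob_space_normal_density) simp

lemma AE_std_normal_nonzero: "AE x in std_normal_distribution. x \<noteq> 0"
  using AE_lborel_singleton[of 0] by (subst AE_density) auto

text \<open>The projections of \<open>W\<close> have the same law for every \<open>t\<close>.
  Integrating \<open>ln_norm_Re_cis\<close> over the sample space and exchanging the integrals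
  expresses the logarithm of the modulus through that law. The bound on the absolute value prepares
  a second exchange, over the points of a circle.\<close>

lemma (in prob_space) expectation_ln_norm_circular:
  fixes W :: "'a \<Rightarrow> complex"
  assumes W [measurable]: "W \<in> borel_measurable M" and \<sigma>: "\<sigma> > 0"
    and law: "\<And>t. distr M borel (\<lambda>\<omega>. Re (cis t * W \<omega>)) = distr std_normal_distribution borel (\<lambda>x. \<sigma> * x)"
  shows "integrable M (\<lambda>\<omega>. ln (cmod (W \<omega>)))"
    and "expectation (\<lambda>\<omega>. ln (cmod (W \<omega>))) = ln \<sigma> + ln 2 + (\<integral>x. ln \<bar>x\<bar> \<partial>std_normal_distribution)"
    and "expectation (\<lambda>\<omega>. \<bar>ln (cmod (W \<omega>))\<bar>) \<le> \<bar>ln \<sigma>\<bar> + ln 2 + (\<integral>x. \<bar>ln \<bar>x\<bar>\<bar> \<partial>std_normal_distribution)"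
    and "AE \<omega> in M. W \<omega> \<noteq> 0"
proof -
  interpret N: prob_space std_normal_distribution by (rule prob_space_std_normal)
  interpret P: pair_prob_space angle_measure M ..
  have int1: "integrable M (\<lambda>\<omega>. ln \<bar>Re (cis t * W \<omega>)\<bar>)"
    and val1: "expectation (\<lambda>\<omega>. ln \<bar>Re (cis t * W \<omega>)\<bar>) = ln \<sigma> + (\<integral>x. ln \<bar>x\<bar> \<partial>std_normal_distribution)"
    and abs1: "expectation (\<lambda>\<omega>. \<bar>ln \<bar>Re (cis t * W \<omega>)\<bar>\<bar>) \<le> \<bar>ln \<sigma>\<bar> + (\<integral>x. \<bar>ln \<bar>x\<bar>\<bar> \<partial>std_normal_distribution)" for t
  proof -
    have ae: "AE x in std_normal_distribution. ln \<bar>\<sigma> * x\<bar> = ln \<sigma> + ln \<bar>x\<bar>"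
      using AE_std_normal_nonzero by eventually_elim (use \<sigma> in \<open>simp add: abs_mult ln_mult\<close>)
    have i: "integrable std_normal_distribution (\<lambda>x. ln \<bar>\<sigma> * x\<bar>)"
      using integrable_cong_AE[OF _ _ ae] integrable_ln_std_normal by simp
    have v: "(\<integral>x. ln \<bar>\<sigma> * x\<bar> \<partial>std_normal_distribution) = ln \<sigma> + (\<integral>x. ln \<bar>x\<bar> \<partial>std_normal_distribution)"
      using integral_cong_AE[OF _ _ ae] integrable_ln_std_normal N.prob_space by simp
    have a: "(\<integral>x. \<bar>ln \<bar>\<sigma> * x\<bar>\<bar> \<partial>std_normal_distribution) \<le> (\<integral>x. \<bar>ln \<sigma>\<bar> + \<bar>ln \<bar>x\<bar>\<bar> \<partial>std_normal_distribution)"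
    proof (rule integral_mono_AE)
      show "AE x in std_normal_distribution. \<bar>ln \<bar>\<sigma> * x\<bar>\<bar> \<le> \<bar>ln \<sigma>\<bar> + \<bar>ln \<bar>x\<bar>\<bar>"
        using ae by eventually_elim auto
    qed (use i integrable_ln_std_normal in auto)
    have "integrable (distr M borel (\<lambda>\<omega>. Re (cis t * W \<omega>))) (\<lambda>x. ln \<bar>x\<bar>)"
      unfolding law using i by (subst integrable_distr_eq) auto
    then show "integrable M (\<lambda>\<omega>. ln \<bar>Re (cis t * W \<omega>)\<bar>)"
      by (subst (asm) integrable_distr_eq) auto
    have "expectation (\<lambda>\<omega>. ln \<bar>Re (cis t * W \<omega>)\<bar>) = (\<integral>x. ln \<bar>x\<bar> \<partial>distr M borel (\<lambda>\<omega>. Re (cis t * W \<omega>)))"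
      by (subst integral_distr) auto
    also have "\<dots> = (\<integral>x. ln \<bar>\<sigma> * x\<bar> \<partial>std_normal_distribution)"
      unfolding law by (subst integral_distr) auto
    finally show "expectation (\<lambda>\<omega>. ln \<bar>Re (cis t * W \<omega>)\<bar>) = ln \<sigma> + (\<integral>x. ln \<bar>x\<bar> \<partial>std_normal_distribution)"
      using v by simp
    have "expectation (\<lambda>\<omega>. \<bar>ln \<bar>Re (cis t * W \<omega>)\<bar>\<bar>) = (\<integral>x. \<bar>ln \<bar>x\<bar>\<bar> \<partial>distr M borel (\<lambda>\<omega>. Re (cis t * W \<omega>)))"
      by (subst integral_distr) auto
    also have "\<dots> = (\<integral>x. \<bar>ln \<bar>\<sigma> * x\<bar>\<bar> \<partial>std_normal_distribution)"
      unfolding law by (subst integral_distr) auto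
    also have "\<dots> \<le> \<bar>ln \<sigma>\<bar> + (\<integral>x. \<bar>ln \<bar>x\<bar>\<bar> \<partial>std_normal_distribution)"
      using a integrable_ln_std_normal N.prob_space by simp
    finally show "expectation (\<lambda>\<omega>. \<bar>ln \<bar>Re (cis t * W \<omega>)\<bar>\<bar>) \<le> \<bar>ln \<sigma>\<bar> + (\<integral>x. \<bar>ln \<bar>x\<bar>\<bar> \<partial>std_normal_distribution)" .
  qed
  show nz: "AE \<omega> in M. W \<omega> \<noteq> 0"
  proof -
    have "AE x in std_normal_distribution. \<sigma> * x \<noteq> 0"
      using AE_std_normal_nonzero by eventually_elim (use \<sigma> in simp)
    then have "AE x in distr M borel (\<lambda>\<omega>. Re (cis 0 * W \<omega>)). x \<noteq> 0"
      unfolding law by (subst AE_distr_iff) auto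
    then have "AE \<omega> in M. Re (cis 0 * W \<omega>) \<noteq> 0" by (subst (asm) AE_distr_iff) auto
    then show ?thesis by eventually_elim auto
  qed
  define g where "g = (\<lambda>(t, \<omega>). ln \<bar>Re (cis t * W \<omega>)\<bar>)"
  have g_meas [measurable]: "g \<in> borel_measurable (angle_measure \<Otimes>\<^sub>M M)" unfolding g_def by measurable
  \<comment> \<open>The bound \<open>abs1\<close> does not depend on \<open>t\<close>, which gives
    joint integrability on the product of two probability spaces.\<close>
  have gint: "integrable (angle_measure \<Otimes>\<^sub>M M) g"
  proof (rule P.Fubini_integrable[OF g_meas])
    show "AE t in angle_measure. integrable M (\<lambda>\<omega>. g (t, \<omega>))" using int1 by (simp add: g_def)
    show "integrable angle_measure (\<lambda>t. \<integral>\<omega>. norm (g (t, \<omega>)) \<partial>M)"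
    proof (rule angle.integrable_const_bound)
      show "AE t in angle_measure. norm (\<integral>\<omega>. norm (g (t, \<omega>)) \<partial>M) \<le> \<bar>ln \<sigma>\<bar> + (\<integral>x. \<bar>ln \<bar>x\<bar>\<bar> \<partial>std_normal_distribution)"
        using abs1 by (simp add: g_def)
    qed measurable
  qed
  have gint': "integrable (angle_measure \<Otimes>\<^sub>M M) (case_prod (\<lambda>t \<omega>. ln \<bar>Re (cis t * W \<omega>)\<bar>))"
    using gint by (simp add: g_def)
  have ae: "AE \<omega> in M. (\<integral>t. ln \<bar>Re (cis t * W \<omega>)\<bar> \<partial>angle_measure) = ln (cmod (W \<omega>)) - ln 2"
    using nz by eventually_elim (rule ln_norm_Re_cis)
  have ae': "AE \<omega> in M. \<bar>ln (cmod (W \<omega>))\<bar> \<le> (\<integral>t. \<bar>ln \<bar>Re (cis t * W \<omega>)\<bar>\<bar> \<partial>angle_measure) + ln 2"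
    using nz
  proof eventually_elim
    case (elim \<omega>)
    have "\<bar>ln (cmod (W \<omega>)) - ln 2\<bar> \<le> (\<integral>t. \<bar>ln \<bar>Re (cis t * W \<omega>)\<bar>\<bar> \<partial>angle_measure)"
      using ln_norm_Re_cis[OF elim] integral_abs_bound[of angle_measure "\<lambda>t. ln \<bar>Re (cis t * W \<omega>)\<bar>"] by simp
    moreover have "0 \<le> ln (2::real)" by simp
    ultimately show ?case by linarith
  qed
  have "integrable M (\<lambda>\<omega>. ln (cmod (W \<omega>)) - ln 2)"
    using integrable_cong_AE[OF _ _ ae] P.integrable_snd[OF gint'] by simp
  from Bochner_Integration.integrable_add[OF this integrable_const[of "ln 2"]]
  show int: "integrable M (\<lambda>\<omega>. ln (cmod (W \<omega>)))" by simp
  have "expectation (\<lambda>\<omega>. ln (cmod (W \<omega>)) - ln 2) = expectation (\<lambda>\<omega>. \<integral>t. ln \<bar>Re (cis t * W \<omega>)\<bar> \<partial>angle_measure)"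
    using integral_cong_AE[OF _ _ ae] by simp
  also have "\<dots> = (\<integral>t. expectation (\<lambda>\<omega>. ln \<bar>Re (cis t * W \<omega>)\<bar>) \<partial>angle_measure)"
    by (rule P.Fubini_integral[OF gint'])
  also have "\<dots> = ln \<sigma> + (\<integral>x. ln \<bar>x\<bar> \<partial>std_normal_distribution)" unfolding val1 by simp
  finally show "expectation (\<lambda>\<omega>. ln (cmod (W \<omega>))) = ln \<sigma> + ln 2 + (\<integral>x. ln \<bar>x\<bar> \<partial>std_normal_distribution)"
    using int by (simp add: prob_space)
  have gabs: "integrable (angle_measure \<Otimes>\<^sub>M M) (case_prod (\<lambda>t \<omega>. \<bar>ln \<bar>Re (cis t * W \<omega>)\<bar>\<bar>))"
    using integrable_abs[OF gint'] by (simp add: case_prod_unfold)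
  have "expectation (\<lambda>\<omega>. \<bar>ln (cmod (W \<omega>))\<bar>) \<le> expectation (\<lambda>\<omega>. (\<integral>t. \<bar>ln \<bar>Re (cis t * W \<omega>)\<bar>\<bar> \<partial>angle_measure) + ln 2)"
    using int P.integrable_snd[OF gabs] ae' by (intro integral_mono_AE) auto
  also have "\<dots> = expectation (\<lambda>\<omega>. (\<integral>t. \<bar>ln \<bar>Re (cis t * W \<omega>)\<bar>\<bar> \<partial>angle_measure)) + ln 2"
    using P.integrable_snd[OF gabs] by (simp add: prob_space)
  also have "expectation (\<lambda>\<omega>. (\<integral>t. \<bar>ln \<bar>Re (cis t * W \<omega>)\<bar>\<bar> \<partial>angle_measure)) = (\<integral>t. expectation (\<lambda>\<omega>. \<bar>ln \<bar>Re (cis t * W \<omega>)\<bar>\<bar>) \<partial>angle_measure)"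
    by (rule P.Fubini_integral[OF gabs])
  also have "\<dots> \<le> (\<integral>t. \<bar>ln \<sigma>\<bar> + (\<integral>x. \<bar>ln \<bar>x\<bar>\<bar> \<partial>std_normal_distribution) \<partial>angle_measure)"
    using P.integrable_fst[OF gabs] abs1 by (intro integral_mono) auto
  finally show "expectation (\<lambda>\<omega>. \<bar>ln (cmod (W \<omega>))\<bar>) \<le> \<bar>ln \<sigma>\<bar> + ln 2 + (\<integral>x. \<bar>ln \<bar>x\<bar>\<bar> \<partial>std_normal_distribution)"
    by simp
qed

section \<open>Gaussian processes and their power series\<close>

text \<open>With mean zero, the degenerate case of \<open>real_gaussian\<close> is the constant 0
  with variance 0, so one formula covers both cases.\<close>

lemma (in prob_space) char_real_gaussian:
  assumes g: "real_gaussian M X" and mean: "expectation X = 0"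
  shows "char (distr M borel X) t = of_real (exp (- (expectation (\<lambda>\<omega>. (X \<omega>)\<^sup>2) * t\<^sup>2 / 2)))"
proof -
  have [measurable]: "X \<in> borel_measurable M" using g by (simp add: real_gaussian_def)
  have ch: "char (distr M borel X) t = expectation (\<lambda>\<omega>. iexp (t * X \<omega>))"
    unfolding char_def by (subst integral_distr) auto
  from g consider (const) \<mu> where "AE \<omega> in M. X \<omega> = \<mu>"
    | (normal) \<mu> \<sigma> where "\<sigma> > 0" "distributed M lborel X (\<lambda>x. ennreal (normal_density \<mu> \<sigma> x))"
    by (auto simp: real_gaussian_def)
  then show ?thesis
  proof cases
    case const
    have "expectation X = expectation (\<lambda>_. \<mu>)" by (rule integral_cong_AE) (use const in auto)
    then have "\<mu> = 0" using mean by (simp add: prob_space)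
    then have ae: "AE \<omega> in M. X \<omega> = 0" using const by simp
    have "expectation (\<lambda>\<omega>. (X \<omega>)\<^sup>2) = expectation (\<lambda>_. 0)"
      by (rule integral_cong_AE) (use ae in auto)
    moreover have "expectation (\<lambda>\<omega>. iexp (t * X \<omega>)) = expectation (\<lambda>_. 1)"
      by (rule integral_cong_AE) (use ae in auto)
    ultimately show ?thesis unfolding ch by (simp add: prob_space)
  next
    case normal
    have mu: "\<mu> = 0" using normal_distributed_expectation[OF normal] mean by simp
    have var: "expectation (\<lambda>\<omega>. (X \<omega>)\<^sup>2) = \<sigma>\<^sup>2"
      using normal_distributed_variance[OF normal] mean by simp
    have "distributed M lborel (\<lambda>\<omega>. (X \<omega> - \<mu>) / \<sigma>) std_normal_density"
      using normal normal_standard_normal_convert by blast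
    then have "distr M lborel (\<lambda>\<omega>. X \<omega> / \<sigma>) = std_normal_distribution"
      unfolding mu by (simp add: distributed_def)
    then have d: "distr M borel (\<lambda>\<omega>. X \<omega> / \<sigma>) = std_normal_distribution"
      by (metis distr_cong sets_lborel)
    have "char std_normal_distribution (\<sigma> * t) = expectation (\<lambda>\<omega>. iexp ((\<sigma> * t) * (X \<omega> / \<sigma>)))"
      unfolding d[symmetric] char_def by (subst integral_distr) auto
    also have "\<dots> = expectation (\<lambda>\<omega>. iexp (t * X \<omega>))"
      using normal(1) by (intro Bochner_Integration.integral_cong) auto
    finally show ?thesis unfolding ch var
      by (simp add: char_std_normal_distribution power_mult_distrib)
  qed
qed

lemma char_scaled_std_normal:
  "char (distr std_normal_distribution borel (\<lambda>x. \<sigma> * x)) t = of_real (exp (- (\<sigma>\<^sup>2 * t\<^sup>2 / 2)))"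
proof -
  have "char (distr std_normal_distribution borel (\<lambda>x. \<sigma> * x)) t = (\<integral>x. iexp (t * (\<sigma> * x)) \<partial>std_normal_distribution)"
    unfolding char_def by (subst integral_distr) auto
  also have "\<dots> = char std_normal_distribution (\<sigma> * t)"
    unfolding char_def by (intro Bochner_Integration.integral_cong) (auto simp: mult_ac)
  finally show ?thesis by (simp add: char_std_normal_distribution power_mult_distrib)
qed

lemma le_one_plus_square: "x \<le> 1 + x\<^sup>2" for x :: real
proof -
  have "0 \<le> (x - 1 / 2)\<^sup>2" by simp
  then show ?thesis by (simp add: power2_eq_square algebra_simps)
qed

definition spectral_potential :: "(int \<Rightarrow> complex) \<Rightarrow> complex \<Rightarrow> real" where
  "spectral_potential \<gamma> z = 1 + 2 * Re (G_fun \<gamma> z)"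

section \<open>Second moments of the process\<close>

locale finitely_dependent_gaussian = prob_space M for M :: "'a measure" +
  fixes \<xi> :: "int \<Rightarrow> 'a \<Rightarrow> complex"
  assumes gaussian: "complex_gaussian_process M \<xi>"
    and stationary: "stationary_process M \<xi>"
    and centered: "centered_process M \<xi>"
    and unit: "unit_variance M \<xi>"
    and fin_dep: "finitely_dependent M \<xi>"
begin

abbreviation \<gamma> where "\<gamma> \<equiv> autocov M \<xi>"

lemma xi_measurable [measurable]: "\<xi> k \<in> borel_measurable M"
  using gaussian by (simp add: complex_gaussian_process_def)

lemma gaussian_combination: "finite S \<Longrightarrow> real_gaussian M (\<lambda>\<omega>. Re (\<Sum>k\<in>S. a k * \<xi> k \<omega>))"
  using gaussian unfolding complex_gaussian_process_def by blast

lemma process_measurable: "(\<lambda>\<omega> k. \<eta> k \<omega>) \<in> measurable M (\<Pi>\<^sub>M k\<in>UNIV. borel)"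
  if "\<And>k. \<eta> k \<in> borel_measurable M" for \<eta> :: "int \<Rightarrow> 'a \<Rightarrow> complex"
  by (rule measurable_PiM_single') (use that in auto)

text \<open>Transfers equality of laws to moments; it is applied to a shift for stationarity and to
  a rotation for circular symmetry.\<close>

lemma expectation_process_law:
  fixes h :: "(int \<Rightarrow> complex) \<Rightarrow> 'b :: {banach, second_countable_topology}"
  assumes "\<And>k. \<eta> k \<in> borel_measurable M" "process_law M \<eta> = process_law M \<xi>"
    and [measurable]: "h \<in> borel_measurable (\<Pi>\<^sub>M k\<in>UNIV. borel)"
  shows "expectation (\<lambda>\<omega>. h (\<lambda>k. \<eta> k \<omega>)) = expectation (\<lambda>\<omega>. h (\<lambda>k. \<xi> k \<omega>))"
proof -
  have "integral\<^sup>L (process_law M \<zeta>) h = expectation (\<lambda>\<omega>. h (\<lambda>k. \<zeta> k \<omega>))"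
    if "\<And>k. \<zeta> k \<in> borel_measurable M" for \<zeta>
    unfolding process_law_def by (subst integral_distr[OF process_measurable[OF that]]) auto
  from this[of \<eta>] this[of \<xi>] show ?thesis using assms by simp
qed

text \<open>A non-integrable function has integral 0 by default, so the value 1 forces
  integrability.\<close>

lemma integrable_xi_sq: "integrable M (\<lambda>\<omega>. (cmod (\<xi> k \<omega>))\<^sup>2)"
  using unit not_integrable_integral_eq[of M "\<lambda>\<omega>. (cmod (\<xi> k \<omega>))\<^sup>2"] by (auto simp: unit_variance_def)

lemma integrable_xi: "integrable M (\<xi> k)"
proof (rule Bochner_Integration.integrable_bound)
  show "integrable M (\<lambda>\<omega>. 1 + (cmod (\<xi> k \<omega>))\<^sup>2)" using integrable_xi_sq by simp
  show "AE \<omega> in M. norm (\<xi> k \<omega>) \<le> norm (1 + (cmod (\<xi> k \<omega>))\<^sup>2)"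
    using le_one_plus_square by simp
qed simp

lemma expectation_norm_xi: "expectation (\<lambda>\<omega>. cmod (\<xi> k \<omega>)) \<le> 2"
proof -
  have "expectation (\<lambda>\<omega>. cmod (\<xi> k \<omega>)) \<le> expectation (\<lambda>\<omega>. 1 + (cmod (\<xi> k \<omega>))\<^sup>2)"
    using integrable_xi integrable_xi_sq by (intro integral_mono) (auto intro: le_one_plus_square)
  also have "\<dots> = 2" using integrable_xi_sq unit by (simp add: prob_space unit_variance_def)
  finally show ?thesis .
qed

lemma mult_norm_le: "cmod a * cmod b \<le> (cmod a)\<^sup>2 + (cmod b)\<^sup>2"
proof -
  have "2 * (cmod a * cmod b) \<le> (cmod a)\<^sup>2 + (cmod b)\<^sup>2"
    using sum_squares_bound[of "cmod a" "cmod b"] by (simp add: mult.assoc)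
  moreover have "0 \<le> cmod a * cmod b" by simp
  ultimately show ?thesis by linarith
qed

lemma integrable_xi_mult: "integrable M (\<lambda>\<omega>. \<xi> k \<omega> * \<xi> l \<omega>)"
  by (rule Bochner_Integration.integrable_bound[OF Bochner_Integration.integrable_add[OF integrable_xi_sq[of k] integrable_xi_sq[of l]]])
     (auto simp: norm_mult mult_norm_le)

lemma integrable_xi_mult_cnj: "integrable M (\<lambda>\<omega>. \<xi> k \<omega> * cnj (\<xi> l \<omega>))"
  by (rule Bochner_Integration.integrable_bound[OF Bochner_Integration.integrable_add[OF integrable_xi_sq[of k] integrable_xi_sq[of l]]])
     (auto simp: norm_mult mult_norm_le)

lemma covariance: "expectation (\<lambda>\<omega>. \<xi> k \<omega> * cnj (\<xi> l \<omega>)) = \<gamma> (l - k)"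
proof -
  have "expectation (\<lambda>\<omega>. (\<lambda>x. x 0 * cnj (x (l - k))) (\<lambda>j. \<xi> (j + k) \<omega>)) =
        expectation (\<lambda>\<omega>. (\<lambda>x. x 0 * cnj (x (l - k))) (\<lambda>j. \<xi> j \<omega>))"
    by (rule expectation_process_law) (use stationary in \<open>auto simp: stationary_process_def\<close>)
  then show ?thesis by (simp add: autocov_def)
qed

text \<open>Rotation by a right angle preserves the law and multiplies the product by -1, so the
  expectation equals its own negative.\<close>

lemma pseudo_covariance: "expectation (\<lambda>\<omega>. \<xi> k \<omega> * \<xi> l \<omega>) = 0"
proof -
  have "expectation (\<lambda>\<omega>. (\<lambda>x. x k * x l) (\<lambda>j. cis (pi/2) * \<xi> j \<omega>)) =
        expectation (\<lambda>\<omega>. (\<lambda>x. x k * x l) (\<lambda>j. \<xi> j \<omega>))"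
    by (rule expectation_process_law) (use gaussian[unfolded complex_gaussian_process_def, THEN conjunct2, THEN conjunct2, THEN spec, of "pi/2"] in measurable)
  moreover have "cis (pi/2) * \<xi> k \<omega> * (cis (pi/2) * \<xi> l \<omega>) = - (\<xi> k \<omega> * \<xi> l \<omega>)" for \<omega>
    by (simp add: mult.assoc mult.left_commute)
  ultimately have "- expectation (\<lambda>\<omega>. \<xi> k \<omega> * \<xi> l \<omega>) = expectation (\<lambda>\<omega>. \<xi> k \<omega> * \<xi> l \<omega>)"
    by simp
  then show ?thesis unfolding complex_eq_iff by simp
qed

lemma gamma_0: "\<gamma> 0 = 1"
proof -
  have "\<gamma> 0 = expectation (\<lambda>\<omega>. of_real ((cmod (\<xi> 0 \<omega>))\<^sup>2))"
    unfolding autocov_def complex_norm_square ..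
  then show ?thesis using unit by (simp only: integral_complex_of_real unit_variance_def) simp
qed

lemma gamma_uminus: "\<gamma> (- n) = cnj (\<gamma> n)"
proof -
  have "\<gamma> (- n) = expectation (\<lambda>\<omega>. \<xi> n \<omega> * cnj (\<xi> 0 \<omega>))" using covariance[of n 0] by simp
  also have "\<dots> = expectation (\<lambda>\<omega>. cnj (\<xi> 0 \<omega> * cnj (\<xi> n \<omega>)))" by (simp add: mult.commute)
  also have "\<dots> = cnj (\<gamma> n)" unfolding autocov_def by (rule Bochner_Integration.integral_cnj)
  finally show ?thesis .
qed

definition L where "L = (SOME m. \<forall>n\<ge>m. \<gamma> (int n) = 0)"

lemma gamma_eq_0: "n \<ge> L \<Longrightarrow> \<gamma> (int n) = 0"
proof -
  obtain m where m: "\<And>k. \<bar>k\<bar> > m \<Longrightarrow> \<gamma> k = 0" using fin_dep by (auto simp: finitely_dependent_def)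
  have "\<exists>m. \<forall>n\<ge>m. \<gamma> (int n) = 0"
    by (rule exI[of _ "nat m + 1"]) (auto intro!: m)
  from someI_ex[OF this] show "n \<ge> L \<Longrightarrow> \<gamma> (int n) = 0" unfolding L_def by auto
qed

lemma G_fun_eq_sum:
  assumes "n \<ge> L"
  shows "G_fun \<gamma> z = (\<Sum>k<n. cnj (\<gamma> (int (Suc k))) * z ^ Suc k)"
  unfolding G_fun_def by (rule suminf_finite) (use assms gamma_eq_0 in \<open>auto simp del: of_nat_Suc\<close>)

text \<open>From \<open>2 * (Re x)\<^sup>2 = Re (x * x) + Re (x * cnj x)\<close>: the first term has
  mean zero by \<open>pseudo_covariance\<close>, so the real part carries half of E |X|^2. The
  equation between complex numbers also records that the double sum is real.\<close>

lemma linear_combination_moments: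
  fixes a :: "int \<Rightarrow> complex"
  assumes "finite S"
  defines "X \<equiv> \<lambda>\<omega>. \<Sum>k\<in>S. a k * \<xi> k \<omega>"
  shows "expectation (\<lambda>\<omega>. Re (X \<omega>)) = 0"
    and "of_real (2 * expectation (\<lambda>\<omega>. (Re (X \<omega>))\<^sup>2)) = (\<Sum>k\<in>S. \<Sum>l\<in>S. a k * cnj (a l) * \<gamma> (l - k))"
proof -
  have X_int: "integrable M X" unfolding X_def by (intro Bochner_Integration.integrable_sum integrable_mult_right integrable_xi)
  have "expectation X = 0"
    unfolding X_def using centered
    by (subst Bochner_Integration.integral_sum) (auto intro!: integrable_mult_right integrable_xi simp: centered_process_def)
  then show "expectation (\<lambda>\<omega>. Re (X \<omega>)) = 0" using integral_Re[OF X_int] by simp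
  have sq: "X \<omega> * X \<omega> = (\<Sum>k\<in>S. \<Sum>l\<in>S. a k * a l * (\<xi> k \<omega> * \<xi> l \<omega>))" for \<omega>
    unfolding X_def sum_product by (intro sum.cong refl) (simp add: mult_ac)
  have sqc: "X \<omega> * cnj (X \<omega>) = (\<Sum>k\<in>S. \<Sum>l\<in>S. a k * cnj (a l) * (\<xi> k \<omega> * cnj (\<xi> l \<omega>)))" for \<omega>
    unfolding X_def cnj_sum sum_product by (intro sum.cong refl) (simp add: mult_ac)
  have i1: "integrable M (\<lambda>\<omega>. X \<omega> * X \<omega>)" and i2: "integrable M (\<lambda>\<omega>. X \<omega> * cnj (X \<omega>))"
    unfolding sq sqc by (intro Bochner_Integration.integrable_sum integrable_mult_right integrable_xi_mult integrable_xi_mult_cnj)+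
  have e1: "expectation (\<lambda>\<omega>. X \<omega> * X \<omega>) = 0"
    unfolding sq by (subst Bochner_Integration.integral_sum)
      (auto intro!: Bochner_Integration.integrable_sum integrable_mult_right integrable_xi_mult sum.neutral
        simp: Bochner_Integration.integral_sum integrable_xi_mult pseudo_covariance)
  have e2: "expectation (\<lambda>\<omega>. X \<omega> * cnj (X \<omega>)) = (\<Sum>k\<in>S. \<Sum>l\<in>S. a k * cnj (a l) * \<gamma> (l - k))"
    unfolding sqc by (subst Bochner_Integration.integral_sum)
      (auto intro!: Bochner_Integration.integrable_sum integrable_mult_right integrable_xi_mult_cnj sum.cong
        simp: Bochner_Integration.integral_sum integrable_xi_mult_cnj covariance)
  have re: "2 * (Re x)\<^sup>2 = Re (x * x) + Re (x * cnj x)" for x by (simp add: power2_eq_square)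
  have "2 * expectation (\<lambda>\<omega>. (Re (X \<omega>))\<^sup>2) = expectation (\<lambda>\<omega>. Re (X \<omega> * X \<omega>) + Re (X \<omega> * cnj (X \<omega>)))"
    unfolding re[symmetric] by simp
  also have "\<dots> = Re (\<Sum>k\<in>S. \<Sum>l\<in>S. a k * cnj (a l) * \<gamma> (l - k))"
    unfolding e2[symmetric] using i1 i2 e1 by (simp only: Bochner_Integration.integral_add integrable_Re integral_Re) simp
  finally have *: "2 * expectation (\<lambda>\<omega>. (Re (X \<omega>))\<^sup>2) = Re (\<Sum>k\<in>S. \<Sum>l\<in>S. a k * cnj (a l) * \<gamma> (l - k))" .
  have "(\<Sum>k\<in>S. \<Sum>l\<in>S. a k * cnj (a l) * \<gamma> (l - k)) = expectation (\<lambda>\<omega>. of_real ((cmod (X \<omega>))\<^sup>2))"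
    unfolding e2[symmetric] complex_norm_square ..
  also have "\<dots> = of_real (expectation (\<lambda>\<omega>. (cmod (X \<omega>))\<^sup>2))" by (rule integral_complex_of_real)
  finally show "of_real (2 * expectation (\<lambda>\<omega>. (Re (X \<omega>))\<^sup>2)) = (\<Sum>k\<in>S. \<Sum>l\<in>S. a k * cnj (a l) * \<gamma> (l - k))"
    unfolding * by simp
qed

text \<open>This is E |f_n(z)|^2 for the partial sum f_n of the first \<open>n\<close> terms of the
  power series.\<close>

definition partial_cov :: "nat \<Rightarrow> complex \<Rightarrow> complex" where
  "partial_cov n z = (\<Sum>k<n. \<Sum>l<n. \<gamma> (int l - int k) * z ^ k * cnj z ^ l)"

text \<open>Split off the row \<open>k = 0\<close> and the column \<open>l = 0\<close>. Once
  \<open>n\<close> exceeds the range of dependence, this border is 1 + conj G + G, and the remaining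
  block is the previous sum with one more factor \<open>z\<close> and one more factor
  \<open>cnj z\<close> in each term.\<close>

lemma partial_cov_Suc:
  assumes "n \<ge> L"
  shows "partial_cov (Suc n) z = of_real ((cmod z)\<^sup>2) * partial_cov n z + of_real (spectral_potential \<gamma> z)"
proof -
  have "partial_cov (Suc n) z = (\<Sum>l<Suc n. \<gamma> (int l) * cnj z ^ l) +
      (\<Sum>k<n. \<Sum>l<Suc n. \<gamma> (int l - int (Suc k)) * z ^ Suc k * cnj z ^ l)"
    unfolding partial_cov_def by (subst sum.lessThan_Suc_shift) simp
  also have "(\<Sum>k<n. \<Sum>l<Suc n. \<gamma> (int l - int (Suc k)) * z ^ Suc k * cnj z ^ l) =
      (\<Sum>k<n. \<gamma> (- int (Suc k)) * z ^ Suc k + (\<Sum>l<n. \<gamma> (int l - int k) * z ^ Suc k * cnj z ^ Suc l))"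
    by (intro sum.cong refl, subst sum.lessThan_Suc_shift) simp
  also have "\<dots> = G_fun \<gamma> z + of_real ((cmod z)\<^sup>2) * partial_cov n z"
    unfolding sum.distrib gamma_uminus G_fun_eq_sum[OF assms] partial_cov_def complex_norm_square sum_distrib_left
    by (simp add: mult_ac)
  also have "(\<Sum>l<Suc n. \<gamma> (int l) * cnj z ^ l) = 1 + cnj (G_fun \<gamma> z)"
    unfolding G_fun_eq_sum[OF assms] by (subst sum.lessThan_Suc_shift) (simp add: gamma_0)
  finally show ?thesis
    using complex_add_cnj[of "G_fun \<gamma> z"] by (simp add: spectral_potential_def algebra_simps)
qed

lemma partial_cov_tendsto:
  assumes "cmod z < 1"
  shows "(\<lambda>n. partial_cov n z) \<longlonglongrightarrow> of_real (spectral_potential \<gamma> z / (1 - (cmod z)\<^sup>2))"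
proof -
  define q where "q = (cmod z)\<^sup>2"
  have q: "0 \<le> q" "q < 1" using assms by (auto simp: q_def power_less_one_iff)
  \<comment> \<open>\<open>T\<close> is the fixed point of the affine recursion
    \<open>partial_cov_Suc\<close>, so the error shrinks geometrically with ratio
    \<open>q\<close>.\<close>
  define T where "T = (of_real (spectral_potential \<gamma> z / (1 - q)) :: complex)"
  have T: "T = of_real q * T + of_real (spectral_potential \<gamma> z)"
  proof -
    have "spectral_potential \<gamma> z / (1 - q) = q * (spectral_potential \<gamma> z / (1 - q)) + spectral_potential \<gamma> z"
      using q by (simp add: field_simps)
    then show ?thesis unfolding T_def of_real_mult[symmetric] of_real_add[symmetric] by (rule arg_cong)
  qed
  have "partial_cov (j + L) z = T + of_real q ^ j * (partial_cov L z - T)" for j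
  proof (induction j)
    case (Suc j)
    have "partial_cov (Suc j + L) z = of_real q * partial_cov (j + L) z + of_real (spectral_potential \<gamma> z)"
      using partial_cov_Suc[of "j + L" z] by (simp add: q_def)
    also have "\<dots> = (of_real q * T + of_real (spectral_potential \<gamma> z)) + of_real q ^ Suc j * (partial_cov L z - T)"
      unfolding Suc by (simp add: algebra_simps)
    finally show ?case using T by simp
  qed simp
  moreover have "(\<lambda>j. T + of_real q ^ j * (partial_cov L z - T)) \<longlonglongrightarrow> T + 0 * (partial_cov L z - T)"
    by (intro tendsto_intros LIMSEQ_power_zero) (use q in auto)
  ultimately have "(\<lambda>j. partial_cov (j + L) z) \<longlonglongrightarrow> T" by simp
  then show ?thesis unfolding T_def q_def by (rule LIMSEQ_offset)
qed

section \<open>The random power series and its one-dimensional projections\<close>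

lemma AE_summable: "AE \<omega> in M. \<forall>z. cmod z < 1 \<longrightarrow> summable (\<lambda>k. norm (\<xi> (int k) \<omega> * z ^ k))"
proof -
  have one: "AE \<omega> in M. summable (\<lambda>k. cmod (\<xi> (int k) \<omega>) * t ^ k)" if t: "0 \<le> t" "t < 1" for t :: real
  proof -
    have "(\<integral>\<^sup>+\<omega>. (\<Sum>k. ennreal (cmod (\<xi> (int k) \<omega>) * t ^ k)) \<partial>M) = (\<Sum>k. \<integral>\<^sup>+\<omega>. ennreal (cmod (\<xi> (int k) \<omega>) * t ^ k) \<partial>M)"
      by (rule nn_integral_suminf) simp
    also have "\<dots> \<le> (\<Sum>k. ennreal (2 * t ^ k))"
    proof (rule suminf_le)
      fix k
      have "(\<integral>\<^sup>+\<omega>. ennreal (cmod (\<xi> (int k) \<omega>) * t ^ k) \<partial>M) = ennreal (expectation (\<lambda>\<omega>. cmod (\<xi> (int k) \<omega>) * t ^ k))"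
        using integrable_xi t by (intro nn_integral_eq_integral) auto
      also have "\<dots> \<le> ennreal (2 * t ^ k)"
        using expectation_norm_xi[of "int k"] integrable_xi t by (intro ennreal_leI) (auto intro!: mult_right_mono)
      finally show "(\<integral>\<^sup>+\<omega>. ennreal (cmod (\<xi> (int k) \<omega>) * t ^ k) \<partial>M) \<le> ennreal (2 * t ^ k)" .
    qed auto
    also have "\<dots> < \<infinity>"
    proof -
      have "summable (\<lambda>k. 2 * t ^ k)" using t by (intro summable_mult summable_geometric) auto
      then have "(\<Sum>k. ennreal (2 * t ^ k)) = ennreal (\<Sum>k. 2 * t ^ k)"
        using t by (intro suminf_ennreal2) auto
      then show ?thesis by simp
    qed
    finally have "AE \<omega> in M. (\<Sum>k. ennreal (cmod (\<xi> (int k) \<omega>) * t ^ k)) \<noteq> \<infinity>"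
      by (intro nn_integral_PInf_AE) auto
    then show ?thesis
    proof eventually_elim
      case (elim \<omega>)
      then show ?case using t by (intro summable_suminf_not_top[where f = "\<lambda>k. cmod (\<xi> (int k) \<omega>) * t ^ k"]) simp_all
    qed
  qed
  \<comment> \<open>A single null set has to serve all \<open>z\<close>, hence a countable sequence
    of radii increasing to 1.\<close>
  have "AE \<omega> in M. \<forall>n::nat. summable (\<lambda>k. cmod (\<xi> (int k) \<omega>) * (1 - inverse (real (Suc n))) ^ k)"
    unfolding AE_all_countable by (intro allI one) (simp_all add: inverse_le_1_iff)
  then show ?thesis
  proof eventually_elim
    case (elim \<omega>)
    show ?case
    proof (intro allI impI)
      fix z :: complex assume "cmod z < 1"
      then obtain n where n: "inverse (real (Suc n)) < 1 - cmod z" using reals_Archimedean[of "1 - cmod z"] by auto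
      show "summable (\<lambda>k. norm (\<xi> (int k) \<omega> * z ^ k))"
      proof (rule summable_comparison_test'[OF elim[rule_format, of n]])
        show "norm (norm (\<xi> (int k) \<omega> * z ^ k)) \<le> cmod (\<xi> (int k) \<omega>) * (1 - inverse (real (Suc n))) ^ k" for k
          using n by (auto simp: norm_mult norm_power intro!: mult_left_mono power_mono)
      qed
    qed
  qed
qed

lemma power_series_measurable [measurable]: "(\<lambda>\<omega>. power_series \<xi> \<omega> z) \<in> borel_measurable M"
  unfolding power_series_def by measurable

lemma power_series_measurable_pair:
  "(\<lambda>(t, \<omega>). power_series \<xi> \<omega> (of_real r * cis t)) \<in> borel_measurable (angle_measure \<Otimes>\<^sub>M M)"
proof -
  show ?thesis unfolding power_series_def by measurable
qed

text \<open>Partial sums are Gaussian with known variance, and almost sure convergence passes to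
  characteristic functions by dominated convergence. The rotation \<open>cis t\<close> cancels in
  the covariance. The exponent has 4 instead of 2 because a real part carries half of the
  kernel.\<close>

lemma power_series_char:
  assumes z: "cmod z < 1"
  shows "char (distr M borel (\<lambda>\<omega>. Re (cis t * power_series \<xi> \<omega> z))) s =
    of_real (exp (- (spectral_potential \<gamma> z / (1 - (cmod z)\<^sup>2) * s\<^sup>2 / 4)))"
proof -
  define X where "X n \<omega> = (\<Sum>k\<in>int ` {..<n}. (cis t * z ^ nat k) * \<xi> k \<omega>)" for n \<omega>
  have X_eq: "X n \<omega> = cis t * (\<Sum>k<n. \<xi> (int k) \<omega> * z ^ k)" for n \<omega>
    unfolding X_def sum_distrib_left by (subst sum.reindex) (auto simp: mult_ac)
  have [measurable]: "X n \<in> borel_measurable M" for n unfolding X_def by measurable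
  have cov: "of_real (2 * expectation (\<lambda>\<omega>. (Re (X n \<omega>))\<^sup>2)) = partial_cov n z" for n
  proof -
    have "cis t * cnj (cis t) = 1" by (simp add: cis_cnj cis_mult)
    then have *: "(cis t * z ^ k) * cnj (cis t * z ^ l) = z ^ k * cnj z ^ l" for k l
    proof -
      have "(cis t * z ^ k) * cnj (cis t * z ^ l) = (cis t * cnj (cis t)) * (z ^ k * cnj z ^ l)"
        unfolding complex_cnj_mult complex_cnj_power by (simp only: mult_ac)
      then show ?thesis using \<open>cis t * cnj (cis t) = 1\<close> by simp
    qed
    have "of_real (2 * expectation (\<lambda>\<omega>. (Re (X n \<omega>))\<^sup>2)) =
       (\<Sum>k\<in>int ` {..<n}. \<Sum>l\<in>int ` {..<n}. (cis t * z ^ nat k) * cnj (cis t * z ^ nat l) * \<gamma> (l - k))"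
      unfolding X_def by (rule linear_combination_moments) auto
    also have "\<dots> = partial_cov n z"
      unfolding partial_cov_def * by (simp add: sum.reindex mult_ac)
    finally show ?thesis .
  qed
  have char_X: "char (distr M borel (\<lambda>\<omega>. Re (X n \<omega>))) s = of_real (exp (- (Re (partial_cov n z) * s\<^sup>2 / 4)))" for n
  proof -
    have "real_gaussian M (\<lambda>\<omega>. Re (X n \<omega>))"
      unfolding X_def by (rule gaussian_combination) auto
    moreover have "expectation (\<lambda>\<omega>. Re (X n \<omega>)) = 0"
      unfolding X_def by (rule linear_combination_moments) auto
    ultimately show ?thesis using char_real_gaussian[of "\<lambda>\<omega>. Re (X n \<omega>)" s]
      by (simp add: cov[of n, symmetric] del: of_real_mult)
  qed
  have lim1: "(\<lambda>n. char (distr M borel (\<lambda>\<omega>. Re (X n \<omega>))) s) \<longlonglongrightarrow>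
      of_real (exp (- (Re (of_real (spectral_potential \<gamma> z / (1 - (cmod z)\<^sup>2))) * s\<^sup>2 / 4)))"
    unfolding char_X by (intro tendsto_intros partial_cov_tendsto z) auto
  have lim2: "(\<lambda>n. char (distr M borel (\<lambda>\<omega>. Re (X n \<omega>))) s) \<longlonglongrightarrow>
      char (distr M borel (\<lambda>\<omega>. Re (cis t * power_series \<xi> \<omega> z))) s"
  proof -
    have ch: "char (distr M borel (\<lambda>\<omega>. Re (Y \<omega>))) s = expectation (\<lambda>\<omega>. iexp (s * Re (Y \<omega>)))"
      if [measurable]: "Y \<in> borel_measurable M" for Y
      unfolding char_def by (subst integral_distr) auto
    have "AE \<omega> in M. (\<lambda>n. iexp (s * Re (X n \<omega>))) \<longlonglongrightarrow> iexp (s * Re (cis t * power_series \<xi> \<omega> z))"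
      using AE_summable
    proof eventually_elim
      case (elim \<omega>)
      then have "summable (\<lambda>k. \<xi> (int k) \<omega> * z ^ k)" using z by (intro summable_norm_cancel[where f = "\<lambda>k. \<xi> (int k) \<omega> * z ^ k"]) (rule elim[rule_format])
      then have "(\<lambda>n. \<Sum>k<n. \<xi> (int k) \<omega> * z ^ k) \<longlonglongrightarrow> power_series \<xi> \<omega> z"
        unfolding power_series_def by (rule summable_LIMSEQ)
      then show ?case unfolding X_eq by (intro tendsto_intros)
    qed
    then have "(\<lambda>n. expectation (\<lambda>\<omega>. iexp (s * Re (X n \<omega>)))) \<longlonglongrightarrow> expectation (\<lambda>\<omega>. iexp (s * Re (cis t * power_series \<xi> \<omega> z)))"
      by (intro integral_dominated_convergence[where w = "\<lambda>_. 1"]) simp_all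
    moreover have "char (distr M borel (\<lambda>\<omega>. Re (X n \<omega>))) s = expectation (\<lambda>\<omega>. iexp (s * Re (X n \<omega>)))" for n
      by (rule ch) measurable
    moreover have "char (distr M borel (\<lambda>\<omega>. Re (cis t * power_series \<xi> \<omega> z))) s = expectation (\<lambda>\<omega>. iexp (s * Re (cis t * power_series \<xi> \<omega> z)))"
      by (rule ch) measurable
    ultimately show ?thesis by (simp only:)
  qed
  show ?thesis using LIMSEQ_unique[OF lim2 lim1] by (simp only: Re_complex_of_real)
qed

lemma power_series_law:
  assumes z: "cmod z < 1" and pos: "spectral_potential \<gamma> z > 0"
  shows "distr M borel (\<lambda>\<omega>. Re (cis t * power_series \<xi> \<omega> z)) =
    distr std_normal_distribution borel (\<lambda>x. sqrt (spectral_potential \<gamma> z / (1 - (cmod z)\<^sup>2) / 2) * x)"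
proof (rule Levy_uniqueness)
  interpret N: prob_space std_normal_distribution by (rule prob_space_std_normal)
  show "real_distribution (distr M borel (\<lambda>\<omega>. Re (cis t * power_series \<xi> \<omega> z)))"
    by (rule real_distribution_distr) measurable
  show "real_distribution (distr std_normal_distribution borel (\<lambda>x. sqrt (spectral_potential \<gamma> z / (1 - (cmod z)\<^sup>2) / 2) * x))"
    by (rule N.real_distribution_distr) measurable
  have "0 \<le> spectral_potential \<gamma> z / (1 - (cmod z)\<^sup>2)" using pos z
    by (intro divide_nonneg_nonneg) (auto simp: power_le_one)
  then have "(sqrt (spectral_potential \<gamma> z / (1 - (cmod z)\<^sup>2) / 2))\<^sup>2 = spectral_potential \<gamma> z / (1 - (cmod z)\<^sup>2) / 2"
    by (intro real_sqrt_pow2, intro divide_nonneg_pos[of _ 2], assumption, simp)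
  then show "char (distr M borel (\<lambda>\<omega>. Re (cis t * power_series \<xi> \<omega> z))) =
    char (distr std_normal_distribution borel (\<lambda>x. sqrt (spectral_potential \<gamma> z / (1 - (cmod z)\<^sup>2) / 2) * x))"
    unfolding fun_eq_iff power_series_char[OF z] char_scaled_std_normal by (simp only:) simp
qed

text \<open>\<open>partial_cov\<close> is twice the second moment of a real part, so its limit is
  nonnegative, and the denominator of that limit is positive in the disc.\<close>

lemma spectral_potential_nonneg:
  assumes "cmod z < 1"
  shows "spectral_potential \<gamma> z \<ge> 0"
proof -
  have "0 \<le> Re (partial_cov n z)" for n
  proof -
    have "of_real (2 * expectation (\<lambda>\<omega>. (Re (\<Sum>k\<in>int ` {..<n}. z ^ nat k * \<xi> k \<omega>))\<^sup>2)) =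
       (\<Sum>k\<in>int ` {..<n}. \<Sum>l\<in>int ` {..<n}. z ^ nat k * cnj (z ^ nat l) * \<gamma> (l - k))"
      by (rule linear_combination_moments) auto
    also have "\<dots> = partial_cov n z" unfolding partial_cov_def by (simp add: sum.reindex mult_ac)
    finally have "partial_cov n z = of_real (2 * expectation (\<lambda>\<omega>. (Re (\<Sum>k\<in>int ` {..<n}. z ^ nat k * \<xi> k \<omega>))\<^sup>2))" by (rule sym)
    then have "Re (partial_cov n z) = 2 * expectation (\<lambda>\<omega>. (Re (\<Sum>k\<in>int ` {..<n}. z ^ nat k * \<xi> k \<omega>))\<^sup>2)"
      by (simp only: Re_complex_of_real)
    then show ?thesis by (simp only:) (intro mult_nonneg_nonneg integral_nonneg, auto)
  qed
  then have "0 \<le> Re (of_real (spectral_potential \<gamma> z / (1 - (cmod z)\<^sup>2)))"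
    by (intro LIMSEQ_le_const[OF tendsto_Re[OF partial_cov_tendsto[OF assms]]]) auto
  moreover have "0 < 1 - (cmod z)\<^sup>2" using assms by (simp add: power_less_one_iff)
  ultimately show ?thesis by (simp add: zero_le_divide_iff)
qed

end

section \<open>The expected number of zeros\<close>

text \<open>Harnack's inequality by way of the Schwarz lemma: a Cayley transform carries the right
  half-plane to the unit disc and the value at 0 to 0.\<close>

lemma harnack_lower_bound:
  assumes hol: "h holomorphic_on ball 0 1" and h0: "h 0 = 1"
    and nonneg: "\<And>z. cmod z < 1 \<Longrightarrow> 0 \<le> Re (h z)" and z: "cmod z < 1"
  shows "(1 - cmod z) / (1 + cmod z) \<le> Re (h z)"
proof (rule field_le_epsilon)
  fix \<delta> :: real assume \<delta>: "\<delta> > 0"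
  \<comment> \<open>Adding \<open>\<delta>\<close> moves the function strictly into the right
    half-plane; \<open>a\<close> is the shifted value at 0, so that \<open>f\<close> vanishes
    there.\<close>
  define a where "a = 1 + \<delta>"
  define w where "w \<zeta> = h \<zeta> + of_real \<delta>" for \<zeta>
  have a: "a > 0" using \<delta> by (simp add: a_def)
  have wpos: "Re (w \<zeta>) > 0" if "cmod \<zeta> < 1" for \<zeta> using nonneg[OF that] \<delta> by (simp add: w_def)
  have den: "w \<zeta> + of_real a \<noteq> 0" if "cmod \<zeta> < 1" for \<zeta>
  proof
    assume "w \<zeta> + of_real a = 0"
    then have "Re (w \<zeta> + of_real a) = 0" by (simp only: zero_complex.sel)
    then show False using wpos[OF that] a by simp
  qed
  define f where "f \<zeta> = (w \<zeta> - of_real a) / (w \<zeta> + of_real a)" for \<zeta>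
  have lt: "cmod (v - of_real a) < cmod (v + of_real a)" if "Re v > 0" for v
  proof -
    have "(cmod (v - of_real a))\<^sup>2 < (cmod (v + of_real a))\<^sup>2"
      unfolding cmod_power2 using mult_pos_pos[OF that a] by (simp add: power2_eq_square algebra_simps)
    then show ?thesis by (rule power2_less_imp_less) simp
  qed
  have "cmod (f z) \<le> cmod z"
  proof (rule Schwarz_Lemma(1))
    show "f holomorphic_on ball 0 1" unfolding f_def w_def
      by (intro holomorphic_intros hol) (use den in \<open>auto simp: w_def\<close>)
    show "f 0 = 0" by (simp add: f_def w_def h0 a_def)
    show "cmod (f \<zeta>) < 1" if "cmod \<zeta> < 1" for \<zeta>
      using lt[OF wpos[OF that]] den[OF that] by (simp add: f_def norm_divide divide_less_eq)
  qed (rule z)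
  then have le: "cmod (w z - of_real a) \<le> cmod z * cmod (w z + of_real a)"
    using den[OF z] by (simp add: f_def norm_divide divide_le_eq)
  define x y \<rho> where "x = Re (w z)" and "y = Im (w z)" and "\<rho> = cmod z"
  have \<rho>: "0 \<le> \<rho>" "\<rho> < 1" using z by (auto simp: \<rho>_def)
  have "(cmod (w z - of_real a))\<^sup>2 \<le> (\<rho> * cmod (w z + of_real a))\<^sup>2"
    using le unfolding \<rho>_def by (rule power_mono) simp
  then have "(x - a)\<^sup>2 + y\<^sup>2 \<le> \<rho>\<^sup>2 * ((x + a)\<^sup>2 + y\<^sup>2)"
    unfolding power_mult_distrib cmod_power2 by (simp add: x_def y_def)
  moreover have "\<rho>\<^sup>2 * y\<^sup>2 \<le> 1 * y\<^sup>2"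
    using \<rho> by (intro mult_right_mono) (auto simp: power_le_one)
  ultimately have "(x - a)\<^sup>2 \<le> (\<rho> * (x + a))\<^sup>2" unfolding power_mult_distrib distrib_left[of "\<rho>\<^sup>2"] by linarith
  moreover have "0 \<le> \<rho> * (x + a)" using \<rho> a wpos[OF z] by (simp add: x_def)
  ultimately have "\<bar>x - a\<bar> \<le> \<rho> * (x + a)" by (metis abs_le_square_iff abs_of_nonneg)
  then have "a * (1 - \<rho>) \<le> x * (1 + \<rho>)" by (simp add: abs_if algebra_simps split: if_splits)
  moreover have "1 * (1 - \<rho>) \<le> a * (1 - \<rho>)" using \<rho> \<delta> by (intro mult_right_mono) (auto simp: a_def)
  ultimately have "1 * (1 - \<rho>) \<le> x * (1 + \<rho>)" by (rule order_trans[rotated])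
  then have "(1 - \<rho>) / (1 + \<rho>) \<le> x" using \<rho> by (simp add: divide_le_eq)
  then show "(1 - cmod z) / (1 + cmod z) \<le> Re (h z) + \<delta>" by (simp add: x_def w_def \<rho>_def)
qed

section \<open>Logarithmic moments and the squeeze for the expected number of zeros\<close>

context finitely_dependent_gaussian
begin

definition gpoly :: "complex poly" where
  "gpoly = (\<Sum>k<L. monom (cnj (\<gamma> (int (Suc k)))) (Suc k))"

lemma G_fun_eq_poly: "G_fun \<gamma> z = poly gpoly z"
  unfolding G_fun_eq_sum[OF order_refl] gpoly_def by (simp add: poly_sum poly_monom del: of_nat_Suc power_Suc)

lemma poly_gpoly_0: "poly gpoly 0 = 0"
  unfolding gpoly_def by (simp add: poly_sum poly_monom)

lemma spectral_potential_eq: "spectral_potential \<gamma> z = 1 + 2 * Re (poly gpoly z)"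
  by (simp add: spectral_potential_def G_fun_eq_poly)

lemma continuous_spectral_potential [continuous_intros]:
  "continuous_on S g \<Longrightarrow> continuous_on S (\<lambda>x. spectral_potential \<gamma> (g x))"
  unfolding spectral_potential_eq by (intro continuous_intros)

text \<open>Harnack's bound for 1 + 2 G, which has value 1 at 0. It gives positivity inside the disc
  and decay no faster than linear at the boundary.\<close>

lemma spectral_potential_lower:
  assumes "cmod z < 1"
  shows "(1 - cmod z) / (1 + cmod z) \<le> spectral_potential \<gamma> z"
proof -
  have "(1 - cmod z) / (1 + cmod z) \<le> Re (1 + 2 * poly gpoly z)"
    by (rule harnack_lower_bound[OF _ _ _ assms])
       (use spectral_potential_nonneg in \<open>auto intro!: holomorphic_intros simp: poly_gpoly_0 spectral_potential_eq\<close>)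
  then show ?thesis by (simp add: spectral_potential_eq)
qed

lemma spectral_potential_pos: "cmod z < 1 \<Longrightarrow> 0 < spectral_potential \<gamma> z"
  using spectral_potential_lower[of z] divide_pos_pos[of "1 - cmod z" "1 + cmod z"] norm_ge_zero[of z] by linarith

definition log_potential :: "real \<Rightarrow> real" where
  "log_potential r = (\<integral>t. ln (spectral_potential \<gamma> (of_real r * cis t)) \<partial>angle_measure)"

definition half_log_kernel :: "complex \<Rightarrow> real" where
  "half_log_kernel z = (ln (spectral_potential \<gamma> z) - ln (1 - (cmod z)\<^sup>2)) / 2"

text \<open>The universal additive constant in E log |f(z)|; it cancels in differences of Jensen
  means.\<close>

definition gaussian_log_const :: real where
  "gaussian_log_const = ln 2 / 2 + (\<integral>x. ln \<bar>x\<bar> \<partial>std_normal_distribution)"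

lemma ln_std_dev:
  assumes "cmod z < 1"
  shows "ln (sqrt (spectral_potential \<gamma> z / (1 - (cmod z)\<^sup>2) / 2)) = half_log_kernel z - ln 2 / 2"
    and "0 < sqrt (spectral_potential \<gamma> z / (1 - (cmod z)\<^sup>2) / 2)"
proof -
  have pos: "0 < 1 - (cmod z)\<^sup>2" "0 < spectral_potential \<gamma> z"
    using assms spectral_potential_pos by (simp_all add: power_less_one_iff)
  have "ln (u / d / 2) = ln u - ln d - ln 2" if "0 < u" "0 < d" for u d :: real
    using that by (simp add: ln_div ln_mult)
  note ln3 = this[OF pos(2,1)]
  show "ln (sqrt (spectral_potential \<gamma> z / (1 - (cmod z)\<^sup>2) / 2)) = half_log_kernel z - ln 2 / 2"
    unfolding half_log_kernel_def
    by (subst ln_sqrt, intro divide_nonneg_pos[of _ 2] divide_nonneg_pos[OF less_imp_le[OF pos(2)] pos(1)])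
       (simp_all only: ln3 diff_divide_distrib zero_less_numeral)
  show "0 < sqrt (spectral_potential \<gamma> z / (1 - (cmod z)\<^sup>2) / 2)"
    using pos by (intro real_sqrt_gt_zero divide_pos_pos) simp_all
qed

lemma log_moments:
  assumes "cmod z < 1"
  shows "integrable M (\<lambda>\<omega>. ln (cmod (power_series \<xi> \<omega> z)))"
    and "expectation (\<lambda>\<omega>. ln (cmod (power_series \<xi> \<omega> z))) = half_log_kernel z + gaussian_log_const"
    and "expectation (\<lambda>\<omega>. \<bar>ln (cmod (power_series \<xi> \<omega> z))\<bar>) \<le>
      \<bar>half_log_kernel z - ln 2 / 2\<bar> + ln 2 + (\<integral>x. \<bar>ln \<bar>x\<bar>\<bar> \<partial>std_normal_distribution)"
    and "AE \<omega> in M. power_series \<xi> \<omega> z \<noteq> 0"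
proof -
  note * = expectation_ln_norm_circular[OF power_series_measurable ln_std_dev(2)[OF assms]
      power_series_law[OF assms spectral_potential_pos[OF assms]], unfolded ln_std_dev(1)[OF assms]]
  show "integrable M (\<lambda>\<omega>. ln (cmod (power_series \<xi> \<omega> z)))" by (rule *(1))
  show "expectation (\<lambda>\<omega>. ln (cmod (power_series \<xi> \<omega> z))) = half_log_kernel z + gaussian_log_const"
    unfolding *(2) gaussian_log_const_def by simp
  show "expectation (\<lambda>\<omega>. \<bar>ln (cmod (power_series \<xi> \<omega> z))\<bar>) \<le>
      \<bar>half_log_kernel z - ln 2 / 2\<bar> + ln 2 + (\<integral>x. \<bar>ln \<bar>x\<bar>\<bar> \<partial>std_normal_distribution)" by (rule *(3))
  show "AE \<omega> in M. power_series \<xi> \<omega> z \<noteq> 0" by (rule *(4))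
qed

text \<open>Fubini turns the expected Jensen mean into the circular mean of E log |f|. The exchange
  is justified by \<open>log_moments(3)\<close>, whose bound is continuous in the angle.\<close>

lemma circle_log_integral:
  assumes r: "0 < r" "r < 1"
  shows "integrable M (\<lambda>\<omega>. \<integral>t. ln (cmod (power_series \<xi> \<omega> (of_real r * cis t))) \<partial>angle_measure)"
    and "expectation (\<lambda>\<omega>. \<integral>t. ln (cmod (power_series \<xi> \<omega> (of_real r * cis t))) \<partial>angle_measure) =
      (log_potential r - ln (1 - r\<^sup>2)) / 2 + gaussian_log_const"
proof -
  interpret P: pair_prob_space angle_measure M ..
  have nz: "cmod (of_real r * cis t) = r" for t using r by (simp add: norm_mult)
  have lt: "cmod (of_real r * cis t) < 1" for t using r nz by simp
  define g where "g = (\<lambda>(t, \<omega>). ln (cmod (power_series \<xi> \<omega> (of_real r * cis t))))"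
  have [measurable]: "(\<lambda>(t, \<omega>). power_series \<xi> \<omega> (of_real r * cis t)) \<in> borel_measurable (angle_measure \<Otimes>\<^sub>M M)"
    by (rule power_series_measurable_pair)
  have g_meas [measurable]: "g \<in> borel_measurable (angle_measure \<Otimes>\<^sub>M M)"
    unfolding g_def by measurable
  have cont: "continuous_on UNIV (\<lambda>t. ln (spectral_potential \<gamma> (of_real r * cis t)))"
    by (intro continuous_intros) (simp add: less_imp_neq[OF spectral_potential_pos[OF lt], symmetric])
  have hlk: "half_log_kernel (of_real r * cis t) = (ln (spectral_potential \<gamma> (of_real r * cis t)) - ln (1 - r\<^sup>2)) / 2" for t
    unfolding half_log_kernel_def nz ..
  have cont': "continuous_on UNIV (\<lambda>t. half_log_kernel (of_real r * cis t))"
    unfolding hlk by (intro continuous_intros cont) auto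
  have gint: "integrable (angle_measure \<Otimes>\<^sub>M M) g"
  proof (rule P.Fubini_integrable[OF g_meas])
    show "AE t in angle_measure. integrable M (\<lambda>\<omega>. g (t, \<omega>))" using log_moments(1)[OF lt] by (simp add: g_def)
    show "integrable angle_measure (\<lambda>t. \<integral>\<omega>. norm (g (t, \<omega>)) \<partial>M)"
    proof (rule Bochner_Integration.integrable_bound)
      show "integrable angle_measure (\<lambda>t. \<bar>half_log_kernel (of_real r * cis t) - ln 2 / 2\<bar> + ln 2 + (\<integral>x. \<bar>ln \<bar>x\<bar>\<bar> \<partial>std_normal_distribution))"
        by (rule integrable_angle_continuous) (intro continuous_intros cont')
      show "AE t in angle_measure. norm (\<integral>\<omega>. norm (g (t, \<omega>)) \<partial>M) \<le>
         norm (\<bar>half_log_kernel (of_real r * cis t) - ln 2 / 2\<bar> + ln 2 + (\<integral>x. \<bar>ln \<bar>x\<bar>\<bar> \<partial>std_normal_distribution))"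
      proof (rule AE_I2)
        fix t
        have "norm (\<integral>\<omega>. norm (g (t, \<omega>)) \<partial>M) = (\<integral>\<omega>. \<bar>ln (cmod (power_series \<xi> \<omega> (of_real r * cis t)))\<bar> \<partial>M)"
          by (simp add: g_def)
        also have "\<dots> \<le> \<bar>half_log_kernel (of_real r * cis t) - ln 2 / 2\<bar> + ln 2 + (\<integral>x. \<bar>ln \<bar>x\<bar>\<bar> \<partial>std_normal_distribution)"
          by (rule log_moments(3)[OF lt])
        also have "\<dots> \<le> norm \<dots>" unfolding real_norm_def by (rule abs_ge_self)
        finally show "norm (\<integral>\<omega>. norm (g (t, \<omega>)) \<partial>M) \<le>
         norm (\<bar>half_log_kernel (of_real r * cis t) - ln 2 / 2\<bar> + ln 2 + (\<integral>x. \<bar>ln \<bar>x\<bar>\<bar> \<partial>std_normal_distribution))" .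
      qed
    qed measurable
  qed
  have gint': "integrable (angle_measure \<Otimes>\<^sub>M M) (case_prod (\<lambda>t \<omega>. ln (cmod (power_series \<xi> \<omega> (of_real r * cis t)))))"
    using gint by (simp add: g_def)
  show "integrable M (\<lambda>\<omega>. \<integral>t. ln (cmod (power_series \<xi> \<omega> (of_real r * cis t))) \<partial>angle_measure)"
    by (rule P.integrable_snd[OF gint'])
  have "expectation (\<lambda>\<omega>. \<integral>t. ln (cmod (power_series \<xi> \<omega> (of_real r * cis t))) \<partial>angle_measure) =
     (\<integral>t. half_log_kernel (of_real r * cis t) + gaussian_log_const \<partial>angle_measure)"
    unfolding P.Fubini_integral[OF gint'] log_moments(2)[OF lt] ..
  also have "\<dots> = (log_potential r - ln (1 - r\<^sup>2)) / 2 + gaussian_log_const"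
    unfolding hlk log_potential_def using integrable_angle_continuous[OF cont] by simp
  finally show "expectation (\<lambda>\<omega>. \<integral>t. ln (cmod (power_series \<xi> \<omega> (of_real r * cis t))) \<partial>angle_measure) =
      (log_potential r - ln (1 - r\<^sup>2)) / 2 + gaussian_log_const" .
qed

text \<open>The expected Jensen mean without \<open>gaussian_log_const\<close>.\<close>

definition mean_log :: "real \<Rightarrow> real" where
  "mean_log r = (log_potential r - ln (1 - r\<^sup>2)) / 2"

lemma expected_zeros_bounds:
  assumes sr: "0 < s" "s < r" "r < 1"
  shows "ennreal ((mean_log r - mean_log s) / ln (r / s)) \<le> expected_zeros M \<xi> r"
    and "expected_zeros M \<xi> s \<le> ennreal ((mean_log r - mean_log s) / ln (r / s))"
    and "0 \<le> (mean_log r - mean_log s) / ln (r / s)"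
proof -
  define J where "J \<rho> \<omega> = (\<integral>t. ln (cmod (power_series \<xi> \<omega> (of_real \<rho> * cis t))) \<partial>angle_measure)" for \<rho> \<omega>
  have good: "AE \<omega> in M. (\<lambda>z. power_series \<xi> \<omega> z) holomorphic_on ball 0 1 \<and> power_series \<xi> \<omega> 0 \<noteq> 0"
  proof -
    have "AE \<omega> in M. power_series \<xi> \<omega> 0 \<noteq> 0" by (rule log_moments(4)) simp
    then show ?thesis using AE_summable
    proof eventually_elim
      case (elim \<omega>)
      have "power_series \<xi> \<omega> holomorphic_on ball 0 1"
      proof (rule power_series_holomorphic)
        fix z :: complex assume "z \<in> ball 0 1"
        then have "summable (\<lambda>k. \<xi> (int k) \<omega> * z ^ k)"
          using elim by (intro summable_norm_cancel[where f = "\<lambda>k. \<xi> (int k) \<omega> * z ^ k"]) simp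
        then show "(\<lambda>n. \<xi> (int n) \<omega> * (z - 0) ^ n) sums power_series \<xi> \<omega> z"
          unfolding power_series_def by (simp add: summable_sums)
      qed
      then show ?case using elim by simp
    qed
  qed
  have lnpos: "0 < ln (r / s)" using sr by simp
  have Jint: "integrable M (\<lambda>\<omega>. (J r \<omega> - J s \<omega>) / ln (r / s))"
    unfolding J_def using circle_log_integral(1)[of r] circle_log_integral(1)[of s] sr by auto
  have Jval: "expectation (\<lambda>\<omega>. (J r \<omega> - J s \<omega>) / ln (r / s)) = (mean_log r - mean_log s) / ln (r / s)"
    unfolding J_def mean_log_def using circle_log_integral[of r] circle_log_integral[of s] sr by simp
  have nn: "AE \<omega> in M. 0 \<le> (J r \<omega> - J s \<omega>) / ln (r / s)"
    using good by eventually_elim (use zero_count_bounds(3)[OF _ _ sr] lnpos in \<open>simp add: J_def\<close>)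
  have eq: "(\<integral>\<^sup>+\<omega>. ennreal ((J r \<omega> - J s \<omega>) / ln (r / s)) \<partial>M) = ennreal ((mean_log r - mean_log s) / ln (r / s))"
    unfolding Jval[symmetric] by (rule nn_integral_eq_integral[OF Jint nn])
  show "0 \<le> (mean_log r - mean_log s) / ln (r / s)"
    unfolding Jval[symmetric] by (rule integral_nonneg_AE[OF nn])
  show "ennreal ((mean_log r - mean_log s) / ln (r / s)) \<le> expected_zeros M \<xi> r"
    unfolding eq[symmetric] expected_zeros_def
    by (rule nn_integral_mono_AE) (use good in \<open>eventually_elim, use zero_count_bounds(1)[OF _ _ sr] in \<open>simp add: J_def\<close>\<close>)
  show "expected_zeros M \<xi> s \<le> ennreal ((mean_log r - mean_log s) / ln (r / s))"
    unfolding eq[symmetric] expected_zeros_def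
    by (rule nn_integral_mono_AE) (use good in \<open>eventually_elim, use zero_count_bounds(2)[OF _ _ sr] in \<open>simp add: J_def\<close>\<close>)
qed

text \<open>
  The two one-sided difference quotients of \<open>mean_log\<close> with respect to \<open>ln r\<close> squeeze the
  expected number of zeros, so its measurability is never needed.
\<close>

lemma expected_zeros_eq_deriv:
  assumes r: "0 < r" "r < 1" and D: "(mean_log has_real_derivative D) (at r)"
  shows "expected_zeros M \<xi> r = ennreal (r * D)" and "0 \<le> r * D"
proof -
  \<comment> \<open>The difference quotient of \<open>mean_log\<close> with respect to
    \<open>ln \<rho>\<close>; dividing numerator and denominator by \<open>\<rho> - r\<close>
    exposes the limit \<open>r * D\<close>.\<close>
  define q where "q \<rho> = ((mean_log \<rho> - mean_log r) / (\<rho> - r)) / ((ln \<rho> - ln r) / (\<rho> - r))" for \<rho>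
  have "(ln has_real_derivative 1 / r) (at r)" using r by (auto intro!: derivative_eq_intros)
  then have "((\<lambda>\<rho>. (ln \<rho> - ln r) / (\<rho> - r)) \<longlongrightarrow> 1 / r) (at r)" by (simp add: has_field_derivative_iff)
  then have q_real: "(q \<longlongrightarrow> D / (1 / r)) (at r)"
    unfolding q_def by (rule tendsto_divide[OF D[unfolded has_field_derivative_iff]]) (use r in simp)
  then have q: "((\<lambda>\<rho>. ennreal (q \<rho>)) \<longlongrightarrow> ennreal (r * D)) (at r)" by (intro tendsto_ennrealI) (simp add: mult.commute)
  have q_right: "((\<lambda>\<rho>. ennreal (q \<rho>)) \<longlongrightarrow> ennreal (r * D)) (at_right r)"
    and q_left: "((\<lambda>\<rho>. ennreal (q \<rho>)) \<longlongrightarrow> ennreal (r * D)) (at_left r)"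
    using q by (simp_all add: filterlim_at_split)
  have "expected_zeros M \<xi> r \<le> ennreal (r * D)"
  proof (rule tendsto_lowerbound[OF q_right])
    have "eventually (\<lambda>\<rho>. \<rho> \<in> {r<..<1}) (at_right r)" using r by (intro eventually_at_right_real)
    then show "eventually (\<lambda>\<rho>. expected_zeros M \<xi> r \<le> ennreal (q \<rho>)) (at_right r)"
    proof eventually_elim
      case (elim \<rho>)
      have "q \<rho> = (mean_log \<rho> - mean_log r) / ln (\<rho> / r)" using elim r by (simp add: q_def ln_div)
      then show ?case using expected_zeros_bounds(2)[of r \<rho>] elim r by simp
    qed
  qed simp
  moreover have "ennreal (r * D) \<le> expected_zeros M \<xi> r"
  proof (rule tendsto_upperbound[OF q_left])
    have "eventually (\<lambda>\<rho>. \<rho> \<in> {0<..<r}) (at_left r)" using r by (intro eventually_at_left_real)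
    then show "eventually (\<lambda>\<rho>. ennreal (q \<rho>) \<le> expected_zeros M \<xi> r) (at_left r)"
    proof eventually_elim
      case (elim \<rho>)
      have "q \<rho> = (mean_log \<rho> - mean_log r) / (ln \<rho> - ln r)" using elim by (simp add: q_def)
      also have "\<dots> = (mean_log r - mean_log \<rho>) / (ln r - ln \<rho>)" using minus_divide_divide[of "mean_log r - mean_log \<rho>" "ln r - ln \<rho>"] by simp
      also have "\<dots> = (mean_log r - mean_log \<rho>) / ln (r / \<rho>)" using elim r by (simp add: ln_div)
      finally show ?case using expected_zeros_bounds(1)[of \<rho> r] elim r by simp
    qed
  qed simp
  ultimately show "expected_zeros M \<xi> r = ennreal (r * D)" by (rule antisym)
  \<comment> \<open>The sign is recorded because \<open>ennreal\<close> truncates negative numbers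
    to 0.\<close>
  have "0 \<le> D / (1 / r)"
  proof (rule tendsto_lowerbound)
    show "(q \<longlongrightarrow> D / (1 / r)) (at_right r)" using q_real by (simp add: filterlim_at_split)
    have "eventually (\<lambda>\<rho>. \<rho> \<in> {r<..<1}) (at_right r)" using r by (intro eventually_at_right_real)
    then show "eventually (\<lambda>\<rho>. 0 \<le> q \<rho>) (at_right r)"
    proof eventually_elim
      case (elim \<rho>)
      have "q \<rho> = (mean_log \<rho> - mean_log r) / ln (\<rho> / r)" using elim r by (simp add: q_def ln_div)
      then show ?case using expected_zeros_bounds(3)[of r \<rho>] elim r by simp
    qed
  qed simp
  then show "0 \<le> r * D" by (simp add: mult.commute)
qed

end

section \<open>The mean of the logarithm over circles\<close>

text \<open>The Euler operator z d/dz. On circles it is the angular derivative divided by i, and it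
  multiplies the k-th coefficient by k, so that its iterates stay explicit.\<close>

definition euler_poly :: "complex poly \<Rightarrow> complex poly" where
  "euler_poly P = pCons 0 (pderiv P)"

lemma poly_euler: "poly (euler_poly P) z = z * poly (pderiv P) z"
  by (simp add: euler_poly_def)

lemma coeff_euler: "coeff (euler_poly P) k = of_nat k * coeff P k"
  by (cases k) (simp_all add: euler_poly_def coeff_pderiv)

lemma poly_circle_radial_deriv:
  "((\<lambda>r. poly P (of_real r * cis t)) has_vector_derivative cis t * poly (pderiv P) (of_real r * cis t)) (at r within S)"
proof -
  have "((\<lambda>r. of_real r * cis t) has_vector_derivative cis t) (at r within S)"
    by (auto intro!: derivative_eq_intros simp: has_vector_derivative_def scaleR_conv_of_real has_derivative_ident)
  from field_vector_diff_chain_within[OF this, of "poly P"] show ?thesis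
    by (simp add: o_def poly_DERIV has_field_derivative_at_within)
qed

lemma poly_circle_angular_deriv:
  "((\<lambda>t. poly P (of_real r * cis t)) has_vector_derivative \<i> * poly (euler_poly P) (of_real r * cis t)) (at t within S)"
proof -
  have "(cis has_vector_derivative \<i> * cis t) (at t within S)"
    using has_derivative_cis[OF has_derivative_ident] by (simp add: has_vector_derivative_def)
  from field_vector_diff_chain_within[OF has_vector_derivative_mult_right[OF this, of "of_real r"]
      poly_DERIV[THEN has_field_derivative_at_within]]
  show ?thesis by (simp add: o_def poly_euler mult_ac)
qed

lemma Re_circle_radial_deriv:
  "((\<lambda>r. Re (poly P (of_real r * cis t))) has_real_derivative Re (cis t * poly (pderiv P) (of_real r * cis t))) (at r within S)"
  using bounded_linear.has_vector_derivative[OF bounded_linear_Re poly_circle_radial_deriv]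
  by (simp add: has_real_derivative_iff_has_vector_derivative)

lemma Re_circle_angular_deriv:
  "((\<lambda>t. Re (poly P (of_real r * cis t))) has_real_derivative - Im (poly (euler_poly P) (of_real r * cis t))) (at t within S)"
  using bounded_linear.has_vector_derivative[OF bounded_linear_Re poly_circle_angular_deriv]
  by (simp add: has_real_derivative_iff_has_vector_derivative)

lemma Im_circle_angular_deriv:
  "((\<lambda>t. Im (poly P (of_real r * cis t))) has_real_derivative Re (poly (euler_poly P) (of_real r * cis t))) (at t within S)"
  using bounded_linear.has_vector_derivative[OF bounded_linear_Im poly_circle_angular_deriv]
  by (simp add: has_real_derivative_iff_has_vector_derivative)

lemma Re_of_real_times: "Re (of_real r * x) = r * Re x"
  by simp

text \<open>The interface between probability and analysis: a polynomial vanishing at 0 together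
  with the Harnack bound for its potential.\<close>

locale positive_potential =
  fixes p :: "complex poly"
  assumes poly_p_0: "poly p 0 = 0" and p_nonzero: "p \<noteq> 0"
    and lower: "\<And>z. cmod z < 1 \<Longrightarrow> (1 - cmod z) / (1 + cmod z) \<le> 1 + 2 * Re (poly p z)"
begin

definition u :: "complex \<Rightarrow> real" where "u z = 1 + 2 * Re (poly p z)"

definition w :: "complex \<Rightarrow> complex" where "w z = poly (euler_poly p) z"

definition A :: "real \<Rightarrow> real" where
  "A r = (\<integral>t. - Re (w (of_real r * cis t)) / u (of_real r * cis t) \<partial>angle_measure)"

lemma continuous_u [continuous_intros]: "continuous_on S g \<Longrightarrow> continuous_on S (\<lambda>x. u (g x))"
  unfolding u_def by (intro continuous_intros)

lemma continuous_w [continuous_intros]: "continuous_on S g \<Longrightarrow> continuous_on S (\<lambda>x. w (g x))"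
  unfolding w_def by (intro continuous_intros)

lemma u_lower: "cmod z < 1 \<Longrightarrow> (1 - cmod z) / (1 + cmod z) \<le> u z"
  using lower by (simp add: u_def)

lemma u_pos: "cmod z < 1 \<Longrightarrow> 0 < u z"
  using u_lower[of z] divide_pos_pos[of "1 - cmod z" "1 + cmod z"] norm_ge_zero[of z] by linarith

lemma u_pos_circle: "0 \<le> r \<Longrightarrow> r < 1 \<Longrightarrow> 0 < u (of_real r * cis t)"
  by (rule u_pos) (simp add: norm_mult)

lemma u_circle_nonneg: "0 \<le> u (cis t)"
proof (rule tendsto_lowerbound)
  have "continuous_on UNIV (\<lambda>r. u (of_real r * cis t))" by (intro continuous_intros)
  then have "isCont (\<lambda>r. u (of_real r * cis t)) 1" by (simp add: continuous_on_eq_continuous_at)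
  then show "((\<lambda>r. u (of_real r * cis t)) \<longlongrightarrow> u (cis t)) (at_left 1)"
    using filterlim_at_split by (fastforce simp: isCont_def)
  have "eventually (\<lambda>r. r \<in> {0<..<1}) (at_left (1::real))" by (rule eventually_at_left_real) simp
  then show "eventually (\<lambda>r. 0 \<le> u (of_real r * cis t)) (at_left 1)"
    by eventually_elim (use u_pos_circle[of _ t] in \<open>auto intro: less_imp_le\<close>)
qed simp

lemma u_radial_deriv:
  "((\<lambda>r. u (of_real r * cis t)) has_real_derivative 2 * Re (cis t * poly (pderiv p) (of_real r * cis t))) (at r within S)"
  unfolding u_def by (rule derivative_eq_intros Re_circle_radial_deriv refl | simp)+

lemma u_angular_deriv:
  "((\<lambda>t. u (of_real r * cis t)) has_real_derivative - 2 * Im (w (of_real r * cis t))) (at t within S)"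
  unfolding u_def w_def by (rule derivative_eq_intros Re_circle_angular_deriv refl | simp)+

text \<open>Differentiation under the integral sign: r times the radial derivative of
  \<open>u\<close> is 2 Re w, and \<open>A\<close> carries the opposite sign.\<close>

lemma log_potential_deriv:
  assumes r: "0 < r" "r < 1"
  shows "((\<lambda>r. \<integral>t. ln (u (of_real r * cis t)) \<partial>angle_measure) has_real_derivative - 2 * A r / r) (at r)"
proof -
  define fx where "fx x t = 2 * Re (cis t * poly (pderiv p) (of_real x * cis t)) / u (of_real x * cis t)" for x t
  have pos: "0 < u (of_real x * cis t)" if "x \<in> {0<..<1}" for x t using u_pos_circle[of x t] that by simp
  have cont: "continuous_on UNIV (\<lambda>t. ln (u (of_real x * cis t)))" if "x \<in> {0<..<1}" for x
    by (intro continuous_intros) (simp add: less_imp_neq[OF pos[OF that], symmetric])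
  have "((\<lambda>x. integral (cbox 0 (2 * pi)) (\<lambda>t. ln (u (of_real x * cis t)))) has_field_derivative integral (cbox 0 (2 * pi)) (fx r)) (at r within {0<..<1})"
  proof (rule leibniz_rule_field_derivative)
    show "((\<lambda>x. ln (u (of_real x * cis t))) has_real_derivative fx x t) (at x within {0<..<1})" if "x \<in> {0<..<1}" for x t
      unfolding fx_def using pos[OF that] DERIV_ln_divide[THEN DERIV_chain2, OF pos[OF that] u_radial_deriv] by simp
    show "(\<lambda>t. ln (u (of_real x * cis t))) integrable_on cbox 0 (2 * pi)" if "x \<in> {0<..<1}" for x
      by (intro integrable_continuous continuous_on_subset[OF cont[OF that]]) simp
    show "continuous_on ({0<..<1} \<times> cbox 0 (2 * pi)) (\<lambda>(x, t). fx x t)"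
      unfolding fx_def case_prod_unfold
      by (intro continuous_intros) (auto simp: less_imp_neq[OF pos, symmetric])
  qed (use r in auto)
  then have D: "((\<lambda>x. integral {0..2 * pi} (\<lambda>t. ln (u (of_real x * cis t)))) has_field_derivative integral {0..2 * pi} (fx r)) (at r)"
    using r by (simp add: at_within_open[of r "{0<..<1}"])
  have D': "((\<lambda>x. \<integral>t. ln (u (of_real x * cis t)) \<partial>angle_measure) has_field_derivative 1 / (2 * pi) * integral {0..2 * pi} (fx r)) (at r)"
  proof (rule has_field_derivative_transform_within[OF DERIV_cmult[OF D, of "1 / (2 * pi)"] _ UNIV_I])
    show "0 < min r (1 - r)" using r by simp
    fix x :: real assume "dist x r < min r (1 - r)"
    then have "x \<in> {0<..<1}" by (auto simp: dist_real_def)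
    from integral_angle_continuous[OF cont[OF this]]
    show "1 / (2 * pi) * integral {0..2 * pi} (\<lambda>t. ln (u (of_real x * cis t))) = (\<integral>t. ln (u (of_real x * cis t)) \<partial>angle_measure)" by simp
  qed
  have "- 2 * A r / r = (\<integral>t. (- 2 / r) * (- Re (w (of_real r * cis t)) / u (of_real r * cis t)) \<partial>angle_measure)"
    unfolding A_def integral_mult_right_zero by simp
  also have "(\<lambda>t. (- 2 / r) * (- Re (w (of_real r * cis t)) / u (of_real r * cis t))) = fx r"
  proof
    fix t
    have "Re (w (of_real r * cis t)) = r * Re (cis t * poly (pderiv p) (of_real r * cis t))"
      unfolding w_def poly_euler mult.assoc by (rule Re_of_real_times)
    then show "(- 2 / r) * (- Re (w (of_real r * cis t)) / u (of_real r * cis t)) = fx r t"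
      using r unfolding fx_def by (simp del: times_complex.sel)
  qed
  also have "(\<integral>t. fx r t \<partial>angle_measure) = 1 / (2 * pi) * integral {0..2 * pi} (fx r)"
  proof (subst integral_angle_continuous)
    show "continuous_on UNIV (fx r)" unfolding fx_def
      by (intro continuous_intros) (use r in \<open>simp add: less_imp_neq[OF pos, symmetric]\<close>)
  qed simp
  finally show ?thesis using D' by simp
qed

lemma w_nontrivial_on_circle:
  assumes "r > 0"
  shows "\<exists>t\<in>{0..2*pi}. w (of_real r * cis t) \<noteq> 0"
proof (rule ccontr)
  assume "\<not> ?thesis"
  then have z: "w (of_real r * cis t) = 0" if "t \<in> {0..2*pi}" for t using that by auto
  \<comment> \<open>Half of the circle suffices for infinitely many roots, and injectivity is there
    inherited from the cosine.\<close>
  have "(\<lambda>t. of_real r * cis t) ` {0..pi} \<subseteq> {z. poly (euler_poly p) z = 0}"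
    using z by (auto simp: w_def)
  moreover have "inj_on (\<lambda>t. of_real r * cis t) {0..pi}"
    using assms by (auto simp: inj_on_def complex_eq_iff intro: cos_inj_pi)
  then have "infinite ((\<lambda>t. of_real r * cis t) ` {0..pi})"
    by (simp add: finite_image_iff infinite_Icc)
  ultimately have "infinite {z. poly (euler_poly p) z = 0}" using finite_subset by blast
  then have "euler_poly p = 0" using poly_roots_finite by blast
  then have "pderiv p = 0" by (simp add: euler_poly_def)
  then obtain h where "p = [:h:]" by (auto simp: pderiv_eq_0_iff degree_eq_zeroE elim: degree_eq_zeroE)
  then show False using poly_p_0 p_nonzero by simp
qed

text \<open>
  With \<open>z = r e\<^sup>i\<^sup>t\<close>, the function \<open>Re w / u\<close> satisfies
  \<open>r \<partial>\<^sub>r (Re w / u) = \<partial>\<^sub>t (Im w / u) - 2 \<bar>w\<bar>\<^sup>2 / u\<^sup>2\<close>, and the angular derivative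
  integrates to zero over the circle.
\<close>

lemma A_deriv_pos:
  assumes r: "0 < r" "r < 1"
  shows "\<exists>D>0. (A has_real_derivative D) (at r)"
proof -
  define w2 where "w2 z = poly (euler_poly (euler_poly p)) z" for z
  define F where "F x t = - Re (w (of_real x * cis t)) / u (of_real x * cis t)" for x t
  define fx where "fx x t = - (Re (cis t * poly (pderiv (euler_poly p)) (of_real x * cis t)) * u (of_real x * cis t)
      - Re (w (of_real x * cis t)) * (2 * Re (cis t * poly (pderiv p) (of_real x * cis t)))) / (u (of_real x * cis t))\<^sup>2" for x t
  have pos: "0 < u (of_real x * cis t)" if "x \<in> {0<..<1}" for x t using u_pos_circle[of x t] that by simp
  have cont: "continuous_on UNIV (F x)" if "x \<in> {0<..<1}" for x
    unfolding F_def by (intro continuous_intros) (simp add: less_imp_neq[OF pos[OF that], symmetric])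
  have "((\<lambda>x. integral (cbox 0 (2 * pi)) (F x)) has_field_derivative integral (cbox 0 (2 * pi)) (fx r)) (at r within {0<..<1})"
  proof (rule leibniz_rule_field_derivative)
    show "((\<lambda>x. F x t) has_real_derivative fx x t) (at x within {0<..<1})" if "x \<in> {0<..<1}" for x t
      unfolding F_def fx_def minus_divide_left[symmetric] power2_eq_square
      by (intro DERIV_minus DERIV_divide u_radial_deriv Re_circle_radial_deriv[of "euler_poly p", folded w_def])
         (use pos[OF that] in \<open>simp add: less_imp_neq[symmetric]\<close>)
    show "F x integrable_on cbox 0 (2 * pi)" if "x \<in> {0<..<1}" for x
      by (intro integrable_continuous continuous_on_subset[OF cont[OF that]]) simp
    show "continuous_on ({0<..<1} \<times> cbox 0 (2 * pi)) (\<lambda>(x, t). fx x t)"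
      unfolding fx_def case_prod_unfold
      by (intro continuous_intros) (auto simp: less_imp_neq[OF pos, symmetric])
  qed (use r in auto)
  then have D: "((\<lambda>x. integral {0..2 * pi} (F x)) has_field_derivative integral {0..2 * pi} (fx r)) (at r)"
    using r by (simp add: at_within_open[of r "{0<..<1}"])
  have D': "(A has_field_derivative 1 / (2 * pi) * integral {0..2 * pi} (fx r)) (at r)"
  proof (rule has_field_derivative_transform_within[OF DERIV_cmult[OF D, of "1 / (2 * pi)"] _ UNIV_I])
    show "0 < min r (1 - r)" using r by simp
    fix x :: real assume "dist x r < min r (1 - r)"
    then have "x \<in> {0<..<1}" by (auto simp: dist_real_def)
    from integral_angle_continuous[OF cont[OF this]]
    show "1 / (2 * pi) * integral {0..2 * pi} (F x) = A x" unfolding A_def F_def by simp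
  qed
  \<comment> \<open>The radial derivative is split into a nonnegative term \<open>G\<close> and the
    exact angular derivative \<open>H\<close> of Im w / u, whose integral vanishes by
    periodicity.\<close>
  define G where "G t = 2 * (cmod (w (of_real r * cis t)))\<^sup>2 / (u (of_real r * cis t))\<^sup>2" for t
  define H where "H t = (Re (w2 (of_real r * cis t)) * u (of_real r * cis t) - Im (w (of_real r * cis t)) * (- 2 * Im (w (of_real r * cis t)))) / (u (of_real r * cis t))\<^sup>2" for t
  have fx_eq: "fx r t = (G t - H t) / r" for t
  proof -
    let ?z = "of_real r * cis t"
    have up: "u ?z > 0" using pos r by simp
    have rw: "Re (poly (euler_poly P) ?z) = r * Re (cis t * poly (pderiv P) ?z)" for P
      unfolding poly_euler mult.assoc by (rule Re_of_real_times)
    have e1: "Re (cis t * poly (pderiv (euler_poly p)) ?z) = Re (w2 ?z) / r"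
      and e2: "Re (cis t * poly (pderiv p) ?z) = Re (w ?z) / r"
      using rw[of "euler_poly p"] rw[of p] r by (simp_all add: w2_def w_def del: times_complex.sel)
    have key: "- (W2 / r * U - W * (2 * (W / r))) / U\<^sup>2 =
        (2 * (W\<^sup>2 + V\<^sup>2) / U\<^sup>2 - (W2 * U - V * (- 2 * V)) / U\<^sup>2) / r" if "U > 0" for W2 U W V :: real
      using that r by (simp add: field_simps power2_eq_square)
    show ?thesis unfolding fx_def G_def H_def e1 e2 cmod_power2 by (rule key[OF up])
  qed
  have "(H has_integral (Im (w (of_real r * cis (2 * pi))) / u (of_real r * cis (2 * pi)) - Im (w (of_real r * cis 0)) / u (of_real r * cis 0))) {0..2*pi}"
  proof (rule fundamental_theorem_of_calculus)
    fix t :: real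
    have "((\<lambda>t. Im (w (of_real r * cis t)) / u (of_real r * cis t)) has_real_derivative H t) (at t within {0..2*pi})"
      unfolding H_def w_def w2_def power2_eq_square
      by (intro DERIV_divide Im_circle_angular_deriv u_angular_deriv[unfolded w_def])
         (use pos[of r t] r in \<open>simp add: less_imp_neq[symmetric]\<close>)
    then show "((\<lambda>t. Im (w (of_real r * cis t)) / u (of_real r * cis t)) has_vector_derivative H t) (at t within {0..2*pi})"
      by (simp add: has_real_derivative_iff_has_vector_derivative)
  qed simp
  then have H0: "(H has_integral 0) {0..2*pi}" by simp
  have contG: "continuous_on UNIV G"
    unfolding G_def by (intro continuous_intros) (use r in \<open>simp add: less_imp_neq[OF pos, symmetric]\<close>)
  have Gi: "(G has_integral integral {0..2*pi} G) {0..2*pi}"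
    by (intro integrable_integral integrable_continuous_interval continuous_on_subset[OF contG]) simp
  have "((\<lambda>t. (G t - H t) / r) has_integral (integral {0..2*pi} G - 0) / r) {0..2*pi}"
    by (intro has_integral_divide has_integral_diff Gi H0)
  then have fxi: "integral {0..2*pi} (fx r) = integral {0..2*pi} G / r"
    by (metis (no_types, lifting) Henstock_Kurzweil_Integration.integral_cong diff_zero fx_eq integral_unique)
  have G0: "0 \<le> G t" for t by (simp add: G_def)
  have "integral {0..2*pi} G > 0"
  proof (rule ccontr)
    assume "\<not> 0 < integral {0..2*pi} G"
    moreover have "0 \<le> integral {0..2*pi} G" by (rule integral_nonneg) (use Gi G0 in \<open>auto simp: has_integral_iff\<close>)
    ultimately have "(G has_integral 0) (cbox 0 (2*pi))" using Gi by simp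
    \<comment> \<open>A continuous nonnegative function with integral 0 vanishes, and then
      \<open>w\<close> would vanish on a whole circle.\<close>
    then have Gz: "G t = 0" if "t \<in> cbox 0 (2*pi)" for t
      by (intro has_integral_0_cbox_imp_0[of 0 "2*pi" G]) (use that contG G0 pi_gt_zero in \<open>auto intro: continuous_on_subset simp: box_real simp del: pi_gt_zero\<close>)
    have "w (of_real r * cis t) = 0" if "t \<in> {0..2*pi}" for t
      using Gz[of t] that pos[of r t] r by (auto simp: G_def)
    then show False using w_nontrivial_on_circle[OF r(1)] by blast
  qed
  then have "0 < 1 / (2 * pi) * integral {0..2 * pi} (fx r)" unfolding fxi using r by simp
  then show ?thesis using D' by blast
qed

lemma A_no_zeros:
  assumes nz: "\<And>t. u (cis t) \<noteq> 0"
  shows "A 1 > 0" and "(A \<longlongrightarrow> A 1) (at_left 1)"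
proof -
  have pos: "0 < u (of_real x * cis t)" if "x \<in> {0..1}" for x t
    using u_pos_circle[of x t] u_circle_nonneg[of t] nz[of t] that by (cases "x = 1") auto
  define F where "F x t = - Re (w (of_real x * cis t)) / u (of_real x * cis t)" for x t
  have contF: "continuous_on UNIV (F x)" if "x \<in> {0..1}" for x
    unfolding F_def by (intro continuous_intros) (simp add: less_imp_neq[OF pos[OF that], symmetric])
  have AF: "A x = 1 / (2 * pi) * integral (cbox 0 (2 * pi)) (F x)" if "x \<in> {0..1}" for x
    using integral_angle_continuous[OF contF[OF that]] unfolding A_def F_def by simp
  have "continuous_on {0..1} (\<lambda>x. 1 / (2 * pi) * integral (cbox 0 (2 * pi)) (F x))"
  proof (intro continuous_intros integral_continuous_on_param)
    show "continuous_on ({0..1} \<times> cbox 0 (2 * pi)) (\<lambda>(x, t). F x t)"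
      unfolding F_def case_prod_unfold
      by (intro continuous_intros) (auto simp: less_imp_neq[OF pos, symmetric])
  qed
  then have contA: "continuous_on {0..1} A" by (rule continuous_on_eq) (simp add: AF)
  have "\<exists>l z. 0 < z \<and> z < 1 \<and> (A has_real_derivative l) (at z) \<and> A 1 - A 0 = (1 - 0) * l"
  proof (rule MVT)
    show "A differentiable (at x)" if "0 < x" "x < 1" for x
      using A_deriv_pos[OF that] by (auto simp: real_differentiable_def)
  qed (use contA in auto)
  then obtain l z where z: "0 < z" "z < 1" "(A has_real_derivative l) (at z)" "A 1 - A 0 = l" by auto
  obtain D where "D > 0" "(A has_real_derivative D) (at z)" using A_deriv_pos[OF z(1,2)] by auto
  then have "l > 0" using DERIV_unique[OF z(3)] by auto
  moreover have "A 0 = 0" by (simp add: A_def w_def poly_euler)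
  ultimately show "A 1 > 0" using z by simp
  have "(A \<longlongrightarrow> A 1) (at 1 within {0..1})" using contA by (simp add: continuous_on_def)
  then show "(A \<longlongrightarrow> A 1) (at_left 1)" by (simp add: at_within_Icc_at_left)
qed

end

section \<open>Zeros of the spectral density\<close>

lemma poly_eq_sum_atMost:
  fixes q :: "'a :: comm_ring_1 poly"
  assumes "degree q \<le> n"
  shows "poly q x = (\<Sum>k\<le>n. coeff q k * x ^ k)"
proof -
  have "poly q x = poly (\<Sum>k\<le>n. monom (coeff q k) k) x" using poly_as_sum_of_monoms'[OF assms] by simp
  then show ?thesis by (simp add: poly_sum poly_monom)
qed

lemma coeff_euler_funpow: "coeff ((euler_poly ^^ n) P) k = of_nat k ^ n * coeff P k"
  by (induction n) (simp_all add: coeff_euler mult.assoc)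

section \<open>Taylor expansion along the unit circle\<close>

context positive_potential
begin

text \<open>The n-th angular derivative of \<open>u\<close> on the unit circle: each differentiation
  applies i z d/dz, and the summand 1 of \<open>u\<close> survives only for
  \<open>n = 0\<close>.\<close>

definition circle_deriv :: "nat \<Rightarrow> real \<Rightarrow> real" where
  "circle_deriv n \<theta> = (if n = 0 then 1 else 0) + 2 * Re (\<i> ^ n * poly ((euler_poly ^^ n) p) (cis \<theta>))"

lemma circle_deriv_0: "circle_deriv 0 \<theta> = u (cis \<theta>)"
  by (simp add: circle_deriv_def u_def)

lemma circle_deriv_has_deriv: "(circle_deriv n has_real_derivative circle_deriv (Suc n) \<theta>) (at \<theta>)"
proof -
  have "((\<lambda>t. \<i> ^ n * poly ((euler_poly ^^ n) p) (of_real 1 * cis t)) has_vector_derivative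
      \<i> ^ n * (\<i> * poly (euler_poly ((euler_poly ^^ n) p)) (of_real 1 * cis \<theta>))) (at \<theta>)"
    by (intro has_vector_derivative_mult_right poly_circle_angular_deriv)
  from bounded_linear.has_vector_derivative[OF bounded_linear_Re this]
  have "((\<lambda>t. Re (\<i> ^ n * poly ((euler_poly ^^ n) p) (cis t))) has_real_derivative
      Re (\<i> ^ Suc n * poly ((euler_poly ^^ Suc n) p) (cis \<theta>))) (at \<theta>)"
    by (simp only: has_real_derivative_iff_has_vector_derivative mult_1 of_real_1 funpow.simps o_apply power_Suc mult_ac)
  from DERIV_add[OF DERIV_const DERIV_cmult[OF this, of 2], of "if n = 0 then 1 else 0"]
  show ?thesis unfolding circle_deriv_def[abs_def] by simp
qed

lemma higher_deriv_circle: "(deriv ^^ n) (\<lambda>\<theta>. u (cis \<theta>)) = circle_deriv n"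
proof (induction n)
  case 0
  show ?case by (simp add: circle_deriv_0[abs_def] fun_eq_iff circle_deriv_0)
next
  case (Suc n)
  have "deriv (circle_deriv n) \<theta> = circle_deriv (Suc n) \<theta>" for \<theta>
    by (rule DERIV_imp_deriv[OF circle_deriv_has_deriv])
  then have "deriv (circle_deriv n) = circle_deriv (Suc n)" by (rule ext)
  then show ?case using Suc by simp
qed

lemma continuous_circle_deriv: "continuous_on S (circle_deriv n)"
  unfolding circle_deriv_def by (intro continuous_intros)

text \<open>The Euler operator multiplies the k-th coefficient by \<open>k\<close>, which is at most
  the degree. Growth that is only geometric in \<open>n\<close> loses against the factorial in
  Taylor's formula.\<close>

lemma circle_deriv_bound: "\<exists>C N. 0 \<le> N \<and> (\<forall>n \<theta>. n > 0 \<longrightarrow> \<bar>circle_deriv n \<theta>\<bar> \<le> C * N ^ n)"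
proof (intro exI conjI allI impI)
  let ?N = "real (degree p)" and ?C = "2 * (\<Sum>k\<le>degree p. cmod (coeff p k))"
  show "0 \<le> ?N" by simp
  fix n :: nat and \<theta> assume n: "n > 0"
  let ?q = "(euler_poly ^^ n) p"
  have "degree ?q \<le> degree p"
    by (rule degree_le) (simp add: coeff_euler_funpow coeff_eq_0)
  then have "cmod (poly ?q (cis \<theta>)) = cmod (\<Sum>k\<le>degree p. of_nat k ^ n * coeff p k * cis \<theta> ^ k)"
    by (subst poly_eq_sum_atMost) (simp_all add: coeff_euler_funpow)
  also have "\<dots> \<le> (\<Sum>k\<le>degree p. cmod (of_nat k ^ n * coeff p k * cis \<theta> ^ k))" by (rule norm_sum)
  also have "\<dots> \<le> (\<Sum>k\<le>degree p. cmod (coeff p k) * ?N ^ n)"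
    by (intro sum_mono) (auto simp: norm_mult norm_power mult.commute[of "cmod _"] intro!: mult_right_mono power_mono)
  finally have "cmod (poly ?q (cis \<theta>)) \<le> (\<Sum>k\<le>degree p. cmod (coeff p k)) * ?N ^ n"
    by (simp add: sum_distrib_right)
  moreover have "\<bar>Re (\<i> ^ n * poly ?q (cis \<theta>))\<bar> \<le> cmod (poly ?q (cis \<theta>))"
    using abs_Re_le_cmod[of "\<i> ^ n * poly ?q (cis \<theta>)"] by (simp add: norm_mult norm_power)
  ultimately show "\<bar>circle_deriv n \<theta>\<bar> \<le> ?C * ?N ^ n"
    using n by (simp add: circle_deriv_def abs_mult del: times_complex.sel)
qed

lemma circle_taylor:
  "\<exists>\<xi>. \<bar>\<xi>\<bar> \<le> \<bar>x\<bar> \<and> u (cis (t + x)) = (\<Sum>m<n. circle_deriv m t / fact m * x ^ m) + circle_deriv n (t + \<xi>) / fact n * x ^ n"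
proof -
  have "((\<lambda>x. circle_deriv m (x + t)) has_real_derivative circle_deriv (Suc m) (x + t)) (at x)" for m x
    using circle_deriv_has_deriv[of m "x + t"] by (simp add: DERIV_shift)
  then show ?thesis
    using Maclaurin_bi_le[of "\<lambda>m x. circle_deriv m (x + t)" "\<lambda>x. u (cis (t + x))" n x]
    by (auto simp: circle_deriv_0 add.commute)
qed

text \<open>The polynomial has circular mean 0, so \<open>u\<close> has mean 1 on the unit
  circle.\<close>

lemma u_circle_nontrivial: "\<exists>\<theta>. u (cis \<theta>) \<noteq> 0"
proof (rule ccontr)
  assume "\<not> ?thesis"
  then have "1 + 2 * Re (poly p (cis t)) = 0" for t by (simp add: u_def)
  then have "2 * Re (poly p (cis t)) = - 1" for t by (simp add: add_eq_0_iff)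
  then have re: "Re (poly p (cis t)) = - (1 / 2)" for t by (simp add: field_simps)
  have "continuous_on UNIV (\<lambda>t. poly p (of_real 1 * cis t))" by (intro continuous_intros)
  then have int: "integrable angle_measure (\<lambda>t. poly p (of_real 1 * cis t))" by (rule integrable_angle_continuous)
  have "(\<integral>t. poly p (of_real 1 * cis t) \<partial>angle_measure) = 0"
    using mean_value_holomorphic[of "\<lambda>z. poly p z" 2 1] poly_p_0 by (simp add: holomorphic_intros)
  then have "(\<integral>t. Re (poly p (of_real 1 * cis t)) \<partial>angle_measure) = 0"
    by (subst integral_Re[OF int]) simp
  then show False by (simp add: re)
qed

text \<open>If all derivatives vanished at \<open>t\<close>, the Taylor remainders, which tend to 0,
  would force \<open>u\<close> to vanish on the whole circle. Hence the \<open>LEAST\<close> in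
  \<open>zero_multiplicity\<close> is attained.\<close>

lemma circle_deriv_nonzero: "\<exists>n. circle_deriv n t \<noteq> 0"
proof (rule ccontr)
  assume "\<not> ?thesis"
  then have flat: "circle_deriv m t = 0" for m by simp
  obtain C N where N: "0 \<le> N" and CN: "\<And>n \<theta>. n > 0 \<Longrightarrow> \<bar>circle_deriv n \<theta>\<bar> \<le> C * N ^ n"
    using circle_deriv_bound by blast
  have "u (cis (t + x)) = 0" for x
  proof -
    have le: "\<bar>u (cis (t + x))\<bar> \<le> C * (inverse (fact n) * (N * \<bar>x\<bar>) ^ n)" if n: "n > 0" for n
    proof -
      obtain \<xi> where "u (cis (t + x)) = circle_deriv n (t + \<xi>) / fact n * x ^ n"
        using circle_taylor[of x t n] by (auto simp: flat)
      then have "\<bar>u (cis (t + x))\<bar> = \<bar>circle_deriv n (t + \<xi>)\<bar> * (inverse (fact n) * \<bar>x\<bar> ^ n)"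
        by (simp add: abs_mult power_abs divide_inverse)
      also have "\<dots> \<le> (C * N ^ n) * (inverse (fact n) * \<bar>x\<bar> ^ n)"
        by (rule mult_right_mono[OF CN[OF n]]) simp
      finally show ?thesis by (simp add: power_mult_distrib mult_ac)
    qed
    have "(\<lambda>n. C * (inverse (fact n) * (N * \<bar>x\<bar>) ^ n)) \<longlonglongrightarrow> C * 0"
      by (intro tendsto_mult_left summable_LIMSEQ_zero summable_exp)
    then have "\<bar>u (cis (t + x))\<bar> \<le> C * 0"
      by (rule tendsto_lowerbound) (use le in \<open>auto intro!: eventually_at_top_linorderI[of 1]\<close>)
    then show ?thesis by simp
  qed
  from this[of "\<theta> - t" for \<theta>] show False using u_circle_nontrivial by simp
qed

text \<open>All derivatives below the multiplicity vanish, so only the Lagrange remainder is left,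
  and its intermediate point tends to \<open>t\<close>. The angle \<open>t\<close> is arbitrary: at
  points other than zeros the multiplicity is 0.\<close>

lemma circle_expansion:
  defines "g \<equiv> \<lambda>\<theta>. u (cis \<theta>)"
  shows "((\<lambda>x. g (t + x) / x ^ zero_multiplicity g t) \<longlongrightarrow> circle_deriv (zero_multiplicity g t) t / fact (zero_multiplicity g t)) (at 0)"
    and "circle_deriv (zero_multiplicity g t) t \<noteq> 0"
proof -
  define n where "n = zero_multiplicity g t"
  have n_eq: "n = (LEAST n. circle_deriv n t \<noteq> 0)"
    unfolding n_def zero_multiplicity_def g_def higher_deriv_circle ..
  show nz: "circle_deriv (zero_multiplicity g t) t \<noteq> 0"
    unfolding n_def[symmetric] n_eq using circle_deriv_nonzero by (rule LeastI_ex)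
  have low: "circle_deriv m t = 0" if "m < n" for m
    using not_less_Least that unfolding n_eq by blast
  have "\<forall>x. \<exists>\<xi>. \<bar>\<xi>\<bar> \<le> \<bar>x\<bar> \<and> g (t + x) = circle_deriv n (t + \<xi>) / fact n * x ^ n"
    using circle_taylor[of _ t n] low by (simp add: g_def)
  then obtain \<xi> where \<xi>: "\<And>x. \<bar>\<xi> x\<bar> \<le> \<bar>x\<bar>" "\<And>x. g (t + x) = circle_deriv n (t + \<xi> x) / fact n * x ^ n"
    by metis
  have "(\<xi> \<longlongrightarrow> 0) (at 0)"
    by (rule tendsto_0_le[where K = 1, OF tendsto_ident_at]) (use \<xi> in auto)
  then have "((\<lambda>x. t + \<xi> x) \<longlongrightarrow> t + 0) (at 0)" by (intro tendsto_intros)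
  moreover have "isCont (circle_deriv n) t"
    using continuous_circle_deriv[of UNIV n] by (simp add: continuous_on_eq_continuous_at)
  ultimately have "((\<lambda>x. circle_deriv n (t + \<xi> x)) \<longlongrightarrow> circle_deriv n t) (at 0)"
    by (intro isCont_tendsto_compose[of t "circle_deriv n"]) simp_all
  then have "((\<lambda>x. circle_deriv n (t + \<xi> x) / fact n) \<longlongrightarrow> circle_deriv n t / fact n) (at 0)"
    by (intro tendsto_intros) auto
  then show "((\<lambda>x. g (t + x) / x ^ zero_multiplicity g t) \<longlongrightarrow> circle_deriv (zero_multiplicity g t) t / fact (zero_multiplicity g t)) (at 0)"
    unfolding n_def[symmetric]
    by (rule Lim_transform_eventually) (auto simp: eventually_at_filter \<xi>(2))
qed

text \<open>Nonnegativity on the circle decides both claims: approaching from the right makes the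
  leading coefficient positive, and an odd power would make it nonpositive from the left.\<close>

lemma circle_zero_expansion:
  assumes zero: "u (cis t) = 0"
  defines "n \<equiv> zero_multiplicity (\<lambda>\<theta>. u (cis \<theta>)) t"
  shows "even n" "n \<ge> 2" "\<exists>c>0. ((\<lambda>x. u (cis (t + x)) / x ^ n) \<longlongrightarrow> c) (at 0)"
proof -
  define c where "c = circle_deriv n t / fact n"
  have lim: "((\<lambda>x. u (cis (t + x)) / x ^ n) \<longlongrightarrow> c) (at 0)" and c: "c \<noteq> 0"
    using circle_expansion[of t] by (simp_all add: n_def c_def)
  have lim_r: "((\<lambda>x. u (cis (t + x)) / x ^ n) \<longlongrightarrow> c) (at_right 0)"
    and lim_l: "((\<lambda>x. u (cis (t + x)) / x ^ n) \<longlongrightarrow> c) (at_left 0)"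
    using lim by (simp_all add: filterlim_at_split)
  have "0 \<le> c"
    by (rule tendsto_lowerbound[OF lim_r])
       (auto simp: eventually_at_filter u_circle_nonneg intro!: always_eventually divide_nonneg_nonneg)
  then have cpos: "c > 0" using c by simp
  show "even n"
  proof (rule ccontr)
    assume "odd n"
    have "c \<le> 0"
    proof (rule tendsto_upperbound[OF lim_l])
      show "\<forall>\<^sub>F x in at_left 0. u (cis (t + x)) / x ^ n \<le> 0"
        unfolding eventually_at_filter
      proof (intro always_eventually allI impI)
        fix x :: real assume "x \<in> {..<0}"
        then have "x ^ n < 0" using \<open>odd n\<close> by (simp add: zero_less_power_eq power_less_zero_eq)
        then show "u (cis (t + x)) / x ^ n \<le> 0" using u_circle_nonneg[of "t + x"] by (simp add: divide_nonneg_neg)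
      qed
    qed simp
    then show False using cpos by simp
  qed
  moreover have "n \<noteq> 0"
  proof
    assume "n = 0"
    then have "circle_deriv 0 t \<noteq> 0" using c by (simp add: c_def)
    then show False using zero by (simp add: circle_deriv_0)
  qed
  ultimately show "n \<ge> 2" by (cases n) (auto elim: oddE)
  show "\<exists>c>0. ((\<lambda>x. u (cis (t + x)) / x ^ n) \<longlongrightarrow> c) (at 0)" using lim cpos by blast
qed

text \<open>A nonzero leading coefficient keeps zeros from accumulating at any point; compactness of
  the interval does the rest.\<close>

lemma finite_circle_zeros: "finite {t \<in> {a..b}. u (cis t) = 0}"
proof -
  have "\<not> t islimpt {t. u (cis t) = 0}" for t
  proof -
    define n where "n = zero_multiplicity (\<lambda>\<theta>. u (cis \<theta>)) t"
    have "((\<lambda>x. u (cis (t + x)) / x ^ n) \<longlongrightarrow> circle_deriv n t / fact n) (at 0)" "circle_deriv n t / fact n \<noteq> 0"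
      using circle_expansion[of t] by (simp_all add: n_def)
    then have "eventually (\<lambda>x. u (cis (t + x)) / x ^ n \<noteq> 0) (at 0)" by (rule tendsto_imp_eventually_ne)
    then have "eventually (\<lambda>x. u (cis (t + x)) \<noteq> 0) (at 0)" by eventually_elim auto
    then have "eventually (\<lambda>x. u (cis x) \<noteq> 0) (at t)"
      by (simp add: eventually_at_to_0[of _ t] add.commute)
    then show ?thesis by (simp add: islimpt_iff_eventually)
  qed
  then have "finite ({a..b} \<inter> {t. u (cis t) = 0})" by (intro finite_not_islimpt_in_compact) auto
  then show ?thesis by (rule rev_finite_subset) auto
qed

text \<open>The quotient (u(e^it) - u(r e^it)) / (1 - r) with the division carried out in each power
  of r, so that it extends continuously to \<open>r = 1\<close>, where it is the radial derivative
  of \<open>u\<close>.\<close>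

definition radial_quotient :: "real \<Rightarrow> real \<Rightarrow> real" where
  "radial_quotient r t = 2 * Re (\<Sum>k\<le>degree p. coeff p k * cis t ^ k * of_real (\<Sum>j<k. r ^ j))"

lemma u_radial: "u (of_real r * cis t) = u (cis t) - (1 - r) * radial_quotient r t"
proof -
  have "poly p (cis t) - poly p (of_real r * cis t) = (\<Sum>k\<le>degree p. coeff p k * cis t ^ k * of_real (1 - r ^ k))"
    unfolding poly_eq_sum_atMost[OF order_refl] sum_subtractf[symmetric]
    by (intro sum.cong refl) (simp add: power_mult_distrib algebra_simps)
  also have "\<dots> = of_real (1 - r) * (\<Sum>k\<le>degree p. coeff p k * cis t ^ k * of_real (\<Sum>j<k. r ^ j))"
    unfolding one_diff_power_eq by (subst sum_distrib_left) (intro sum.cong refl, simp add: mult_ac)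
  finally have "Re (poly p (cis t)) - Re (poly p (of_real r * cis t)) =
      (1 - r) * Re (\<Sum>k\<le>degree p. coeff p k * cis t ^ k * of_real (\<Sum>j<k. r ^ j))"
    unfolding Re_of_real_times[symmetric] minus_complex.sel[symmetric] by simp
  then show ?thesis by (simp add: u_def radial_quotient_def algebra_simps)
qed

lemma radial_quotient_1: "radial_quotient 1 t = 2 * Re (w (cis t))"
proof -
  have "degree (euler_poly p) \<le> degree p" by (rule degree_le) (simp add: coeff_euler coeff_eq_0)
  then have "w (cis t) = (\<Sum>k\<le>degree p. coeff p k * cis t ^ k * of_real (\<Sum>j<k. 1 ^ j))"
    unfolding w_def by (subst poly_eq_sum_atMost) (simp_all add: coeff_euler mult_ac)
  then show ?thesis unfolding radial_quotient_def by simp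
qed

lemma continuous_radial_quotient [continuous_intros]:
  "continuous_on S f \<Longrightarrow> continuous_on S g \<Longrightarrow> continuous_on S (\<lambda>x. radial_quotient (f x) (g x))"
  unfolding radial_quotient_def by (intro continuous_intros)

text \<open>This is the Hopf boundary lemma, with the constant that Harnack's inequality gives.\<close>

lemma radial_quotient_at_zero:
  assumes "u (cis t) = 0"
  shows "radial_quotient 1 t \<le> - 1 / 2"
proof (rule tendsto_upperbound)
  \<comment> \<open>The correction term tends to 0 and turns Harnack's bound
    \<open>- 1 / (1 + r)\<close> into the constant \<open>- 1 / 2\<close>. The absolute value keeps
    the denominator positive on the whole line.\<close>
  have "continuous_on UNIV (\<lambda>r. radial_quotient r t + (1 / (1 + \<bar>r\<bar>) - 1 / 2))"
    by (intro continuous_intros) auto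
  then have "isCont (\<lambda>r. radial_quotient r t + (1 / (1 + \<bar>r\<bar>) - 1 / 2)) 1" by (simp add: continuous_on_eq_continuous_at)
  then have "((\<lambda>r. radial_quotient r t + (1 / (1 + \<bar>r\<bar>) - 1 / 2)) \<longlongrightarrow> radial_quotient 1 t) (at 1)"
    by (simp add: isCont_def)
  then show "((\<lambda>r. radial_quotient r t + (1 / (1 + \<bar>r\<bar>) - 1 / 2)) \<longlongrightarrow> radial_quotient 1 t) (at_left 1)"
    by (simp add: filterlim_at_split)
  have "eventually (\<lambda>r. r \<in> {0<..<1}) (at_left (1::real))" by (rule eventually_at_left_real) simp
  then show "\<forall>\<^sub>F r in at_left 1. radial_quotient r t + (1 / (1 + \<bar>r\<bar>) - 1 / 2) \<le> - 1 / 2"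
  proof eventually_elim
    case (elim r)
    have "(1 - r) / (1 + r) \<le> - ((1 - r) * radial_quotient r t)"
      using u_lower[of "of_real r * cis t"] u_radial[of r t] assms elim by (simp add: norm_mult)
    then have "(1 - r) * (1 / (1 + r)) \<le> (1 - r) * (- radial_quotient r t)" by simp
    then have "1 / (1 + r) \<le> - radial_quotient r t" using elim by (subst (asm) mult_le_cancel_left_pos) auto
    then show ?case using elim by simp
  qed
qed simp

end

section \<open>Contribution of a boundary zero\<close>

text \<open>Integrability of the rescaled majorant. For even \<open>n \<ge> 2\<close>,
  \<open>1 + s ^ n\<close> is at least half of \<open>1 + s\<^sup>2\<close>: clear for small
  \<open>s\<close>, and by monotonicity of powers otherwise.\<close>

lemma integrable_inverse_even_power:
  fixes n :: nat and B :: real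
  assumes "even n" "n \<ge> 2" "B \<ge> 0"
  shows "integrable lborel (\<lambda>s::real. B / (1 + s ^ n))"
proof (rule Bochner_Integration.integrable_bound)
  show "integrable lborel (\<lambda>s::real. 2 * B * inverse (1 + s\<^sup>2))"
    using integrable_inverse_1_plus_square by (simp add: set_integrable_def)
  show "AE s in lborel. norm (B / (1 + s ^ n)) \<le> norm (2 * B * inverse (1 + s\<^sup>2))"
  proof (rule AE_I2)
    fix s :: real
    obtain m where m: "n = 2 * m" "m \<ge> 1" using assms by (auto elim!: evenE)
    have "(1 + s\<^sup>2) / 2 \<le> 1 + s ^ n"
    proof (cases "s\<^sup>2 \<le> 1")
      case True
      then show ?thesis using zero_le_even_power[OF assms(1), of s] by simp
    next
      case False
      have aux: "x \<le> X \<Longrightarrow> 0 \<le> X \<Longrightarrow> (1 + x) / 2 \<le> 1 + X" for x X :: real by (simp add: field_simps)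
      have "(s\<^sup>2) ^ 1 \<le> (s\<^sup>2) ^ m" using m False by (intro power_increasing) auto
      then show ?thesis unfolding m power_mult power_one_right by (rule aux) simp
    qed
    moreover have "0 < 1 + s\<^sup>2" by (simp add: add_pos_nonneg)
    ultimately have "B / (1 + s ^ n) \<le> B / ((1 + s\<^sup>2) / 2)" using assms(3) by (intro divide_left_mono) auto
    also have "\<dots> = 2 * B * inverse (1 + s\<^sup>2)" by (simp add: field_simps)
    finally show "norm (B / (1 + s ^ n)) \<le> norm (2 * B * inverse (1 + s\<^sup>2))"
      using assms(3) zero_le_even_power[OF assms(1), of s] by simp
  qed
qed measurable

text \<open>The scale \<open>q m = e m powr (1 / n)\<close> is chosen so that its n-th power is
  \<open>e m\<close>: after the substitution the bound becomes \<open>B / (1 + s ^ n)\<close>, the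
  same for all \<open>m\<close>. The parameter is a sequence because dominated convergence is
  applied along sequences.\<close>

lemma concentrated_integral_limit:
  fixes f :: "nat \<Rightarrow> real \<Rightarrow> real" and n :: nat
  assumes n: "even n" "n \<ge> 2" and \<delta>: "\<delta> > 0" and B: "B \<ge> 0"
    and e: "\<And>m. e m > 0" "e \<longlonglongrightarrow> 0"
    and f_meas [measurable]: "\<And>m. f m \<in> borel_measurable borel"
    and bound: "\<And>m x. \<bar>x\<bar> < \<delta> \<Longrightarrow> \<bar>f m (t + x)\<bar> \<le> B / (e m + x ^ n)"
    and lim: "\<And>s. (\<lambda>m. e m * f m (t + e m powr (1 / n) * s)) \<longlonglongrightarrow> h s"
    and h_meas [measurable]: "h \<in> borel_measurable borel"
  shows "integrable lborel h"
    and "(\<lambda>m. e m powr (1 - 1 / n) * (\<integral>\<theta>. indicator {t - \<delta><..<t + \<delta>} \<theta> * f m \<theta> \<partial>lborel)) \<longlonglongrightarrow> (\<integral>s. h s \<partial>lborel)"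
proof -
  define q where "q m = e m powr (1 / n)" for m
  have q: "q m > 0" for m using e(1)[of m] by (simp add: q_def)
  have qn: "q m ^ n = e m" for m
    using e(1)[of m] n by (simp add: q_def powr_realpow[symmetric] powr_powr)
  have q_lim: "q \<longlonglongrightarrow> 0"
    unfolding q_def using n by (intro tendsto_zero_powrI[OF e(2) tendsto_const]) (auto intro!: always_eventually less_imp_le e)
  define G where "G m s = indicator {t - \<delta><..<t + \<delta>} (t + q m * s) * (e m * f m (t + q m * s))" for m s
  have [measurable]: "G m \<in> borel_measurable borel" for m unfolding G_def by measurable
  have subst: "e m powr (1 - 1 / n) * (\<integral>\<theta>. indicator {t - \<delta><..<t + \<delta>} \<theta> * f m \<theta> \<partial>lborel) = (\<integral>s. G m s \<partial>lborel)" for m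
  proof -
    have "e m powr (1 - 1 / n) * q m = e m" using e(1)[of m] by (simp add: q_def powr_add[symmetric])
    moreover have "(\<integral>\<theta>. indicator {t - \<delta><..<t + \<delta>} \<theta> * f m \<theta> \<partial>lborel) =
       q m * (\<integral>s. indicator {t - \<delta><..<t + \<delta>} (t + q m * s) * f m (t + q m * s) \<partial>lborel)"
      using lborel_integral_real_affine[of "q m" "\<lambda>\<theta>. indicator {t - \<delta><..<t + \<delta>} \<theta> * f m \<theta>" t] q[of m] by simp
    ultimately have "e m powr (1 - 1 / n) * (\<integral>\<theta>. indicator {t - \<delta><..<t + \<delta>} \<theta> * f m \<theta> \<partial>lborel) =
       e m * (\<integral>s. indicator {t - \<delta><..<t + \<delta>} (t + q m * s) * f m (t + q m * s) \<partial>lborel)"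
      by (simp add: mult.assoc[symmetric])
    also have "\<dots> = (\<integral>s. e m * (indicator {t - \<delta><..<t + \<delta>} (t + q m * s) * f m (t + q m * s)) \<partial>lborel)"
      by simp
    also have "\<dots> = (\<integral>s. G m s \<partial>lborel)" unfolding G_def by (simp add: mult_ac)
    finally show ?thesis .
  qed
  have G_bound: "norm (G m s) \<le> B / (1 + s ^ n)" for m s
  proof (cases "\<bar>q m * s\<bar> < \<delta>")
    case True
    have "norm (G m s) \<le> e m * \<bar>f m (t + q m * s)\<bar>"
      using e(1)[of m] by (auto simp: G_def abs_mult indicator_def)
    also have "\<dots> \<le> e m * (B / (e m + (q m * s) ^ n))"
      using e(1)[of m] by (intro mult_left_mono bound True) auto
    also have "(q m * s) ^ n = e m * s ^ n" by (simp add: power_mult_distrib qn)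
    also have "e m * (B / (e m + e m * s ^ n)) = B / (1 + s ^ n)"
    proof -
      have "e m + e m * s ^ n = e m * (1 + s ^ n)" by (simp add: algebra_simps)
      then show ?thesis using e(1)[of m] by simp
    qed
    finally show ?thesis .
  next
    case False
    then have "t + q m * s \<notin> {t - \<delta><..<t + \<delta>}" by auto
    then show ?thesis using B n by (simp add: G_def zero_le_even_power)
  qed
  have G_lim: "(\<lambda>m. G m s) \<longlonglongrightarrow> h s" for s
  proof -
    have "(\<lambda>m. q m * s) \<longlonglongrightarrow> 0 * s" by (intro tendsto_intros q_lim)
    then have "eventually (\<lambda>m. \<bar>q m * s\<bar> < \<delta>) sequentially"
      using \<delta> by (simp add: tendsto_iff dist_real_def)
    then have "eventually (\<lambda>m. e m * f m (t + e m powr (1 / n) * s) = G m s) sequentially"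
      by eventually_elim (auto simp: G_def q_def indicator_def abs_less_iff)
    then show ?thesis by (rule Lim_transform_eventually[OF lim])
  qed
  have dom: "integrable lborel (\<lambda>s::real. B / (1 + s ^ n))"
    by (rule integrable_inverse_even_power[OF n B])
  show "integrable lborel h"
    by (rule integrable_dominated_convergence[OF _ _ dom, of h G]) (use G_lim G_bound in auto)
  show "(\<lambda>m. e m powr (1 - 1 / n) * (\<integral>\<theta>. indicator {t - \<delta><..<t + \<delta>} \<theta> * f m \<theta> \<partial>lborel)) \<longlonglongrightarrow> (\<integral>s. h s \<partial>lborel)"
    unfolding subst
    by (rule integral_dominated_convergence[OF _ _ dom, of h G]) (use G_lim G_bound in auto)
qed

lemma integral_lborel_pos:
  fixes h :: "real \<Rightarrow> real"
  assumes "integrable lborel h" "\<And>s. h s > 0"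
  shows "0 < (\<integral>s. h s \<partial>lborel)"
proof -
  have "0 \<le> (\<integral>s. h s \<partial>lborel)" using assms by (intro integral_nonneg_AE) (auto intro: less_imp_le)
  moreover have "(\<integral>s. h s \<partial>lborel) \<noteq> 0"
  proof
    assume "(\<integral>s. h s \<partial>lborel) = 0"
    then have "AE s in lborel. h s = 0"
      using assms by (subst (asm) integral_nonneg_eq_0_iff_AE) (auto intro: less_imp_le)
    then have "AE s in (lborel :: real measure). False" using assms(2) by (auto elim!: eventually_mono simp: less_le)
    then have "ae_filter (lborel :: real measure) = bot" by (simp add: trivial_limit_def)
    then show False by (simp add: ae_filter_eq_bot_iff)
  qed
  ultimately show ?thesis by simp
qed

lemma one_minus_powr_tendsto_0:
  assumes "\<beta> > 0"
  shows "((\<lambda>r::real. (1 - r) powr \<beta>) \<longlongrightarrow> 0) (at_left 1)"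
proof (rule tendsto_zero_powrI)
  show "((\<lambda>r::real. 1 - r) \<longlongrightarrow> 0) (at_left 1)" by (auto intro!: tendsto_eq_intros)
  show "\<forall>\<^sub>F r in at_left 1. 0 \<le> 1 - (r::real)" by (auto simp: eventually_at_filter)
qed (use assms in auto)

lemma integral_periodic_shift:
  fixes f :: "real \<Rightarrow> real"
  assumes cont: "continuous_on UNIV f" and per: "\<And>x. f (x + T) = f x" and a: "- T \<le> a" "a \<le> 0"
  shows "integral {a..a + T} f = integral {0..T} f"
proof -
  have i: "f integrable_on {x..y}" for x y
    by (rule integrable_continuous_interval) (rule continuous_on_subset[OF cont], simp)
  have "integral {a..0} f = integral {a + T..0 + T} f"
    using integral_shift[OF continuous_on_subset[OF cont], of a T 0] per by (simp add: o_def)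
  moreover have "integral {a..0} f + integral {0..a + T} f = integral {a..a + T} f"
    using a by (intro Henstock_Kurzweil_Integration.integral_combine i) auto
  moreover have "integral {0..a + T} f + integral {a + T..T} f = integral {0..T} f"
    using a by (intro Henstock_Kurzweil_Integration.integral_combine i) auto
  ultimately show ?thesis by simp
qed

section \<open>Rescaling at a single zero\<close>

context positive_potential
begin

definition F :: "real \<Rightarrow> real \<Rightarrow> real" where
  "F r \<theta> = - Re (w (of_real r * cis \<theta>)) / u (of_real r * cis \<theta>)"

lemma continuous_F: "0 \<le> r \<Longrightarrow> r < 1 \<Longrightarrow> continuous_on S (F r)"
  unfolding F_def by (intro continuous_intros) (simp add: less_imp_neq[OF u_pos_circle, symmetric])

lemma w_bound: "\<exists>B>0. \<forall>z. cmod z \<le> 1 \<longrightarrow> \<bar>Re (w z)\<bar> \<le> B"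
proof -
  have "compact (w ` cball 0 1)" by (intro compact_continuous_image continuous_intros) auto
  then obtain B where "\<And>z. z \<in> cball 0 1 \<Longrightarrow> cmod (w z) \<le> B"
    using compact_imp_bounded bounded_iff by (metis imageI)
  then have "\<bar>Re (w z)\<bar> \<le> max B 1" if "cmod z \<le> 1" for z
    using that abs_Re_le_cmod[of "w z"] by (force intro: order_trans)
  then show ?thesis by (intro exI[of _ "max B 1"]) auto
qed

text \<open>The limit is the integral of \<open>(b / 2) / (c * s ^ n + b)\<close>, with
  \<open>c\<close> the leading coefficient along the circle and \<open>b\<close> the rate in the
  radial direction. It is the same for every small \<open>\<delta>\<close>, so that one common width
  can later serve all zeros.\<close>

lemma zero_contribution:
  assumes zero: "u (cis t) = 0"
  defines "n \<equiv> zero_multiplicity (\<lambda>\<theta>. u (cis \<theta>)) t"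
  shows "\<exists>\<delta>\<^sub>0>0. \<exists>l>0. \<forall>\<delta>. 0 < \<delta> \<and> \<delta> \<le> \<delta>\<^sub>0 \<longrightarrow>
    ((\<lambda>r. (1 - r) powr (1 - 1 / n) * (\<integral>\<theta>. indicator {t - \<delta><..<t + \<delta>} \<theta> * F r \<theta> \<partial>lborel)) \<longlongrightarrow> l) (at_left 1)"
proof -
  note n = circle_zero_expansion(1,2)[OF zero, folded n_def]
  obtain c where c: "c > 0" and c_lim: "((\<lambda>x. u (cis (t + x)) / x ^ n) \<longlongrightarrow> c) (at 0)"
    using circle_zero_expansion(3)[OF zero] by (auto simp: n_def)
  \<comment> \<open>Near the zero, u(r e^(i(t + x))) behaves like c x^n + b (1 - r). The Hopf bound
    makes \<open>b\<close> at least 1/2, and the numerator at the zero itself is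
    \<open>b / 2\<close>.\<close>
  define b where "b = - radial_quotient 1 t"
  have b: "b \<ge> 1 / 2" using radial_quotient_at_zero[OF zero] by (simp add: b_def)
  have w_t: "- Re (w (cis t)) = b / 2" by (simp add: b_def radial_quotient_1)
  have xn: "0 \<le> x ^ n" for x :: real using n by (simp add: zero_le_even_power)
  obtain \<delta>1 where \<delta>1: "\<delta>1 > 0" "\<And>x. \<bar>x\<bar> < \<delta>1 \<Longrightarrow> c / 2 * x ^ n \<le> u (cis (t + x))"
  proof -
    have "eventually (\<lambda>x. c / 2 < u (cis (t + x)) / x ^ n) (at 0)"
      using c by (intro order_tendstoD(1)[OF c_lim]) simp
    then obtain d where d: "d > 0" "\<And>x. x \<noteq> 0 \<Longrightarrow> dist x 0 < d \<Longrightarrow> c / 2 < u (cis (t + x)) / x ^ n"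
      unfolding eventually_at by auto
    have "c / 2 * x ^ n \<le> u (cis (t + x))" if "\<bar>x\<bar> < d" for x
    proof (cases "x = 0")
      case True
      then show ?thesis using zero n by (simp add: power_0_left)
    next
      case False
      then have "0 < x ^ n" using n by (simp add: zero_less_power_eq)
      moreover have "c / 2 < u (cis (t + x)) / x ^ n" using d(2)[OF False] that by (simp add: dist_real_def)
      ultimately have "c / 2 * x ^ n < u (cis (t + x))" by (subst (asm) pos_less_divide_eq)
      then show ?thesis by (rule less_imp_le)
    qed
    then show ?thesis using that d by blast
  qed
  \<comment> \<open>Joint continuity in radius and angle: at \<open>(1, t)\<close> the value is at
    most -1/2, so -1/4 leaves room.\<close>
  obtain \<delta>2 where \<delta>2: "\<delta>2 > 0" "\<And>r x. \<bar>r - 1\<bar> < \<delta>2 \<Longrightarrow> \<bar>x\<bar> < \<delta>2 \<Longrightarrow> radial_quotient r (t + x) < - (1 / 4)"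
  proof -
    have "open {z :: real \<times> real. radial_quotient (fst z) (snd z) < - (1 / 4)}"
      by (intro open_Collect_less continuous_intros)
    then obtain U V where UV: "open U" "open V" "1 \<in> U" "t \<in> V"
      "U \<times> V \<subseteq> {z :: real \<times> real. radial_quotient (fst z) (snd z) < - (1 / 4)}"
      by (rule open_prod_elim[of _ "(1, t)"]) (use b in \<open>auto simp: b_def\<close>)
    obtain d1 where "d1 > 0" "ball 1 d1 \<subseteq> U" using UV open_contains_ball by blast
    moreover obtain d2 where "d2 > 0" "ball t d2 \<subseteq> V" using UV open_contains_ball by blast
    ultimately have "radial_quotient r (t + x) < - (1 / 4)" if "\<bar>r - 1\<bar> < min d1 d2" "\<bar>x\<bar> < min d1 d2" for r x
    proof -
      have "r \<in> ball 1 d1" "t + x \<in> ball t d2" using that by (auto simp: dist_real_def)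
      then have "(r, t + x) \<in> U \<times> V" using \<open>ball 1 d1 \<subseteq> U\<close> \<open>ball t d2 \<subseteq> V\<close> by blast
      then show ?thesis using UV(5) by auto
    qed
    then show ?thesis using that[of "min d1 d2"] \<open>d1 > 0\<close> \<open>d2 > 0\<close> by simp
  qed
  obtain B where B: "B > 0" "\<And>z. cmod z \<le> 1 \<Longrightarrow> \<bar>Re (w z)\<bar> \<le> B" using w_bound by blast
  \<comment> \<open>The estimates along the circle and along the radius add up in
    \<open>u_radial\<close> to the lower bound \<open>c1 * ((1 - r) + x ^ n)\<close>, which yields
    the domination.\<close>
  define c1 where "c1 = min (1 / 4) (c / 2)"
  have c1: "c1 > 0" using c by (simp add: c1_def)
  define h where "h s = (b / 2) / (c * s ^ n + b)" for s :: real
  have h_pos: "h s > 0" for s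
    unfolding h_def using b c xn[of s] by (intro divide_pos_pos add_nonneg_pos mult_nonneg_nonneg) auto
  have h_meas: "h \<in> borel_measurable borel" unfolding h_def by measurable
  \<comment> \<open>Radii beyond \<open>start\<close> are positive and within
    \<open>\<delta>2\<close> of 1.\<close>
  define start where "start = max 0 (1 - \<delta>2)"
  have start: "start < 1" using \<delta>2 by (simp add: start_def)
  have key: "integrable lborel h \<and>
      (\<lambda>m. (1 - S m) powr (1 - 1 / n) * (\<integral>\<theta>. indicator {t - \<delta><..<t + \<delta>} \<theta> * F (S m) \<theta> \<partial>lborel)) \<longlonglongrightarrow> (\<integral>s. h s \<partial>lborel)"
    if \<delta>: "0 < \<delta>" "\<delta> \<le> min \<delta>1 \<delta>2" and S: "\<And>m. S m < 1" "\<And>m. start < S m" "S \<longlonglongrightarrow> 1" for \<delta> S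
  proof -
    have S': "0 < S m" "\<bar>S m - 1\<bar> < \<delta>2" for m using S(1)[of m] S(2)[of m] by (auto simp: start_def)
    have e_lim: "(\<lambda>m. 1 - S m) \<longlonglongrightarrow> 0" using tendsto_diff[OF tendsto_const S(3), of 1] by simp
    have bd: "\<bar>F (S m) (t + x)\<bar> \<le> (B / c1) / ((1 - S m) + x ^ n)" if "\<bar>x\<bar> < \<delta>" for m x
    proof -
      have "c1 * ((1 - S m) + x ^ n) \<le> 1 / 4 * (1 - S m) + c / 2 * x ^ n"
        unfolding distrib_left using S(1)[of m] xn[of x] by (intro add_mono mult_right_mono) (auto simp: c1_def)
      also have "\<dots> \<le> u (of_real (S m) * cis (t + x))"
      proof -
        have "(1 - S m) * radial_quotient (S m) (t + x) \<le> (1 - S m) * (- (1 / 4))"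
          using S(1)[of m] S'(2)[of m] \<delta> that by (intro mult_left_mono less_imp_le[OF \<delta>2(2)]) auto
        moreover have "c / 2 * x ^ n \<le> u (cis (t + x))" using \<delta> that by (intro \<delta>1(2)) auto
        ultimately show ?thesis unfolding u_radial by simp
      qed
      finally have le: "c1 * ((1 - S m) + x ^ n) \<le> u (of_real (S m) * cis (t + x))" .
      have pos: "0 < c1 * ((1 - S m) + x ^ n)"
        using c1 S(1)[of m] xn[of x] by (intro mult_pos_pos add_pos_nonneg) auto
      have "\<bar>F (S m) (t + x)\<bar> = \<bar>Re (w (of_real (S m) * cis (t + x)))\<bar> / u (of_real (S m) * cis (t + x))"
        using pos le by (simp add: F_def)
      also have "\<dots> \<le> B / (c1 * ((1 - S m) + x ^ n))"
        using S(1)[of m] S'(1)[of m] B(1) by (intro frac_le le pos B(2)) (auto simp: norm_mult)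
      finally show ?thesis by simp
    qed
    have lim: "(\<lambda>m. (1 - S m) * F (S m) (t + (1 - S m) powr (1 / n) * s)) \<longlonglongrightarrow> h s" for s
    proof -
      define x where "x m = (1 - S m) powr (1 / n) * s" for m
      have x_lim: "x \<longlonglongrightarrow> 0"
      proof -
        have "(\<lambda>m. (1 - S m) powr (1 / n)) \<longlonglongrightarrow> 0"
          using n by (intro tendsto_zero_powrI[OF e_lim tendsto_const]) (auto intro!: always_eventually less_imp_le S)
        then show ?thesis unfolding x_def using tendsto_mult[OF _ tendsto_const] by fastforce
      qed
      have xpow: "x m ^ n = (1 - S m) * s ^ n" for m
        using S(1)[of m] n by (simp add: x_def power_mult_distrib powr_realpow[symmetric] powr_powr)
      have l1: "(\<lambda>m. u (cis (t + x m)) / (1 - S m)) \<longlonglongrightarrow> c * s ^ n"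
      \<comment> \<open>For \<open>s \<noteq> 0\<close> the points \<open>x m\<close> avoid 0, as
        the punctured limit \<open>c_lim\<close> demands; for \<open>s = 0\<close> they sit at the
        zero itself.\<close>
      proof (cases "s = 0")
        case True
        then show ?thesis using zero n by (simp add: x_def power_0_left)
      next
        case False
        have "x m \<noteq> 0" for m using S(1)[of m] False by (simp add: x_def)
        then have "filterlim x (at 0) sequentially" using x_lim by (simp add: filterlim_at)
        then have "(\<lambda>m. u (cis (t + x m)) / x m ^ n) \<longlonglongrightarrow> c" by (rule filterlim_compose[OF c_lim])
        then have "(\<lambda>m. u (cis (t + x m)) / x m ^ n * s ^ n) \<longlonglongrightarrow> c * s ^ n" by (intro tendsto_intros)
        then show ?thesis using False by (simp add: xpow)
      qed
      have t_lim: "(\<lambda>m. t + x m) \<longlonglongrightarrow> t" using tendsto_add[OF tendsto_const x_lim, of t] by simp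
      have l2: "(\<lambda>m. radial_quotient (S m) (t + x m)) \<longlonglongrightarrow> radial_quotient 1 t"
      proof -
        have "continuous_on UNIV (\<lambda>z :: real \<times> real. radial_quotient (fst z) (snd z))" by (intro continuous_intros)
        then have "isCont (\<lambda>z :: real \<times> real. radial_quotient (fst z) (snd z)) (1, t)"
          by (simp add: continuous_on_eq_continuous_at)
        from isCont_tendsto_compose[OF this tendsto_Pair[OF S(3) t_lim]] show ?thesis by simp
      qed
      have l3: "(\<lambda>m. - Re (w (of_real (S m) * cis (t + x m)))) \<longlonglongrightarrow> b / 2"
      proof -
        have "continuous_on UNIV (\<lambda>z :: real \<times> real. - Re (w (of_real (fst z) * cis (snd z))))" by (intro continuous_intros)
        then have "isCont (\<lambda>z :: real \<times> real. - Re (w (of_real (fst z) * cis (snd z)))) (1, t)"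
          by (simp add: continuous_on_eq_continuous_at)
        from isCont_tendsto_compose[OF this tendsto_Pair[OF S(3) t_lim]] show ?thesis using w_t by simp
      qed
      \<comment> \<open>Cancelling \<open>1 - S m\<close> against the denominator, through
        \<open>u_radial\<close>, turns the scaled integrand into a quotient whose numerator and
        denominator both converge.\<close>
      have "(\<lambda>m. - Re (w (of_real (S m) * cis (t + x m))) / (u (cis (t + x m)) / (1 - S m) - radial_quotient (S m) (t + x m)))
          \<longlonglongrightarrow> (b / 2) / (c * s ^ n - radial_quotient 1 t)"
        using h_pos[of s] by (intro tendsto_divide l3 tendsto_diff l1 l2) (auto simp: h_def b_def)
      moreover have "- Re (w (of_real (S m) * cis (t + x m))) / (u (cis (t + x m)) / (1 - S m) - radial_quotient (S m) (t + x m)) =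
          (1 - S m) * F (S m) (t + x m)" for m
      proof -
        have *: "W / (U / e - R) = e * (W / (U - e * R))" if "e \<noteq> 0" for W U e R :: real
        proof -
          have "U - e * R = e * (U / e - R)" using that by (simp add: field_simps)
          then show ?thesis using that by simp
        qed
        show ?thesis unfolding F_def u_radial by (rule *) (use S(1)[of m] in auto)
      qed
      ultimately show ?thesis by (simp add: x_def h_def b_def)
    qed
    have cont: "F (S m) \<in> borel_measurable borel" for m
      using S(1)[of m] S'(1)[of m] by (intro borel_measurable_continuous_onI continuous_F) auto
    have B': "0 \<le> B / c1" using B c1 by simp
    have e_pos: "0 < 1 - S m" for m using S by simp
    show ?thesis
      using concentrated_integral_limit[OF n \<delta>(1) B' e_pos e_lim cont bd lim h_meas] by blast
  qed
  have "integrable lborel h"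
  proof -
    \<comment> \<open>Integrability of \<open>h\<close> does not mention a sequence, but
      \<open>key\<close> delivers it along one, so an admissible sequence has to be
      exhibited.\<close>
    define S where "S m = 1 - (1 - start) * inverse (real (Suc (Suc m)))" for m
    have i: "0 < inverse (real (Suc (Suc m)))" "inverse (real (Suc (Suc m))) < 1" for m
      by (auto simp: field_simps intro!: add_pos_nonneg)
    have "S m < 1" for m using i(1)[of m] start unfolding S_def by simp
    moreover have "start < S m" for m
    proof -
      have "(1 - start) * inverse (real (Suc (Suc m))) < (1 - start) * 1"
        using start by (intro mult_strict_left_mono i(2)) simp
      then have "start < 1 - (1 - start) * inverse (real (Suc (Suc m)))" by (simp only: mult_1_right)
      then show ?thesis by (simp only: S_def)
    qed
    moreover have "S \<longlonglongrightarrow> 1"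
    proof -
      have "(\<lambda>m. inverse (real (Suc (Suc m)))) \<longlonglongrightarrow> 0" by (rule LIMSEQ_Suc[OF LIMSEQ_inverse_real_of_nat])
      then have "(\<lambda>m. 1 - (1 - start) * inverse (real (Suc (Suc m)))) \<longlonglongrightarrow> 1 - (1 - start) * 0" by (intro tendsto_intros)
      then show ?thesis by (simp add: S_def[abs_def])
    qed
    ultimately show ?thesis using key[of "min \<delta>1 \<delta>2" S] \<delta>1 \<delta>2 by simp
  qed
  then have hp: "0 < (\<integral>s. h s \<partial>lborel)" using h_pos by (rule integral_lborel_pos)
  have "0 < min \<delta>1 \<delta>2" using \<delta>1 \<delta>2 by simp
  moreover have "\<forall>\<delta>. 0 < \<delta> \<and> \<delta> \<le> min \<delta>1 \<delta>2 \<longrightarrow>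
    ((\<lambda>r. (1 - r) powr (1 - 1 / n) * (\<integral>\<theta>. indicator {t - \<delta><..<t + \<delta>} \<theta> * F r \<theta> \<partial>lborel)) \<longlongrightarrow> (\<integral>s. h s \<partial>lborel)) (at_left 1)"
  proof (intro allI impI)
    fix \<delta> assume \<delta>: "0 < \<delta> \<and> \<delta> \<le> min \<delta>1 \<delta>2"
    show "((\<lambda>r. (1 - r) powr (1 - 1 / n) * (\<integral>\<theta>. indicator {t - \<delta><..<t + \<delta>} \<theta> * F r \<theta> \<partial>lborel)) \<longlongrightarrow> (\<integral>s. h s \<partial>lborel)) (at_left 1)"
      by (rule tendsto_at_left_sequentially[OF start]) (use key \<delta> in blast)
  qed
  ultimately show ?thesis using hp by blast
qed

end

section \<open>Summing the contributions over the circle\<close>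

context positive_potential
begin

text \<open>By periodicity the window of integration may start at a negative \<open>a\<close>, so
  that a zero at angle 0 becomes an interior point.\<close>

lemma A_eq_shifted:
  assumes a: "- 2 * pi \<le> a" "a \<le> 0" and r: "0 \<le> r" "r < 1"
  shows "A r = 1 / (2 * pi) * (\<integral>\<theta>. indicator {a..a + 2 * pi} \<theta> * F r \<theta> \<partial>lborel)"
proof -
  have "A r = 1 / (2 * pi) * integral {0..2 * pi} (F r)"
    using integral_angle_continuous[OF continuous_F[OF r]] by (simp add: A_def F_def[abs_def])
  also have "integral {0..2 * pi} (F r) = integral {a..a + 2 * pi} (F r)"
    using a by (intro integral_periodic_shift[symmetric] continuous_F r) (auto simp: F_def cis_mult[symmetric])
  also have "\<dots> = (\<integral>\<theta>. indicator {a..a + 2 * pi} \<theta> * F r \<theta> \<partial>lborel)"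
    using set_borel_integral_eq_integral(2)[OF borel_integrable_atLeastAtMost'[OF continuous_F[OF r]], of a "a + 2 * pi"]
    by (simp add: set_lebesgue_integral_def)
  finally show ?thesis .
qed

text \<open>On the compact set of all radii in [0, 1] and angles in \<open>K\<close>,
  \<open>u\<close> has a positive minimum. The integrals stay bounded as r tends to 1, and the
  positive power of \<open>1 - r\<close> sends the product to 0.\<close>

lemma zero_free_contribution:
  assumes K: "compact K" "\<And>\<theta>. \<theta> \<in> K \<Longrightarrow> u (cis \<theta>) \<noteq> 0" and \<alpha>: "\<alpha> > 0"
  shows "((\<lambda>r. (1 - r) powr \<alpha> * (\<integral>\<theta>. indicator K \<theta> * F r \<theta> \<partial>lborel)) \<longlongrightarrow> 0) (at_left 1)"
proof -
  obtain B where B: "B > 0" "\<And>z. cmod z \<le> 1 \<Longrightarrow> \<bar>Re (w z)\<bar> \<le> B" using w_bound by blast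
  obtain m where m: "m > 0" "\<And>r \<theta>. r \<in> {0..1} \<Longrightarrow> \<theta> \<in> K \<Longrightarrow> m \<le> u (of_real r * cis \<theta>)"
  proof (cases "K = {}")
    case True
    then show ?thesis using that[of 1] by simp
  next
    case False
    have "\<exists>x\<in>{0..1} \<times> K. \<forall>y\<in>{0..1} \<times> K. u (of_real (fst x) * cis (snd x)) \<le> u (of_real (fst y) * cis (snd y))"
      using False K(1) by (intro continuous_attains_inf compact_Times continuous_intros) auto
    then obtain r0 \<theta>0 where x: "r0 \<in> {0..1}" "\<theta>0 \<in> K"
      "\<And>r \<theta>. r \<in> {0..1} \<Longrightarrow> \<theta> \<in> K \<Longrightarrow> u (of_real r0 * cis \<theta>0) \<le> u (of_real r * cis \<theta>)" by force
    have "u (of_real r0 * cis \<theta>0) > 0"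
      using u_pos_circle[of r0 \<theta>0] u_circle_nonneg[of \<theta>0] K(2)[OF x(2)] x(1) by (cases "r0 = 1") auto
    then show ?thesis using that x by blast
  qed
  have fin: "emeasure lborel K < \<infinity>" by (rule emeasure_compact_finite[OF K(1)])
  have [measurable]: "K \<in> sets borel" using K(1) by (simp add: compact_imp_closed borel_closed)
  have bound: "\<bar>\<integral>\<theta>. indicator K \<theta> * F r \<theta> \<partial>lborel\<bar> \<le> measure lborel K * (B / m)" if r: "r \<in> {0<..<1}" for r
  proof -
    have "\<bar>\<integral>\<theta>. indicator K \<theta> * F r \<theta> \<partial>lborel\<bar> \<le> (\<integral>\<theta>. indicator K \<theta> * (B / m) \<partial>lborel)"
    proof (rule order_trans[OF integral_abs_bound integral_mono])
      show "integrable lborel (\<lambda>\<theta>. \<bar>indicator K \<theta> * F r \<theta>\<bar>)"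
        using borel_integrable_compact[OF K(1) continuous_F[of r]] r by simp
      show "integrable lborel (\<lambda>\<theta>. indicator K \<theta> * (B / m))" using fin by simp
      show "\<bar>indicator K \<theta> * F r \<theta>\<bar> \<le> indicator K \<theta> * (B / m)" for \<theta>
      proof (cases "\<theta> \<in> K")
        case True
        have mu: "m \<le> u (of_real r * cis \<theta>)" using m(2)[OF _ True] r by simp
        have "\<bar>Re (w (of_real r * cis \<theta>))\<bar> / u (of_real r * cis \<theta>) \<le> B / m"
          using r mu m(1) B(1) by (intro frac_le B(2)) (auto simp: norm_mult)
        then show ?thesis using True mu m(1) by (simp add: F_def)
      qed simp
    qed
    also have "\<dots> = measure lborel K * (B / m)" by simp
    finally show ?thesis .
  qed
  have "((\<lambda>r::real. (1 - r) powr \<alpha>) \<longlongrightarrow> 0) (at_left 1)" using \<alpha> by (rule one_minus_powr_tendsto_0)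
  then have lim: "((\<lambda>r::real. (1 - r) powr \<alpha> * (measure lborel K * (B / m))) \<longlongrightarrow> 0) (at_left 1)"
    by (rule tendsto_mult_left_zero)
  show ?thesis
  proof (rule Lim_null_comparison[OF _ lim])
    have "eventually (\<lambda>r. r \<in> {0<..<1}) (at_left (1::real))" by (rule eventually_at_left_real) simp
    then show "\<forall>\<^sub>F r in at_left 1. norm ((1 - r) powr \<alpha> * (\<integral>\<theta>. indicator K \<theta> * F r \<theta> \<partial>lborel)) \<le> (1 - r) powr \<alpha> * (measure lborel K * (B / m))"
    proof eventually_elim
      case (elim r)
      show ?case unfolding real_norm_def abs_mult abs_of_nonneg[OF powr_ge_zero]
        by (rule mult_left_mono[OF bound[OF elim] powr_ge_zero])
    qed
  qed
qed

text \<open>A zero of multiplicity \<open>N\<close> contributes at the rate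
  \<open>(1 - r) powr (1 / N - 1)\<close>, which grows faster the larger \<open>N\<close> is. After
  scaling by the largest rate, only the zeros of maximal multiplicity survive, each with a positive
  limit.\<close>

lemma A_zeros:
  defines "Z \<equiv> {t \<in> {0..<2 * pi}. u (cis t) = 0}"
  assumes Z_ne: "Z \<noteq> {}"
  defines "k \<equiv> Max ((\<lambda>t. zero_multiplicity (\<lambda>\<theta>. u (cis \<theta>)) t div 2) ` Z)"
  shows "k \<ge> 1"
    and "\<exists>C>0. ((\<lambda>r. (1 - r) powr ((2 * real k - 1) / (2 * real k)) * A r) \<longlongrightarrow> C) (at_left 1)"
proof -
  define N where "N t = zero_multiplicity (\<lambda>\<theta>. u (cis \<theta>)) t" for t
  have N: "even (N t)" "N t \<ge> 2" if "t \<in> Z" for t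
    using circle_zero_expansion(1,2)[of t] that by (simp_all add: N_def Z_def)
  have finZ: "finite Z" by (rule finite_subset[OF _ finite_circle_zeros[of 0 "2 * pi"]]) (auto simp: Z_def)
  have kmax: "N t div 2 \<le> k" if "t \<in> Z" for t
    unfolding k_def N_def[symmetric] using finZ that by (intro Max_ge) auto
  have "k \<in> (\<lambda>t. N t div 2) ` Z" unfolding k_def N_def[symmetric] using finZ Z_ne by (intro Max_in) auto
  then obtain t0 where t0: "t0 \<in> Z" "N t0 = 2 * k" using N by fastforce
  show k: "k \<ge> 1" using N(2)[OF t0(1)] t0(2) by simp
  define \<alpha> where "\<alpha> = 1 - 1 / real (2 * k)"
  have \<alpha>: "\<alpha> > 0" "(2 * real k - 1) / (2 * real k) = \<alpha>" using k by (auto simp: \<alpha>_def field_simps)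
  \<comment> \<open>The point -1 keeps this set nonempty. Halving its maximum gives a cut
    \<open>a\<close> in (-1, 0) with no zero in [a, 0).\<close>
  define T where "T = insert (- 1) {t \<in> {- 1..0}. u (cis t) = 0 \<and> t \<noteq> 0}"
  have finT: "finite T" unfolding T_def
    by (intro finite.insertI, rule finite_subset[OF _ finite_circle_zeros[of "- 1" 0]]) auto
  define a where "a = Max T / 2"
  have "Max T \<in> T" by (rule Max_in[OF finT]) (simp add: T_def)
  then have MT: "- 1 \<le> Max T" "Max T < 0" by (auto simp: T_def)
  have a: "- 1 < a" "a < 0" "Max T < a" using MT by (auto simp: a_def)
  have none: "u (cis t) \<noteq> 0" if "a \<le> t" "t < 0" for t
  proof
    assume "u (cis t) = 0"
    then have "t \<in> T" using that a by (auto simp: T_def)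
    then show False using Max_ge[OF finT] a that by force
  qed
  define b where "b = a + 2 * pi"
  have b: "b < 2 * pi" "a < b" using a pi_gt3 by (auto simp: b_def)
  have Z_eq: "t \<in> Z" if "a \<le> t" "t \<le> b" "u (cis t) = 0" for t
    using that none[of t] b by (force simp: Z_def)
  have Z_in: "a < t" "t < b" "u (cis t) = 0" if "t \<in> Z" for t
  proof -
    show "a < t" "u (cis t) = 0" using that a by (auto simp: Z_def)
    show "t < b"
    proof (rule ccontr)
      assume "\<not> t < b"
      moreover have "cis (t - 2 * pi) = cis t" by (simp add: cis_divide[symmetric])
      ultimately show False using none[of "t - 2 * pi"] that by (auto simp: b_def Z_def)
    qed
  qed
  have "\<forall>t\<in>Z. \<exists>\<delta>0 l. \<delta>0 > 0 \<and> l > 0 \<and> (\<forall>\<delta>. 0 < \<delta> \<and> \<delta> \<le> \<delta>0 \<longrightarrow>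
    ((\<lambda>r. (1 - r) powr (1 - 1 / real (N t)) * (\<integral>\<theta>. indicator {t - \<delta><..<t + \<delta>} \<theta> * F r \<theta> \<partial>lborel)) \<longlongrightarrow> l) (at_left 1))"
    using zero_contribution[OF Z_in(3)] unfolding N_def by blast
  from bchoice[OF this] obtain \<delta>0 where "\<forall>t\<in>Z. \<exists>l. \<delta>0 t > 0 \<and> l > 0 \<and> (\<forall>\<delta>. 0 < \<delta> \<and> \<delta> \<le> \<delta>0 t \<longrightarrow>
    ((\<lambda>r. (1 - r) powr (1 - 1 / real (N t)) * (\<integral>\<theta>. indicator {t - \<delta><..<t + \<delta>} \<theta> * F r \<theta> \<partial>lborel)) \<longlongrightarrow> l) (at_left 1))" ..
  from bchoice[OF this] obtain l where \<delta>0l: "\<forall>t\<in>Z. \<delta>0 t > 0 \<and> l t > 0 \<and> (\<forall>\<delta>. 0 < \<delta> \<and> \<delta> \<le> \<delta>0 t \<longrightarrow>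
    ((\<lambda>r. (1 - r) powr (1 - 1 / real (N t)) * (\<integral>\<theta>. indicator {t - \<delta><..<t + \<delta>} \<theta> * F r \<theta> \<partial>lborel)) \<longlongrightarrow> l t) (at_left 1))" ..
  have \<delta>0: "\<delta>0 t > 0" and l: "l t > 0" if "t \<in> Z" for t using \<delta>0l that by blast+
  have lim: "((\<lambda>r. (1 - r) powr (1 - 1 / real (N t)) * (\<integral>\<theta>. indicator {t - \<delta><..<t + \<delta>} \<theta> * F r \<theta> \<partial>lborel)) \<longlongrightarrow> l t) (at_left 1)"
    if "t \<in> Z" "0 < \<delta>" "\<delta> \<le> \<delta>0 t" for t \<delta> using \<delta>0l that by blast
  have small: "eventually (\<lambda>\<delta>. \<delta> < x) (at_right 0)" if "x > 0" for x :: real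
    using eventually_at_right_real[OF that] by eventually_elim auto
  \<comment> \<open>One width below finitely many positive thresholds: the local scales
    \<open>\<delta>0\<close>, the distances to the ends of the window, and half the gaps between
    zeros, which makes the intervals disjoint.\<close>
  have "eventually (\<lambda>\<delta>. \<delta> > 0 \<and> (\<forall>t\<in>Z. \<delta> < \<delta>0 t \<and> \<delta> < t - a \<and> \<delta> < b - t \<and> (\<forall>t'\<in>Z - {t}. \<delta> < \<bar>t - t'\<bar> / 2))) (at_right 0)"
    using Z_in \<delta>0 finZ
    by (intro eventually_conj eventually_ball_finite ballI small eventually_at_right_less) auto
  from eventually_happens'[OF trivial_limit_at_right_real this]
  obtain \<delta> where \<delta>': "\<delta> > 0 \<and> (\<forall>t\<in>Z. \<delta> < \<delta>0 t \<and> \<delta> < t - a \<and> \<delta> < b - t \<and> (\<forall>t'\<in>Z - {t}. \<delta> < \<bar>t - t'\<bar> / 2))"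
    by blast
  have \<delta>: "\<delta> > 0" "\<And>t. t \<in> Z \<Longrightarrow> \<delta> < \<delta>0 t" using \<delta>' by blast+
  have in_ab: "a < t - \<delta> \<and> t + \<delta> < b" if "t \<in> Z" for t
  proof -
    have "\<delta> < t - a \<and> \<delta> < b - t" using \<delta>' that by blast
    then show ?thesis by linarith
  qed
  have sep: "\<delta> < \<bar>t - t'\<bar> / 2" if "t \<in> Z" "t' \<in> Z" "t \<noteq> t'" for t t' using \<delta>' that by blast
  define J where "J t = {t - \<delta><..<t + \<delta>}" for t
  define K where "K = {a..b} - (\<Union>t\<in>Z. J t)"
  have K: "compact K" unfolding K_def J_def by (intro compact_diff compact_Icc open_UN) auto
  have K_nz: "u (cis \<theta>) \<noteq> 0" if "\<theta> \<in> K" for \<theta>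
  proof
    assume "u (cis \<theta>) = 0"
    then have "\<theta> \<in> Z" using that by (intro Z_eq) (auto simp: K_def)
    then show False using that \<delta>(1) by (auto simp: K_def J_def)
  qed
  have ind: "indicator {a..b} \<theta> = (\<Sum>t\<in>Z. indicator (J t) \<theta>) + (indicator K \<theta> :: real)" for \<theta>
  proof (cases "\<exists>t\<in>Z. \<theta> \<in> J t")
    case True
    then obtain t where t: "t \<in> Z" "\<theta> \<in> J t" by auto
    have "\<theta> \<notin> J t'" if "t' \<in> Z - {t}" for t'
      using sep[of t t'] that t by (auto simp: J_def abs_if split: if_splits)
    then have "(\<Sum>t'\<in>Z - {t}. indicator (J t') \<theta>) = (0::real)" by (intro sum.neutral) auto
    then have "(\<Sum>t\<in>Z. indicator (J t) \<theta>) = (1::real)"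
      using t finZ by (subst sum.remove[of _ t]) auto
    moreover have "\<theta> \<in> {a..b}" using t in_ab[OF t(1)] by (auto simp: J_def)
    moreover have "\<theta> \<notin> K" using t by (auto simp: K_def)
    ultimately show ?thesis by simp
  next
    case False
    then have "(\<Sum>t\<in>Z. indicator (J t) \<theta>) = (0::real)" by (intro sum.neutral) auto
    moreover have "\<theta> \<in> K \<longleftrightarrow> \<theta> \<in> {a..b}" using False by (auto simp: K_def)
    ultimately show ?thesis by (simp add: indicator_def)
  qed
  have split: "A r = 1 / (2 * pi) * ((\<Sum>t\<in>Z. \<integral>\<theta>. indicator (J t) \<theta> * F r \<theta> \<partial>lborel) + (\<integral>\<theta>. indicator K \<theta> * F r \<theta> \<partial>lborel))"
    if r: "0 < r" "r < 1" for r
  proof -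
    have contF: "continuous_on S (F r)" for S using r by (intro continuous_F) auto
    have [measurable]: "F r \<in> borel_measurable borel" by (rule borel_measurable_continuous_onI[OF contF])
    have iK: "integrable lborel (\<lambda>\<theta>. indicator K \<theta> * F r \<theta>)"
      using borel_integrable_compact[OF K contF] by simp
    have iab: "integrable lborel (\<lambda>\<theta>. indicator {a..b} \<theta> * F r \<theta>)"
      using borel_integrable_compact[OF compact_Icc contF] by simp
    have iJ: "integrable lborel (\<lambda>\<theta>. indicator (J t) \<theta> * F r \<theta>)" if "t \<in> Z" for t
      by (rule Bochner_Integration.integrable_bound[OF iab])
         (use in_ab[OF that] in \<open>auto simp: J_def indicator_def\<close>)
    have "(\<integral>\<theta>. indicator {a..b} \<theta> * F r \<theta> \<partial>lborel) = (\<integral>\<theta>. (\<Sum>t\<in>Z. indicator (J t) \<theta> * F r \<theta>) + indicator K \<theta> * F r \<theta> \<partial>lborel)"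
      unfolding ind by (simp add: distrib_right sum_distrib_right)
    also have "\<dots> = (\<Sum>t\<in>Z. \<integral>\<theta>. indicator (J t) \<theta> * F r \<theta> \<partial>lborel) + (\<integral>\<theta>. indicator K \<theta> * F r \<theta> \<partial>lborel)"
      using iJ iK by (simp add: Bochner_Integration.integral_add Bochner_Integration.integral_sum)
    finally show ?thesis using A_eq_shifted[of a r] a r pi_gt3 by (simp add: b_def)
  qed
  define L where "L t = (if N t = 2 * k then l t else 0)" for t
  have limJ: "((\<lambda>r. (1 - r) powr \<alpha> * (\<integral>\<theta>. indicator (J t) \<theta> * F r \<theta> \<partial>lborel)) \<longlongrightarrow> L t) (at_left 1)" if t: "t \<in> Z" for t
  proof -
    \<comment> \<open>The excess of the common exponent \<open>\<alpha>\<close> over the exponent of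
      this zero. It is positive exactly when the multiplicity is not maximal, and then the extra
      factor tends to 0.\<close>
    define \<beta> where "\<beta> = 1 / real (N t) - 1 / real (2 * k)"
    have lt: "((\<lambda>r. (1 - r) powr (1 - 1 / real (N t)) * (\<integral>\<theta>. indicator (J t) \<theta> * F r \<theta> \<partial>lborel)) \<longlongrightarrow> l t) (at_left 1)"
      unfolding J_def using \<delta>(1) \<delta>(2)[OF t] by (intro lim[OF t]) auto
    have Nle: "N t \<le> 2 * k" using kmax[OF t] N[OF t] by (auto elim!: evenE)
    show ?thesis
    proof (cases "N t = 2 * k")
      case True
      then show ?thesis using lt by (simp add: L_def \<alpha>_def)
    next
      case False
      then have "N t < 2 * k" using Nle by simp
      then have \<beta>: "\<beta> > 0" using N(2)[OF t] by (simp add: \<beta>_def frac_less2)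
      have "((\<lambda>r::real. (1 - r) powr \<beta>) \<longlongrightarrow> 0) (at_left 1)" using \<beta> by (rule one_minus_powr_tendsto_0)
      from tendsto_mult[OF this lt]
      have "((\<lambda>r. (1 - r) powr \<beta> * ((1 - r) powr (1 - 1 / real (N t)) * (\<integral>\<theta>. indicator (J t) \<theta> * F r \<theta> \<partial>lborel))) \<longlongrightarrow> 0) (at_left 1)"
        by simp
      moreover have "(1 - r) powr \<beta> * ((1 - r) powr (1 - 1 / real (N t)) * X) = (1 - r) powr \<alpha> * X" for r X :: real
        by (simp add: mult.assoc[symmetric] powr_add[symmetric] \<beta>_def \<alpha>_def)
      ultimately show ?thesis using False by (simp add: L_def)
    qed
  qed
  define C where "C = 1 / (2 * pi) * (\<Sum>t\<in>Z. L t)"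
  have "(\<Sum>t\<in>Z. L t) > 0"
  proof (rule sum_pos2[OF finZ t0(1)])
    show "0 < L t0" using l[OF t0(1)] t0(2) by (simp add: L_def)
    show "0 \<le> L t" if "t \<in> Z" for t using l[OF that] by (simp add: L_def)
  qed
  then have "C > 0" by (simp add: C_def)
  moreover have "((\<lambda>r. (1 - r) powr ((2 * real k - 1) / (2 * real k)) * A r) \<longlongrightarrow> C) (at_left 1)"
  proof (rule Lim_transform_eventually)
    have "((\<lambda>r. 1 / (2 * pi) * ((\<Sum>t\<in>Z. (1 - r) powr \<alpha> * (\<integral>\<theta>. indicator (J t) \<theta> * F r \<theta> \<partial>lborel)) +
        (1 - r) powr \<alpha> * (\<integral>\<theta>. indicator K \<theta> * F r \<theta> \<partial>lborel))) \<longlongrightarrow> 1 / (2 * pi) * ((\<Sum>t\<in>Z. L t) + 0)) (at_left 1)"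
      by (intro tendsto_mult_left tendsto_add tendsto_sum limJ zero_free_contribution[OF K K_nz \<alpha>(1)])
    then show "((\<lambda>r. 1 / (2 * pi) * ((\<Sum>t\<in>Z. (1 - r) powr \<alpha> * (\<integral>\<theta>. indicator (J t) \<theta> * F r \<theta> \<partial>lborel)) +
        (1 - r) powr \<alpha> * (\<integral>\<theta>. indicator K \<theta> * F r \<theta> \<partial>lborel))) \<longlongrightarrow> C) (at_left 1)"
      by (simp add: C_def)
    have "eventually (\<lambda>r. r \<in> {0<..<1}) (at_left (1::real))" by (rule eventually_at_left_real) simp
    then show "\<forall>\<^sub>F r in at_left 1. 1 / (2 * pi) * ((\<Sum>t\<in>Z. (1 - r) powr \<alpha> * (\<integral>\<theta>. indicator (J t) \<theta> * F r \<theta> \<partial>lborel)) +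
        (1 - r) powr \<alpha> * (\<integral>\<theta>. indicator K \<theta> * F r \<theta> \<partial>lborel)) = (1 - r) powr ((2 * real k - 1) / (2 * real k)) * A r"
    proof eventually_elim
      case (elim r)
      then have "0 < r" "r < 1" by auto
      then show ?case unfolding \<alpha>(2) split[OF \<open>0 < r\<close> \<open>r < 1\<close>] sum_distrib_left[symmetric] by (simp add: algebra_simps)
    qed
  qed
  ultimately show "\<exists>C>0. ((\<lambda>r. (1 - r) powr ((2 * real k - 1) / (2 * real k)) * A r) \<longlongrightarrow> C) (at_left 1)" by blast
qed

end

section \<open>The asymptotic formula\<close>

lemma ex_angle_representative: "\<exists>t\<in>{0..<2 * pi}. cis t = cis \<theta>"
proof -
  have "(cos \<theta>)\<^sup>2 + (sin \<theta>)\<^sup>2 = 1" by simp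
  then obtain t where "0 \<le> t" "t < 2 * pi" "cos \<theta> = cos t" "sin \<theta> = sin t" by (rule sincos_total_2pi)
  then show ?thesis by (intro bexI[of _ t]) (auto simp: complex_eq_iff)
qed

context finitely_dependent_gaussian
begin

lemma gpoly_nonzero:
  assumes "k \<noteq> 0" "\<gamma> k \<noteq> 0"
  shows "gpoly \<noteq> 0"
proof -
  define n where "n = nat \<bar>k\<bar>"
  have n: "n \<noteq> 0" using assms by (simp add: n_def)
  have "\<gamma> (int n) \<noteq> 0" using assms gamma_uminus[of k] by (cases "k \<ge> 0") (auto simp: n_def)
  then have nL: "n < L" using gamma_eq_0[of n] by (metis not_less)
  obtain j where j: "n = Suc j" using n by (cases n) auto
  have "coeff gpoly n = (\<Sum>k<L. if k = j then cnj (\<gamma> (int (Suc k))) else 0)"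
    unfolding gpoly_def coeff_sum by (intro sum.cong refl) (simp add: j del: of_nat_Suc)
  also have "\<dots> = cnj (\<gamma> (int n))" using nL by (simp add: j del: of_nat_Suc)
  finally have "coeff gpoly n \<noteq> 0" using \<open>\<gamma> (int n) \<noteq> 0\<close> by simp
  then show ?thesis by auto
qed

end

text \<open>For white noise, G vanishes, \<open>A\<close> is identically 0 and E N(r) = r^2 / (1 -
  r^2) exactly with exponent 0, so no positive constant could satisfy the asymptotic formula. The
  added assumption excludes this case.\<close>

locale dependent_gaussian = finitely_dependent_gaussian +
  assumes dependent: "\<exists>k. k \<noteq> 0 \<and> \<gamma> k \<noteq> 0"
begin

sublocale positive_potential gpoly
  using dependent gpoly_nonzero poly_gpoly_0 spectral_potential_lower
  by unfold_locales (auto simp: spectral_potential_eq)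

lemma u_eq: "u = spectral_potential \<gamma>"
  by (simp add: fun_eq_iff u_def spectral_potential_eq)

lemma spectral_density_eq: "spectral_density \<gamma> = (\<lambda>\<theta>. u (cis \<theta>))"
  by (simp add: fun_eq_iff spectral_density_def u_eq spectral_potential_def)

text \<open>The summand \<open>- ln (1 - r\<^sup>2) / 2\<close> of \<open>mean_log\<close> produces
  \<open>r\<^sup>2 / (1 - r\<^sup>2)\<close>, and \<open>log_potential\<close> produces the
  correction. Nonnegativity makes the passage through \<open>ennreal\<close> faithful.\<close>

lemma expected_zeros_eq:
  assumes r: "0 < r" "r < 1"
  shows "expected_zeros M \<xi> r = ennreal (r\<^sup>2 / (1 - r\<^sup>2) - A r)" and "0 \<le> r\<^sup>2 / (1 - r\<^sup>2) - A r"
proof -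
  have sq: "r\<^sup>2 < 1" using r by (simp add: power_less_one_iff)
  have "(log_potential has_real_derivative - 2 * A r / r) (at r)"
    using log_potential_deriv[OF r] unfolding u_eq log_potential_def[abs_def] .
  moreover have "((\<lambda>r. ln (1 - r\<^sup>2)) has_real_derivative - (2 * r / (1 - r\<^sup>2))) (at r)"
    using sq by (auto intro!: derivative_eq_intros simp: divide_simps)
  ultimately have "(mean_log has_real_derivative (- 2 * A r / r - - (2 * r / (1 - r\<^sup>2))) / 2) (at r)"
    unfolding mean_log_def[abs_def] by (intro DERIV_cdivide DERIV_diff)
  note * = expected_zeros_eq_deriv[OF r this]
  have "r * ((- 2 * A r / r - - (2 * r / (1 - r\<^sup>2))) / 2) = r\<^sup>2 / (1 - r\<^sup>2) - A r"
  proof -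
    have "r * ((- 2 * a / r - - (2 * r / X)) / 2) = r\<^sup>2 / X - a" if "X \<noteq> 0" for a X
      using r that by (simp add: field_simps power2_eq_square)
    then show ?thesis using sq by simp
  qed
  from *[unfolded this] show "expected_zeros M \<xi> r = ennreal (r\<^sup>2 / (1 - r\<^sup>2) - A r)" "0 \<le> r\<^sup>2 / (1 - r\<^sup>2) - A r" .
qed

lemma A_asymptotics: "\<exists>C>0. ((\<lambda>r. (1 - r) powr zero_exponent \<gamma> * A r) \<longlongrightarrow> C) (at_left 1)"
proof (cases "spectral_zeros \<gamma> = {}")
  case True
  have nz: "u (cis t) \<noteq> 0" for t
  proof -
    obtain t' where t': "t' \<in> {0..<2 * pi}" "cis t' = cis t" using ex_angle_representative by blast
    then have "spectral_density \<gamma> t' \<noteq> 0" using True by (auto simp: spectral_zeros_def)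
    then show ?thesis using t' by (simp add: spectral_density_eq)
  qed
  have "((\<lambda>r. (1 - r) powr zero_exponent \<gamma> * A r) \<longlongrightarrow> A 1) (at_left 1)"
  proof (rule Lim_transform_eventually[OF A_no_zeros(2)[OF nz]])
    show "\<forall>\<^sub>F r in at_left 1. A r = (1 - r) powr zero_exponent \<gamma> * A r"
      using True by (auto simp: eventually_at_filter zero_exponent_def)
  qed
  then show ?thesis using A_no_zeros(1)[OF nz] by blast
next
  case False
  have Z: "spectral_zeros \<gamma> = {t \<in> {0..<2 * pi}. u (cis t) = 0}"
    by (simp add: spectral_zeros_def spectral_density_eq)
  show ?thesis
    using A_zeros(2)[folded Z, OF False] False
    by (simp add: zero_exponent_def max_half_multiplicity_def spectral_density_eq)
qed

end

text \<open>Finiteness is asserted alongside the expansion because \<open>enn2real\<close> sends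
  infinity to 0.\<close>

theorem corollary1p5:
  fixes M :: "'a measure" and \<xi> :: "int \<Rightarrow> 'a \<Rightarrow> complex"
  assumes "prob_space M"
    and "complex_gaussian_process M \<xi>"
    and "stationary_process M \<xi>"
    and "centered_process M \<xi>"
    and "unit_variance M \<xi>"
    and "finitely_dependent M \<xi>"
    and "\<exists>k. k \<noteq> 0 \<and> autocov M \<xi> k \<noteq> 0"
  defines "\<alpha> \<equiv> zero_exponent (autocov M \<xi>)"
  shows "\<exists>C::real. C > 0 \<and>
    (\<forall>r\<in>{0<..<1}. expected_zeros M \<xi> r < \<infinity>) \<and>
    (\<lambda>r::real. enn2real (expected_zeros M \<xi> r) -
        (r\<^sup>2 / (1 - r\<^sup>2) - C * (1 - r\<^sup>2) powr (- \<alpha>)))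
      \<in> o[at_left 1](\<lambda>r. (1 - r\<^sup>2) powr (- \<alpha>))"
proof -
  interpret dependent_gaussian M \<xi>
    by (intro dependent_gaussian.intro finitely_dependent_gaussian.intro
        finitely_dependent_gaussian_axioms.intro dependent_gaussian_axioms.intro) (fact assms)+
  obtain C\<^sub>0 where C0: "C\<^sub>0 > 0" "((\<lambda>r. (1 - r) powr \<alpha> * A r) \<longlongrightarrow> C\<^sub>0) (at_left 1)"
    using A_asymptotics unfolding \<alpha>_def by blast
  \<comment> \<open>\<open>A\<close> was expanded in powers of \<open>1 - r\<close>. The factor
    \<open>2 powr \<alpha>\<close> is the limit of \<open>(1 + r) powr \<alpha>\<close> in the
    factorisation of \<open>(1 - r\<^sup>2) powr \<alpha>\<close>.\<close>
  define C where "C = 2 powr \<alpha> * C\<^sub>0"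
  have near: "eventually (\<lambda>r. r \<in> {0<..<1}) (at_left (1::real))" by (rule eventually_at_left_real) simp
  have "((\<lambda>r::real. (1 + r) powr \<alpha>) \<longlongrightarrow> (1 + 1) powr \<alpha>) (at_left 1)"
    by (intro tendsto_intros) auto
  from tendsto_mult[OF this C0(2)]
  have lim: "((\<lambda>r. C - (1 + r) powr \<alpha> * ((1 - r) powr \<alpha> * A r)) \<longlongrightarrow> C - C) (at_left 1)"
    by (intro tendsto_diff tendsto_const) (simp add: C_def)
  have "(\<lambda>r::real. enn2real (expected_zeros M \<xi> r) - (r\<^sup>2 / (1 - r\<^sup>2) - C * (1 - r\<^sup>2) powr (- \<alpha>)))
      \<in> o[at_left 1](\<lambda>r. (1 - r\<^sup>2) powr (- \<alpha>))"
  proof (rule smalloI_tendsto)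
    show "((\<lambda>r. (enn2real (expected_zeros M \<xi> r) - (r\<^sup>2 / (1 - r\<^sup>2) - C * (1 - r\<^sup>2) powr (- \<alpha>))) / (1 - r\<^sup>2) powr (- \<alpha>)) \<longlongrightarrow> 0) (at_left 1)"
    proof (rule Lim_transform_eventually[OF lim[unfolded diff_self]])
      show "\<forall>\<^sub>F r in at_left 1. C - (1 + r) powr \<alpha> * ((1 - r) powr \<alpha> * A r) =
        (enn2real (expected_zeros M \<xi> r) - (r\<^sup>2 / (1 - r\<^sup>2) - C * (1 - r\<^sup>2) powr (- \<alpha>))) / (1 - r\<^sup>2) powr (- \<alpha>)"
        using near
      proof eventually_elim
        case (elim r)
        then have r: "0 < r" "r < 1" by auto
        have fac: "1 - r\<^sup>2 = (1 + r) * (1 - r)" by (simp add: power2_eq_square algebra_simps)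
        have "r\<^sup>2 < 1" using r by (simp add: power_less_one_iff)
        then have pos: "0 < (1 - r\<^sup>2) powr \<alpha>" by simp
        have pw: "(1 - r\<^sup>2) powr \<alpha> = (1 + r) powr \<alpha> * (1 - r) powr \<alpha>"
          unfolding fac by (rule powr_mult)
        have "enn2real (expected_zeros M \<xi> r) = r\<^sup>2 / (1 - r\<^sup>2) - A r"
          using expected_zeros_eq[OF r] by simp
        then have "enn2real (expected_zeros M \<xi> r) - (r\<^sup>2 / (1 - r\<^sup>2) - C * (1 - r\<^sup>2) powr (- \<alpha>)) = C / (1 - r\<^sup>2) powr \<alpha> - A r"
          by (simp add: powr_minus_divide)
        also have "\<dots> / (1 - r\<^sup>2) powr (- \<alpha>) = C - (1 - r\<^sup>2) powr \<alpha> * A r"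
          using pos by (simp add: powr_minus_divide field_simps)
        finally show ?case unfolding pw by (simp add: mult.assoc)
      qed
    qed
    show "\<forall>\<^sub>F r in at_left 1. (1 - r\<^sup>2) powr (- \<alpha>) \<noteq> 0"
      using near
    proof eventually_elim
      case (elim r)
      then have "r\<^sup>2 < 1" by (simp add: power_less_one_iff)
      then show ?case by simp
    qed
  qed
  moreover have "\<forall>r\<in>{0<..<1}. expected_zeros M \<xi> r < \<infinity>"
    using expected_zeros_eq(1) by simp
  moreover have "C > 0" using C0 by (simp add: C_def)
  ultimately show ?thesis by blast
qed

end
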